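(* Let $n\ge 1$ and let $\xi_1,\dots,\xi_n$ be independent random variables with values in a measurable space $(\mathbb{X},\mathcal{X})$, all having the same distribution $\mathbb{P}$. Let $\mathcal{F}$ be a countable family of real-valued measurable functions on $(\mathbb{X},\mathcal{X})$ which are $\mathbb{P}$-centered and satisfy $\|f\|_\infty\le 1$ for all $f\in\mathcal{F}$. Assume that $\mathcal{F}$ is a VC subgraph class of index $d\ge 1$. Let $\sigma\ge 0$ be defined by $\sigma^2=\sup_{f\in\mathcal{F}}\mathbb{E}(f^2(\xi_1))$, and put $$Z=\sup_{f\in\mathcal{F}}\left|\sum_{i=1}^n f(\xi_i)\right|,\qquad \kappa(\eta)=2.5+32\eta^{-1}.$$ Then for all real numbers $\eta>0$ and $x>0$: (1) if $\sigma>0$, then $$\Pr\left(Z>(1+\eta)\left(60\sqrt{d}\,\sqrt{n\sigma^2\log(55/\sigma)}+14400\,d\log(55/\sigma)\right)+\sigma\sqrt{8nx}+\kappa(\eta)x\right)\le e^{-x};$$ (2) (using the upper bound $1$ in place of $\sigma$, with no further assumption on $\sigma$) $$\Pr\left(Z>(1+\eta)\left(121\sqrt{d}\sqrt{n}+58000\,d\right)+\sqrt{8nx}+\kappa(\eta)x\right)\le e^{-x}.$$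
   Context: A function $f$ is $\mathbb{P}$-centered if $\int f\,d\mathbb{P}=0$, i.e. $\mathbb{E}(f(\xi_i))=0$; $\|f\|_\infty$ is the supremum norm; $\log$ is the natural logarithm. A class $\mathcal{C}$ of subsets of a set $S$ shatters a finite set $A\subset S$ if for every $B\subset A$ there is $C\in\mathcal{C}$ with $B=A\cap C$. $\mathcal{C}$ is a VC (Vapnik--Chervonenkis) class of index $d$ if $d$ is the largest (finite) number such that $\mathcal{C}$ shatters at least one set of cardinality $d$. The subgraph of $f:\mathbb{X}\to\mathbb{R}$ is $C_f=\{(x,t)\in\mathbb{X}\times\mathbb{R}: t\le f(x)\}$. $\mathcal{F}$ is a VC subgraph class of index $d$ if $\{C_f: f\in\mathcal{F}\}$ is a VC class of index $d$ of subsets of $\mathbb{X}\times\mathbb{R}$. *)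

theory Defs
  imports "HOL-Probability.Probability"
begin

text \<open>The supremum is taken in the extended reals, so that the norm of an unbounded
  function is \<^term>\<open>\<infinity> :: ereal\<close> and not an unspecified real number. It is a pointwise
  supremum, not an essential one.\<close>

definition sup_norm :: "'a set \<Rightarrow> ('a \<Rightarrow> real) \<Rightarrow> ereal" where
  "sup_norm X f = (SUP x\<in>X. ereal \<bar>f x\<bar>)"

definition centered :: "'a measure \<Rightarrow> ('a \<Rightarrow> real) \<Rightarrow> bool" where
  "centered P f \<longleftrightarrow> integrable P f \<and> integral\<^sup>L P f = 0"

definition shatters :: "'a set set \<Rightarrow> 'a set \<Rightarrow> bool" where
  "shatters \<C> A \<longleftrightarrow> finite A \<and> (\<forall>B\<subseteq>A. \<exists>C\<in>\<C>. B = A \<inter> C)"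

definition VC_class_of_index :: "'a set \<Rightarrow> 'a set set \<Rightarrow> nat \<Rightarrow> bool" where
  "VC_class_of_index S \<C> d \<longleftrightarrow> \<C> \<subseteq> Pow S \<and>
     (\<exists>A\<subseteq>S. card A = d \<and> shatters \<C> A) \<and>
     (\<forall>k. (\<exists>A\<subseteq>S. card A = k \<and> shatters \<C> A) \<longrightarrow> k \<le> d)"

definition subgraph :: "'a set \<Rightarrow> ('a \<Rightarrow> real) \<Rightarrow> ('a \<times> real) set" where
  "subgraph X f = {(x, t). x \<in> X \<and> t \<le> f x}"

definition VC_subgraph_class_of_index :: "'a set \<Rightarrow> ('a \<Rightarrow> real) set \<Rightarrow> nat \<Rightarrow> bool" where
  "VC_subgraph_class_of_index X \<F> d \<longleftrightarrow>
     VC_class_of_index (X \<times> UNIV) (subgraph X ` \<F>) d"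

text \<open>The real-valued supremum below is only meaningful when \<open>\<F>\<close> is nonempty and the
  sums are bounded uniformly in \<open>\<F>\<close>. Both hold for a VC subgraph class of index at least
  one whose members have supremum norm at most one.\<close>

definition emp_sup :: "nat \<Rightarrow> ('a \<Rightarrow> real) set \<Rightarrow> (nat \<Rightarrow> 'w \<Rightarrow> 'a) \<Rightarrow> 'w \<Rightarrow> real" where
  "emp_sup n \<F> \<xi> \<omega> = (SUP f\<in>\<F>. \<bar>\<Sum>i=1..n. f (\<xi> i \<omega>)\<bar>)"

definition kappa :: "real \<Rightarrow> real" where
  "kappa \<eta> = 2.5 + 32 * inverse \<eta>"

end

theory Submission
  imports Defs
begin

text \<open>
  The supremum \<open>Z\<close> is close to its mean because of a concentration inequality, and its mean is
  small because a VC subgraph class has small packing numbers. Both halves are proved for finite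
  subfamilies, with constants that depend on the family only through \<open>d\<close> and an upper bound
  \<open>\<tau> \<le> 1\<close> of the standard deviations. Exhausting the countable family by finite ones gives the
  first claim for \<open>\<tau> = \<sigma>\<close> and the second for \<open>\<tau> = 1\<close>.

  \<^emph>\<open>Concentration.\<close> The entropy of \<open>Y = exp (l * Z)\<close> under a product measure is at most the sum over
  the coordinates of the cost of replacing \<open>Y\<close> by a quantity that ignores this coordinate
  (\<open>entropy_tensorization\<close>). For coordinate \<open>i\<close>, compare \<open>Z\<close> with the supremum \<open>Z\<^sub>i\<close> of the sums
  that omit the \<open>i\<close>-th term. The increment \<open>Z - Z\<^sub>i\<close> is at most 1, is at least the value at the
  \<open>i\<close>-th point of a function that is optimal for \<open>Z\<^sub>i\<close>, hence chosen independently of this point and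
  centered, and the increments sum to at most \<open>Z\<close>. With the elementary \<open>one_sided_exp_inequality\<close>
  this yields, following Bousquet, a differential inequality for the logarithm of the
  moment generating function (\<open>max_sum_entropy\<close>). Solving it (\<open>herbst_argument\<close>) bounds the tail of \<open>Z\<close> beyond
  \<open>E + 2 * sqrt ((n * \<tau>\<^sup>2 / 2 + E) * x) + x\<close> by \<open>exp (- x)\<close> for every positive \<open>E\<close> that is at least
  the mean (\<open>max_sum_tail\<close>). Splitting the square root and using
  \<open>2 * sqrt (E * x) \<le> \<eta> * E + x / \<eta>\<close> puts this in the required form (\<open>threshold_le\<close>).

  \<^emph>\<open>The mean.\<close> Let \<open>N\<close> be a set of functions that are pairwise separated in the empirical
  \<open>L\<^sup>2\<close> distance. Few points of the product of the sample with \<open>[-1, 1]\<close> tell all their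
  subgraphs apart, and by the Sauer-Shelah lemma a VC class leaves only polynomially many traces on
  those points; this bounds \<open>card N\<close> (\<open>VC_packing_bound\<close>). Chaining over nets at
  geometrically decreasing scales then bounds the Rademacher average of the class by a multiple of
  the empirical radius (\<open>chaining_bound\<close>). As the functions are centered, \<open>Z\<close> is bounded in mean by
  twice its Rademacher version (\<open>symmetrization\<close>). The squared empirical radius is itself
  the supremum of an empirical process, indexed by the squares of the functions, to which
  the same two steps apply; this gives a quadratic inequality for the mean squared
  radius. Solving it bounds the mean of \<open>Z\<close> by \<open>VC_mean_bound\<close>
  (\<open>expected_sup_VC_bound\<close>), which lies below the deterministic terms of both claims.
\<close>

section \<open>Sauer-Shelah and packing numbers of VC subgraph classes\<close>

text \<open>Pajor's form of the Sauer-Shelah lemma. Removing a point \<open>a\<close> splits the class into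
  the traces on the rest and those traces that extend both with and without \<open>a\<close>. A set shattered
  by the second family stays shattered after adding \<open>a\<close>, so the two counts of
  shattered sets add up.\<close>
lemma card_le_card_shattered:
  assumes "finite A" and "\<C> \<subseteq> Pow A"
  shows "card \<C> \<le> card {B. B \<subseteq> A \<and> shatters \<C> B}"
  using assms
proof (induction A arbitrary: \<C> rule: finite_induct)
  case empty
  show ?case
  proof (cases "\<C> = {}")
    case False
    then have "\<C> = {{}}" using empty by auto
    then have "{B. B \<subseteq> {} \<and> shatters \<C> B} = {{}}" by (auto simp: shatters_def)
    then show ?thesis using \<open>\<C> = {{}}\<close> by simp
  qed simp
next
  case (insert a A)
  define \<D> where "\<D> = {C. C \<subseteq> A \<and> (C \<in> \<C> \<or> insert a C \<in> \<C>)}"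
  define \<E> where "\<E> = {C. C \<subseteq> A \<and> C \<in> \<C> \<and> insert a C \<in> \<C>}"
  define \<C>0 where "\<C>0 = {C. C \<subseteq> A \<and> C \<in> \<C>}"
  define \<C>1 where "\<C>1 = {C. C \<subseteq> A \<and> insert a C \<in> \<C>}"
  have fin: "finite (Pow A)" using insert by simp
  have finC: "finite \<C>0" "finite \<C>1"
    by (rule finite_subset[OF _ fin], auto simp: \<C>0_def \<C>1_def)+
  have split: "\<C> = \<C>0 \<union> insert a ` \<C>1"
  proof (intro equalityI subsetI)
    fix C assume C: "C \<in> \<C>"
    then have CA: "C \<subseteq> insert a A" using insert.prems by auto
    show "C \<in> \<C>0 \<union> insert a ` \<C>1"
    proof (cases "a \<in> C")
      case True
      then have "insert a (C - {a}) = C" by auto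
      then have "C - {a} \<in> \<C>1" using C CA by (auto simp: \<C>1_def)
      then show ?thesis using \<open>insert a (C - {a}) = C\<close> by blast
    qed (use C CA in \<open>auto simp: \<C>0_def\<close>)
  qed (auto simp: \<C>0_def \<C>1_def)
  have inj: "inj_on (insert a) \<C>1"
    using insert.hyps by (auto simp: \<C>1_def inj_on_def)
  have "card \<C> = card \<C>0 + card (insert a ` \<C>1)"
    unfolding split using finC insert.hyps
    by (intro card_Un_disjoint) (auto simp: \<C>0_def)
  also have "\<dots> = card \<C>0 + card \<C>1" using card_image[OF inj] by simp
  also have "\<dots> = card (\<C>0 \<union> \<C>1) + card (\<C>0 \<inter> \<C>1)" by (rule card_Un_Int[OF finC])
  also have "\<C>0 \<union> \<C>1 = \<D>" by (auto simp: \<C>0_def \<C>1_def \<D>_def)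
  also have "\<C>0 \<inter> \<C>1 = \<E>" by (auto simp: \<C>0_def \<C>1_def \<E>_def)
  finally have card_eq: "card \<C> = card \<D> + card \<E>" .
  let ?SD = "{B. B \<subseteq> A \<and> shatters \<D> B}" and ?SE = "{B. B \<subseteq> A \<and> shatters \<E> B}"
  have IH: "card \<D> \<le> card ?SD" "card \<E> \<le> card ?SE"
    by (rule insert.IH, auto simp: \<D>_def \<E>_def)+
  have finS: "finite ?SD" "finite ?SE" by (rule finite_subset[OF _ fin], auto)+
  have injS: "inj_on (insert a) ?SE" using insert.hyps by (auto simp: inj_on_def)
  have sub: "?SD \<union> insert a ` ?SE \<subseteq> {B. B \<subseteq> insert a A \<and> shatters \<C> B}"
  proof (intro subsetI, elim UnE)
    fix B assume "B \<in> ?SD"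
    then have B: "B \<subseteq> A" "shatters \<D> B" by auto
    have "shatters \<C> B" unfolding shatters_def
    proof (intro conjI allI impI)
      show "finite B" using B by (simp add: shatters_def)
      fix B' assume "B' \<subseteq> B"
      then obtain C where C: "C \<in> \<D>" "B' = B \<inter> C" using B unfolding shatters_def by blast
      then consider "C \<in> \<C>" | "insert a C \<in> \<C>" by (auto simp: \<D>_def)
      then show "\<exists>C\<in>\<C>. B' = B \<inter> C"
      proof cases
        case 2
        have "B' = B \<inter> insert a C" using C(2) B(1) insert.hyps by auto
        with 2 show ?thesis by blast
      qed (use C in blast)
    qed
    with B show "B \<in> {B. B \<subseteq> insert a A \<and> shatters \<C> B}" by auto
  next
    fix B' assume "B' \<in> insert a ` ?SE"
    then obtain B where B: "B' = insert a B" "B \<subseteq> A" "shatters \<E> B" by auto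
    have "shatters \<C> B'" unfolding shatters_def
    proof (intro conjI allI impI)
      show "finite B'" using B by (simp add: shatters_def)
      fix D assume D: "D \<subseteq> B'"
      then have "D - {a} \<subseteq> B" using B by auto
      then obtain C where C: "C \<in> \<E>" "D - {a} = B \<inter> C" using B unfolding shatters_def by blast
      then have CC: "C \<in> \<C>" "insert a C \<in> \<C>" "a \<notin> C" using insert.hyps by (auto simp: \<E>_def)
      show "\<exists>C\<in>\<C>. D = B' \<inter> C"
      proof (cases "a \<in> D")
        case True
        then have "D = B' \<inter> insert a C" using C(2) B(1) by auto
        with CC show ?thesis by blast
      next
        case False
        then have "D = B' \<inter> C" using C(2) B(1) CC(3) by auto
        with CC show ?thesis by blast
      qed
    qed
    with B show "B' \<in> {B. B \<subseteq> insert a A \<and> shatters \<C> B}" by auto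
  qed
  have "card \<C> \<le> card ?SD + card (insert a ` ?SE)"
    using IH card_image[OF injS] by (simp add: card_eq)
  also have "\<dots> = card (?SD \<union> insert a ` ?SE)"
    using finS insert.hyps by (intro card_Un_disjoint[symmetric]) auto
  also have "\<dots> \<le> card {B. B \<subseteq> insert a A \<and> shatters \<C> B}"
    by (rule card_mono[OF _ sub]) (rule finite_subset[of _ "Pow (insert a A)"], use insert.hyps in auto)
  finally show ?case .
qed

text \<open>Multiply the \<open>i\<close>-th term by \<open>(m / d) ^ (d - i) \<ge> 1\<close>, complete the sum to the binomial
  expansion of \<open>(1 + d / m) ^ m\<close> and bound the latter by \<open>exp d\<close>.\<close>
lemma sum_binomial_le:
  assumes "1 \<le> d" and "d \<le> m"
  shows "(\<Sum>i\<le>d. real (m choose i)) \<le> (exp 1 * m / d) ^ d"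
proof -
  have d: "real d > 0" and m: "real m > 0" using assms by auto
  let ?q = "real m / real d"
  have q: "?q \<ge> 1" using assms by (simp add: field_simps)
  have "(\<Sum>i\<le>d. real (m choose i)) \<le> (\<Sum>i\<le>d. real (m choose i) * ?q ^ (d - i))"
    using q by (intro sum_mono) (simp add: mult_left_le one_le_power mult_le_cancel_left1)
  also have "\<dots> = (\<Sum>i\<le>d. ?q ^ d * (real (m choose i) * (d / m) ^ i))"
  proof (intro sum.cong refl)
    fix i assume "i \<in> {..d}"
    then have "?q ^ d = ?q ^ (d - i) * ?q ^ i" by (simp add: power_add[symmetric])
    moreover have "?q ^ i * (real d / real m) ^ i = 1"
      using d m by (simp add: power_mult_distrib[symmetric])
    ultimately show "real (m choose i) * ?q ^ (d - i) = ?q ^ d * (real (m choose i) * (d / m) ^ i)"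
      by simp
  qed
  also have "\<dots> \<le> (\<Sum>i\<le>m. ?q ^ d * (real (m choose i) * (d / m) ^ i))"
    using assms q by (intro sum_mono2) auto
  also have "\<dots> = ?q ^ d * (d / m + 1) ^ m"
    by (simp add: binomial_ring sum_distrib_left)
  also have "\<dots> \<le> ?q ^ d * exp (d / m) ^ m"
    using exp_ge_add_one_self[of "real d / real m"] q
    by (intro mult_left_mono power_mono) (auto simp: add.commute)
  also have "exp (real d / real m) ^ m = exp 1 ^ d"
    using m by (simp add: exp_of_nat_mult[symmetric])
  finally show ?thesis by (simp add: power_mult_distrib[symmetric] mult.commute power_divide)
qed

lemma card_traces_le:
  assumes A: "finite A" "card A \<le> m" and d: "1 \<le> d" "d \<le> m"
    and vc: "\<And>B. B \<subseteq> A \<Longrightarrow> shatters \<C> B \<Longrightarrow> card B \<le> d"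
  shows "real (card ((\<lambda>C. A \<inter> C) ` \<C>)) \<le> (exp 1 * m / d) ^ d"
proof -
  let ?T = "(\<lambda>C. A \<inter> C) ` \<C>"
  have sub: "{B. B \<subseteq> A \<and> shatters ?T B} \<subseteq> (\<Union>i\<le>d. {B. B \<subseteq> A \<and> card B = i})"
  proof
    fix B assume "B \<in> {B. B \<subseteq> A \<and> shatters ?T B}"
    then have B: "B \<subseteq> A" "shatters ?T B" by auto
    have "shatters \<C> B" unfolding shatters_def
    proof (intro conjI allI impI)
      show "finite B" using B by (simp add: shatters_def)
      fix B' assume "B' \<subseteq> B"
      then obtain C where "C \<in> \<C>" "B' = B \<inter> (A \<inter> C)" using B unfolding shatters_def by blast
      then show "\<exists>C\<in>\<C>. B' = B \<inter> C" using B(1) by blast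
    qed
    then have "card B \<le> d" using vc B by auto
    then show "B \<in> (\<Union>i\<le>d. {B. B \<subseteq> A \<and> card B = i})" using B by auto
  qed
  have "card ?T \<le> card {B. B \<subseteq> A \<and> shatters ?T B}"
    by (rule card_le_card_shattered) (use A in auto)
  also have "\<dots> \<le> card (\<Union>i\<le>d. {B. B \<subseteq> A \<and> card B = i})"
    by (rule card_mono[OF _ sub]) (rule finite_subset[of _ "Pow A"], use A in auto)
  also have "\<dots> \<le> (\<Sum>i\<le>d. card {B. B \<subseteq> A \<and> card B = i})"
    by (rule card_UN_le) simp
  also have "\<dots> = (\<Sum>i\<le>d. card A choose i)"
    using A by (simp add: n_subsets)
  also have "\<dots> \<le> (\<Sum>i\<le>d. m choose i)"
    by (intro sum_mono binomial_right_mono A)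
  finally have "real (card ?T) \<le> real (\<Sum>i\<le>d. m choose i)" by (simp only: of_nat_le_iff)
  also have "\<dots> = (\<Sum>i\<le>d. real (m choose i))" by simp
  also have "\<dots> \<le> (exp 1 * m / d) ^ d" by (rule sum_binomial_le[OF d])
  finally show ?thesis .
qed

text \<open>A derandomized union bound: if some point always hits a fraction \<open>\<alpha>\<close> of the elements
  not yet hit, choosing such points greedily leaves at most a fraction
  \<open>(1 - \<alpha>) ^ m\<close> after \<open>m\<close> steps.\<close>
lemma greedy_hitting_set:
  fixes \<alpha> :: real
  assumes E: "finite E" and \<alpha>: "\<alpha> \<le> 1"
    and avg: "\<And>E'. E' \<subseteq> E \<Longrightarrow> E' \<noteq> {} \<Longrightarrow> \<exists>z\<in>Z. \<alpha> * card E' \<le> card {e\<in>E'. hit z e}"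
  shows "\<exists>A. finite A \<and> A \<subseteq> Z \<and> card A \<le> m
           \<and> real (card {e\<in>E. \<forall>z\<in>A. \<not> hit z e}) \<le> (1 - \<alpha>) ^ m * card E"
proof (induction m)
  case 0
  show ?case by (intro exI[of _ "{}"]) simp
next
  case (Suc m)
  then obtain A where A: "finite A" "A \<subseteq> Z" "card A \<le> m"
    "real (card {e\<in>E. \<forall>z\<in>A. \<not> hit z e}) \<le> (1 - \<alpha>) ^ m * card E" by auto
  let ?E' = "{e\<in>E. \<forall>z\<in>A. \<not> hit z e}"
  show ?case
  proof (cases "?E' = {}")
    case True
    have "0 \<le> (1 - \<alpha>) ^ Suc m * card E" using \<alpha> by (intro mult_nonneg_nonneg zero_le_power) auto
    moreover have "card ?E' = 0" using True by (simp only: card.empty)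
    ultimately have "real (card ?E') \<le> (1 - \<alpha>) ^ Suc m * card E" by linarith
    then show ?thesis using A by (intro exI[of _ A] conjI le_SucI)
  next
    case False
    then obtain z where z: "z \<in> Z" "\<alpha> * card ?E' \<le> card {e\<in>?E'. hit z e}"
      using avg[of ?E'] by auto
    let ?H = "{e\<in>?E'. hit z e}"
    have fin: "finite ?E'" "finite ?H" using E by auto
    have sdiff: "{e\<in>E. \<forall>z\<in>insert z A. \<not> hit z e} = ?E' - ?H" by auto
    have "real (card {e\<in>E. \<forall>z\<in>insert z A. \<not> hit z e}) = real (card ?E') - real (card ?H)"
    proof -
      have "card (?E' - ?H) = card ?E' - card ?H" using fin by (intro card_Diff_subset) auto
      moreover have "card ?H \<le> card ?E'" using fin by (intro card_mono) auto
      ultimately show ?thesis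
        by (simp only: sdiff of_nat_diff)
    qed
    also have "\<dots> \<le> (1 - \<alpha>) * card ?E'" using z(2) by (simp add: algebra_simps)
    also have "\<dots> \<le> (1 - \<alpha>) * ((1 - \<alpha>) ^ m * card E)"
      using A(4) \<alpha> by (intro mult_left_mono) auto
    finally have "real (card {e\<in>E. \<forall>z\<in>insert z A. \<not> hit z e}) \<le> (1 - \<alpha>) ^ Suc m * card E"
      by simp
    moreover have "card (insert z A) \<le> Suc m" using A card_insert_le_m1[of "Suc m" A z] by simp
    moreover have "finite (insert z A)" "insert z A \<subseteq> Z" using A(1,2) z(1) by auto
    ultimately show ?thesis by (intro exI[of _ "insert z A"] conjI)
  qed
qed

text \<open>An averaging argument. A level \<open>t\<close> separates \<open>p e i\<close> from \<open>q e i\<close> exactly if it lies in the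
  interval between them, whose length is \<open>\<bar>p e i - q e i\<bar>\<close>. If each pair \<open>(i, t)\<close> separated
  fewer than the claimed number of elements, integrating over \<open>t \<in> [-1, 1]\<close> and summing over
  \<open>i\<close> would contradict the lower bound on the distances.\<close>
lemma exists_separating_level:
  fixes p q :: "'e \<Rightarrow> 'i \<Rightarrow> real" and \<alpha> :: real
  assumes I: "finite I" and E: "finite E" "E \<noteq> {}"
    and range: "\<And>e i. e \<in> E \<Longrightarrow> i \<in> I \<Longrightarrow> \<bar>p e i\<bar> \<le> 1 \<and> \<bar>q e i\<bar> \<le> 1"
    and far: "\<And>e. e \<in> E \<Longrightarrow> 2 * \<alpha> * card I < (\<Sum>i\<in>I. \<bar>p e i - q e i\<bar>)"
  shows "\<exists>i\<in>I. \<exists>t. \<alpha> * card E \<le> card {e\<in>E. (t \<le> p e i) \<noteq> (t \<le> q e i)}"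
proof (rule ccontr)
  assume neg: "\<not> ?thesis"
  let ?S = "\<lambda>e i. {min (p e i) (q e i)<..max (p e i) (q e i)}"
  have card_eq: "real (card {e\<in>E. (t \<le> p e i) \<noteq> (t \<le> q e i)}) = (\<Sum>e\<in>E. indicator (?S e i) t)" for i t
  proof -
    have "(\<Sum>e\<in>E. indicator (?S e i) t :: real) = (\<Sum>e\<in>E. if (t \<le> p e i) \<noteq> (t \<le> q e i) then 1 else 0)"
      by (intro sum.cong) (auto simp: indicator_def min_def max_def)
    also have "\<dots> = real (card {e\<in>E. (t \<le> p e i) \<noteq> (t \<le> q e i)})"
      using E by (simp add: sum.If_cases Int_def)
    finally show ?thesis ..
  qed
  have one: "(\<Sum>e\<in>E. \<bar>p e i - q e i\<bar>) \<le> 2 * \<alpha> * card E" if i: "i \<in> I" for i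
  proof -
    have len: "measure lborel (?S e i) = \<bar>p e i - q e i\<bar>" for e
      by (auto simp: min_def max_def)
    have int: "integrable lborel (\<lambda>t. indicator (?S e i) t :: real)" for e
      by (intro integrable_real_indicator) (auto simp: min_def max_def)
    have "(\<Sum>e\<in>E. \<bar>p e i - q e i\<bar>) = (\<integral>t. (\<Sum>e\<in>E. indicator (?S e i) t) \<partial>lborel)"
      using int len by (subst Bochner_Integration.integral_sum) auto
    also have "\<dots> \<le> (\<integral>t. \<alpha> * card E * indicator {-1..1::real} t \<partial>lborel)"
    proof (rule Bochner_Integration.integral_mono)
      fix t :: real
      show "(\<Sum>e\<in>E. indicator (?S e i) t) \<le> \<alpha> * card E * indicator {-1..1} t"
      proof (cases "t \<in> {-1..1}")
        case True
        have "real (card {e\<in>E. (t \<le> p e i) \<noteq> (t \<le> q e i)}) \<le> \<alpha> * card E"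
          using neg i by (meson linear)
        then show ?thesis using True card_eq[of t i] by simp
      next
        case False
        then have "(\<Sum>e\<in>E. indicator (?S e i) t :: real) = 0"
        proof (intro sum.neutral ballI)
          fix e assume "e \<in> E"
          then have "\<bar>p e i\<bar> \<le> 1" "\<bar>q e i\<bar> \<le> 1" using range i by auto
          then have "t \<notin> ?S e i" using False by (auto simp: min_def max_def abs_le_iff split: if_splits)
          then show "indicator (?S e i) t = (0::real)" by simp
        qed
        then show ?thesis using False by simp
      qed
    qed (use int in auto)
    also have "\<dots> = 2 * \<alpha> * card E" by simp
    finally show ?thesis .
  qed
  have "2 * \<alpha> * card I * card E = (\<Sum>e\<in>E. 2 * \<alpha> * card I)" by simp
  also have "\<dots> < (\<Sum>e\<in>E. \<Sum>i\<in>I. \<bar>p e i - q e i\<bar>)"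
    using E far by (intro sum_strict_mono) auto
  also have "\<dots> = (\<Sum>i\<in>I. \<Sum>e\<in>E. \<bar>p e i - q e i\<bar>)" by (rule sum.swap)
  also have "\<dots> \<le> (\<Sum>i\<in>I. 2 * \<alpha> * card E)" by (intro sum_mono one)
  finally show False by simp
qed

lemma ln_one_plus_le: "ln (1 + y) \<le> (1 + y) / 2 + ln 2 - 1" if "0 \<le> y" for y :: real
proof -
  have "ln ((1 + y) / 2) \<le> (1 + y) / 2 - 1" using that by (intro ln_le_minus_one) auto
  moreover have "ln ((1 + y) / 2) = ln (1 + y) - ln 2" using that by (simp add: ln_div)
  ultimately show ?thesis by (simp add: field_simps)
qed

text \<open>Separation by \<open>e\<close> in the empirical \<open>L\<^sup>2\<close> distance forces the subgraphs to differ on a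
  fraction \<open>\<alpha> = e\<^sup>2 / 4\<close> of the points \<open>(x i, t)\<close> with \<open>\<bar>t\<bar> \<le> 1\<close>: a factor 2 is lost from the square
  to the absolute value, and \<open>[-1, 1]\<close> has length 2. About \<open>2 * ln (card N) / \<alpha>\<close>
  such points therefore distinguish all members of \<open>N\<close>, and the count of traces gives an
  inequality for \<open>ln (card N)\<close> that contains this logarithm on both sides, but on the
  larger side only inside another logarithm.\<close>
lemma VC_packing_bound:
  fixes x :: "'i \<Rightarrow> 'a" and N :: "('a \<Rightarrow> real) set" and e :: real
  assumes I: "finite I" and x: "\<And>i. i \<in> I \<Longrightarrow> x i \<in> X"
    and N: "finite N" "N \<noteq> {}"
    and bounded: "\<And>f y. f \<in> N \<Longrightarrow> y \<in> X \<Longrightarrow> \<bar>f y\<bar> \<le> 1"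
    and vc: "\<And>A. A \<subseteq> X \<times> UNIV \<Longrightarrow> shatters (subgraph X ` N) A \<Longrightarrow> card A \<le> d"
    and d: "1 \<le> d" and e: "0 < e" "e \<le> 1"
    and sep: "\<And>f g. f \<in> N \<Longrightarrow> g \<in> N \<Longrightarrow> f \<noteq> g \<Longrightarrow>
        real (card I) * e\<^sup>2 < (\<Sum>i\<in>I. (f (x i) - g (x i))\<^sup>2)"
  shows "ln (card N) \<le> d * (1 + 4 * ln 2 + 2 * ln (4 / e\<^sup>2))"
proof -
  define \<alpha> where "\<alpha> = e\<^sup>2 / 4"
  have \<alpha>: "0 < \<alpha>" "\<alpha> \<le> 1" using e power_le_one[of e 2] by (auto simp: \<alpha>_def)
  define M where "M = real (card N)"
  have M: "M \<ge> 1" using N by (simp add: M_def Suc_leI card_gt_0_iff)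
  define y where "y = ln M / d"
  have y: "y \<ge> 0" using M by (simp add: y_def)
  \<comment> \<open>The summand \<open>2 * ln M / \<alpha>\<close> makes \<open>(1 - \<alpha>) ^ m\<close> at most the inverse of the number of pairs;
    \<open>d\<close> is added because the bound on the number of traces needs \<open>d \<le> m\<close>.\<close>
  define m where "m = nat \<lceil>2 * ln M / \<alpha>\<rceil> + d"
  have m_ge: "2 * ln M / \<alpha> \<le> m" and dm: "d \<le> m"
    unfolding m_def by linarith+
  have "0 \<le> 2 * ln M / \<alpha>" using M \<alpha> by simp
  then have m_le: "m \<le> 2 * ln M / \<alpha> + 1 + d" unfolding m_def by linarith
  define E where "E = {(f, g). f \<in> N \<and> g \<in> N \<and> f \<noteq> g}"
  have E_sub: "E \<subseteq> N \<times> N" by (auto simp: E_def)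
  have finE: "finite E" using N E_sub finite_subset by blast
  let ?hit = "\<lambda>z (f, g). (snd z \<le> f (fst z)) \<noteq> (snd z \<le> g (fst z))"
  have "\<exists>A. finite A \<and> A \<subseteq> X \<times> UNIV \<and> card A \<le> m
           \<and> real (card {e\<in>E. \<forall>z\<in>A. \<not> ?hit z e}) \<le> (1 - \<alpha>) ^ m * card E"
  proof (rule greedy_hitting_set[OF finE \<alpha>(2)])
    fix E' assume E': "E' \<subseteq> E" "E' \<noteq> {}"
    have finE': "finite E'" using finE E' finite_subset by blast
    have "\<exists>i\<in>I. \<exists>t. \<alpha> * card E' \<le> card {e\<in>E'. (t \<le> fst e (x i)) \<noteq> (t \<le> snd e (x i))}"
    proof (rule exists_separating_level[OF I finE' E'(2)])
      fix e i assume "e \<in> E'" "i \<in> I"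
      then show "\<bar>fst e (x i)\<bar> \<le> 1 \<and> \<bar>snd e (x i)\<bar> \<le> 1"
        using E' bounded x by (auto simp: E_def)
    next
      fix h assume "h \<in> E'"
      then have h: "fst h \<in> N" "snd h \<in> N" "fst h \<noteq> snd h" using E' by (auto simp: E_def)
      have "4 * \<alpha> * card I < (\<Sum>i\<in>I. (fst h (x i) - snd h (x i))\<^sup>2)"
        using sep[OF h] by (simp add: \<alpha>_def mult.commute)
      also have "\<dots> \<le> (\<Sum>i\<in>I. 2 * \<bar>fst h (x i) - snd h (x i)\<bar>)"
      proof (intro sum_mono)
        fix i assume "i \<in> I"
        then have "\<bar>fst h (x i) - snd h (x i)\<bar> \<le> 2"
          using bounded[OF h(1) x] bounded[OF h(2) x] by fastforce
        then have "\<bar>fst h (x i) - snd h (x i)\<bar> * \<bar>fst h (x i) - snd h (x i)\<bar>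
            \<le> 2 * \<bar>fst h (x i) - snd h (x i)\<bar>" by (intro mult_right_mono) auto
        then show "(fst h (x i) - snd h (x i))\<^sup>2 \<le> 2 * \<bar>fst h (x i) - snd h (x i)\<bar>"
          by (simp add: power2_eq_square abs_mult_self_eq)
      qed
      finally show "2 * \<alpha> * card I < (\<Sum>i\<in>I. \<bar>fst h (x i) - snd h (x i)\<bar>)"
        by (simp add: sum_distrib_left[symmetric])
    qed
    then obtain i t where "i \<in> I"
      "\<alpha> * card E' \<le> card {e\<in>E'. (t \<le> fst e (x i)) \<noteq> (t \<le> snd e (x i))}" by blast
    then show "\<exists>z\<in>X \<times> UNIV. \<alpha> * card E' \<le> card {e\<in>E'. ?hit z e}"
      using x by (intro bexI[of _ "(x i, t)"]) (auto simp: case_prod_beta)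
  qed
  then obtain A where A: "finite A" "A \<subseteq> X \<times> UNIV" "card A \<le> m"
    and few: "real (card {e\<in>E. \<forall>z\<in>A. \<not> ?hit z e}) \<le> (1 - \<alpha>) ^ m * card E" by blast
  have all: "{e\<in>E. \<forall>z\<in>A. \<not> ?hit z e} = {}"
  proof (cases "E = {}")
    case False
    have "E \<subset> N \<times> N" using E_sub N by (auto simp: E_def)
    then have "card E < card (N \<times> N)" using N by (intro psubset_card_mono) auto
    then have cardE: "real (card E) < M\<^sup>2"
      by (simp add: M_def power2_eq_square card_cartesian_product flip: of_nat_mult)
    have "(1 - \<alpha>) ^ m \<le> exp (- \<alpha>) ^ m"
      using exp_ge_add_one_self[of "-\<alpha>"] \<alpha> by (intro power_mono) auto
    also have "\<dots> = exp (- (\<alpha> * m))" by (simp add: exp_of_nat_mult[symmetric] mult.commute)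
    also have "\<dots> \<le> exp (- (2 * ln M))" using m_ge \<alpha> by (simp add: field_simps)
    also have "\<dots> = 1 / M\<^sup>2" using M by (simp add: exp_minus exp_double inverse_eq_divide)
    finally have "(1 - \<alpha>) ^ m * card E \<le> 1 / M\<^sup>2 * card E" by (intro mult_right_mono) auto
    also have "\<dots> < 1" using cardE M by (simp add: field_simps)
    finally have "real (card {e\<in>E. \<forall>z\<in>A. \<not> ?hit z e}) < 1" using few by linarith
    then have "card {e\<in>E. \<forall>z\<in>A. \<not> ?hit z e} = 0" by linarith
    moreover have "finite {e\<in>E. \<forall>z\<in>A. \<not> ?hit z e}" using finE by simp
    ultimately show ?thesis by (simp only: card_eq_0_iff) blast
  qed auto
  have inj: "inj_on (\<lambda>f. A \<inter> subgraph X f) N"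
  proof (rule inj_onI, rule ccontr)
    fix f g assume fg: "f \<in> N" "g \<in> N" "A \<inter> subgraph X f = A \<inter> subgraph X g" "f \<noteq> g"
    then have "(f, g) \<in> E" by (auto simp: E_def)
    then have "\<exists>z\<in>A. ?hit z (f, g)" using all by blast
    then obtain z where z: "z \<in> A" "?hit z (f, g)" by blast
    then have "z \<in> subgraph X f \<longleftrightarrow> z \<notin> subgraph X g"
      using A by (auto simp: subgraph_def case_prod_beta)
    then show False using fg(3) z by blast
  qed
  have "M = real (card ((\<lambda>C. A \<inter> C) ` subgraph X ` N))"
    using card_image[OF inj] by (simp add: M_def image_image)
  also have "\<dots> \<le> (exp 1 * m / d) ^ d"
    using A vc by (intro card_traces_le A d dm) auto
  finally have "ln M \<le> ln ((exp 1 * m / d) ^ d)" using M by (intro ln_mono) auto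
  also have "\<dots> = d * (1 + ln (m / d))"
    using d dm by (simp add: ln_realpow ln_mult ln_div)
  finally have "y \<le> 1 + ln (m / d)" using d by (simp add: y_def field_simps)
  also have "m / d \<le> 2 * ((1 + y) / \<alpha>)"
  proof -
    have "m \<le> 2 * (y * d) / \<alpha> + 1 + d" using m_le d by (simp add: y_def)
    also have "\<dots> \<le> 2 * (y * d) / \<alpha> + 2 * d" using d by simp
    also have "\<dots> \<le> 2 * (y * d) / \<alpha> + 2 * d / \<alpha>" using \<alpha> d by (simp add: field_simps)
    finally show ?thesis using d \<alpha> by (simp add: field_simps)
  qed
  then have "ln (m / d) \<le> ln (2 * ((1 + y) / \<alpha>))" using d dm by (intro ln_mono) auto
  also have "\<dots> = ln 2 + ln ((1 + y) * (1 / \<alpha>))"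
    using \<alpha> y ln_mult[of 2 "(1 + y) * (1 / \<alpha>)"] by simp
  also have "ln ((1 + y) * (1 / \<alpha>)) = ln (1 + y) + ln (1 / \<alpha>)"
    using \<alpha> y by (simp add: ln_mult ln_div)
  also have "ln 2 + (ln (1 + y) + ln (1 / \<alpha>)) \<le> ln 2 + ((1 + y) / 2 + ln 2 - 1) + ln (1 / \<alpha>)"
    using ln_one_plus_le[OF y] by (simp add: field_simps)
  finally have "y \<le> 1 + 4 * ln 2 + 2 * ln (1 / \<alpha>)" by (simp add: field_simps)
  then have "ln M \<le> d * (1 + 4 * ln 2 + 2 * ln (1 / \<alpha>))" using d by (simp add: y_def field_simps)
  then show ?thesis by (simp add: M_def \<alpha>_def)
qed

section \<open>Rademacher averages and chaining\<close>

text \<open>A vector of signs is encoded by the set \<open>S\<close> of indices that carry \<open>+1\<close>, so that the average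
  over independent random signs is the finite mean over the subsets of \<open>I\<close>.\<close>
definition rsign :: "'i set \<Rightarrow> 'i \<Rightarrow> real" where
  "rsign S i = (if i \<in> S then 1 else - 1)"

definition rad_avg :: "'i set \<Rightarrow> ('i set \<Rightarrow> real) \<Rightarrow> real" where
  "rad_avg I h = (\<Sum>S\<in>Pow I. h S) / 2 ^ card I"

lemma rad_avg_mono: "(\<And>S. S \<subseteq> I \<Longrightarrow> h S \<le> h' S) \<Longrightarrow> rad_avg I h \<le> rad_avg I h'"
  unfolding rad_avg_def by (intro divide_right_mono sum_mono) auto

lemma rad_avg_add: "rad_avg I (\<lambda>S. h S + h' S) = rad_avg I h + rad_avg I h'"
  by (simp add: rad_avg_def sum.distrib add_divide_distrib)

lemma rad_avg_cmult: "rad_avg I (\<lambda>S. c * h S) = c * rad_avg I h"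
  by (simp add: rad_avg_def sum_distrib_left)

lemma rad_avg_const: "finite I \<Longrightarrow> rad_avg I (\<lambda>S. c) = c"
  by (simp add: rad_avg_def card_Pow)

lemma rad_avg_sum: "rad_avg I (\<lambda>S. \<Sum>t\<in>T. h t S) = (\<Sum>t\<in>T. rad_avg I (h t))"
  unfolding rad_avg_def by (subst sum.swap) (simp add: sum_divide_distrib)

lemma rad_avg_exp:
  assumes "finite I"
  shows "rad_avg I (\<lambda>S. exp (\<Sum>i\<in>I. rsign S i * a i)) = (\<Prod>i\<in>I. cosh (a i))"
proof -
  have *: "exp (\<Sum>i\<in>I. rsign S i * a i) = (\<Prod>i\<in>S. exp (a i)) * (\<Prod>i\<in>I - S. exp (- a i))"
    if "S \<subseteq> I" for S
  proof -
    have "exp (\<Sum>i\<in>I. rsign S i * a i) = (\<Prod>i\<in>I. exp (rsign S i * a i))"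
      using assms by (rule exp_sum)
    also have "\<dots> = (\<Prod>i\<in>S. exp (rsign S i * a i)) * (\<Prod>i\<in>I - S. exp (rsign S i * a i))"
      using that assms by (subst prod.subset_diff[of S I]) (auto simp: mult.commute)
    finally show ?thesis by (simp add: rsign_def)
  qed
  have "(\<Sum>S\<in>Pow I. exp (\<Sum>i\<in>I. rsign S i * a i))
      = (\<Sum>S\<in>Pow I. (\<Prod>i\<in>S. exp (a i)) * (\<Prod>i\<in>I - S. exp (- a i)))"
    by (intro sum.cong) (auto simp: *)
  also have "\<dots> = (\<Prod>i\<in>I. exp (a i) + exp (- a i))"
    by (rule prod_add[OF assms, symmetric])
  also have "\<dots> = (\<Prod>i\<in>I. 2 * cosh (a i))"
    by (intro prod.cong) (simp_all add: cosh_field_def field_simps)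
  finally show ?thesis by (simp add: rad_avg_def prod.distrib)
qed

lemma tanh_le_self: "tanh x \<le> x" if "0 \<le> x" for x :: real
proof -
  have "0 - tanh 0 \<le> x - tanh x"
  proof (rule DERIV_nonneg_imp_nondecreasing[OF that])
    fix y :: real
    have "((\<lambda>x. x - tanh x) has_real_derivative 1 - (1 - tanh y ^ 2)) (at y)"
      by (auto intro!: derivative_eq_intros)
    then show "\<exists>z. ((\<lambda>x. x - tanh x) has_real_derivative z) (at y) \<and> 0 \<le> z"
      by (intro exI[of _ "1 - (1 - tanh y ^ 2)"]) simp
  qed
  then show ?thesis by simp
qed

text \<open>The derivative \<open>x - tanh x\<close> of \<open>x\<^sup>2 / 2 - ln (cosh x)\<close> is nonnegative for \<open>x \<ge> 0\<close>.\<close>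
lemma cosh_le_exp: "cosh x \<le> exp (x\<^sup>2 / 2)" for x :: real
proof -
  have main: "cosh x \<le> exp (x\<^sup>2 / 2)" if "0 \<le> x" for x :: real
  proof -
    have "0\<^sup>2 / 2 - ln (cosh 0) \<le> x\<^sup>2 / 2 - ln (cosh x)"
    proof (rule DERIV_nonneg_imp_nondecreasing[OF that])
      fix y :: real assume "0 \<le> y"
      have "((\<lambda>x. x\<^sup>2 / 2 - ln (cosh x)) has_real_derivative y - tanh y) (at y)"
        by (auto intro!: derivative_eq_intros simp: tanh_def field_simps)
      then show "\<exists>z. ((\<lambda>x. x\<^sup>2 / 2 - ln (cosh x)) has_real_derivative z) (at y) \<and> 0 \<le> z"
        using tanh_le_self[OF \<open>0 \<le> y\<close>] by (intro exI[of _ "y - tanh y"]) simp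
    qed
    then have "ln (cosh x) \<le> x\<^sup>2 / 2" by simp
    then show ?thesis by (metis cosh_real_pos exp_le_cancel_iff exp_ln)
  qed
  show ?thesis
    using main[of x] main[of "- x"] by (cases "0 \<le> x") auto
qed

lemma Max_image_le: "finite T \<Longrightarrow> T \<noteq> {} \<Longrightarrow> (\<And>t. t \<in> T \<Longrightarrow> h t \<le> c) \<Longrightarrow> Max (h ` T) \<le> c"
  by simp

lemma Max_image_ge: "finite T \<Longrightarrow> t \<in> T \<Longrightarrow> h t \<le> Max (h ` T)"
  by simp

text \<open>The maximal inequality for sub-Gaussian variables. The logarithm of the average
  of \<open>exp (l * Max)\<close> is at most \<open>ln (2 * card N) + l\<^sup>2 * r\<^sup>2 / 2\<close>, by a union bound over \<open>N\<close> and the two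
  signs; Jensen's inequality takes the form of the tangent of the exponential at this value
  \<open>c\<close>. The choice \<open>l = sqrt (2 * H) / r\<close> is optimal.\<close>
lemma rad_avg_Max_le:
  fixes a :: "'t \<Rightarrow> 'i \<Rightarrow> real"
  assumes I: "finite I" and N: "finite N" "N \<noteq> {}" and r: "0 < r"
    and a: "\<And>t. t \<in> N \<Longrightarrow> (\<Sum>i\<in>I. (a t i)\<^sup>2) \<le> r\<^sup>2"
  shows "rad_avg I (\<lambda>S. Max ((\<lambda>t. \<bar>\<Sum>i\<in>I. rsign S i * a t i\<bar>) ` N))
           \<le> r * sqrt (2 * ln (2 * card N))"
proof -
  let ?X = "\<lambda>S t. \<Sum>i\<in>I. rsign S i * a t i"
  let ?M = "\<lambda>S. Max ((\<lambda>t. \<bar>?X S t\<bar>) ` N)"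
  define H where "H = ln (2 * real (card N))"
  have cN: "real (card N) \<ge> 1" using N by (simp add: Suc_leI card_gt_0_iff)
  have H: "H > 0" using cN by (simp add: H_def)
  define l where "l = sqrt (2 * H) / r"
  have l: "l > 0" using H r by (simp add: l_def)
  define c where "c = H + l\<^sup>2 * r\<^sup>2 / 2"
  have mgf: "rad_avg I (\<lambda>S. exp (k * ?X S t)) \<le> exp (l\<^sup>2 * r\<^sup>2 / 2)"
    if t: "t \<in> N" and k: "k\<^sup>2 = l\<^sup>2" for t k
  proof -
    have "rad_avg I (\<lambda>S. exp (k * ?X S t)) = rad_avg I (\<lambda>S. exp (\<Sum>i\<in>I. rsign S i * (k * a t i)))"
      by (simp add: sum_distrib_left mult.left_commute)
    also have "\<dots> = (\<Prod>i\<in>I. cosh (k * a t i))" by (rule rad_avg_exp[OF I])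
    also have "\<dots> \<le> (\<Prod>i\<in>I. exp ((k * a t i)\<^sup>2 / 2))"
      by (intro prod_mono conjI cosh_le_exp) (simp add: cosh_real_nonneg)
    also have "\<dots> = exp (l\<^sup>2 * (\<Sum>i\<in>I. (a t i)\<^sup>2) / 2)"
      using I by (simp add: exp_sum[symmetric] power_mult_distrib k sum_distrib_left sum_divide_distrib)
    also have "\<dots> \<le> exp (l\<^sup>2 * r\<^sup>2 / 2)"
      using a[OF t] by (simp add: mult_left_mono)
    finally show ?thesis .
  qed
  have "rad_avg I (\<lambda>S. exp c * (1 + l * ?M S - c)) \<le> rad_avg I (\<lambda>S. \<Sum>t\<in>N. exp (l * ?X S t) + exp (- l * ?X S t))"
  proof (rule rad_avg_mono)
    fix S
    have "?M S \<in> (\<lambda>t. \<bar>?X S t\<bar>) ` N" using N by (intro Max_in) auto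
    then obtain t where t: "t \<in> N" "?M S = \<bar>?X S t\<bar>" by auto
    have "exp c * (1 + (l * ?M S - c)) \<le> exp c * exp (l * ?M S - c)"
      by (intro mult_left_mono exp_ge_add_one_self) auto
    also have "\<dots> = exp (l * \<bar>?X S t\<bar>)" using t by (simp add: exp_add[symmetric])
    also have "\<dots> \<le> exp (l * ?X S t) + exp (- l * ?X S t)"
      by (cases "0 \<le> ?X S t") (auto simp: abs_if)
    also have "\<dots> \<le> (\<Sum>t\<in>N. exp (l * ?X S t) + exp (- l * ?X S t))"
      by (rule member_le_sum[OF t(1)]) (auto simp: N add_nonneg_nonneg)
    finally show "exp c * (1 + l * ?M S - c) \<le> \<dots>" by (simp add: algebra_simps)
  qed
  also have "\<dots> \<le> (\<Sum>t\<in>N. exp (l\<^sup>2 * r\<^sup>2 / 2) + exp (l\<^sup>2 * r\<^sup>2 / 2))"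
    unfolding rad_avg_sum rad_avg_add by (intro sum_mono add_mono mgf) auto
  also have "\<dots> = exp c" using cN by (simp add: c_def exp_add H_def)
  finally have "rad_avg I (\<lambda>S. exp c * (1 + l * ?M S - c)) \<le> exp c" .
  moreover have "rad_avg I (\<lambda>S. exp c * (1 + l * ?M S - c))
      = exp c * (1 + l * rad_avg I ?M - c)"
  proof -
    have "rad_avg I (\<lambda>S. exp c * (1 + l * ?M S - c)) = exp c * rad_avg I (\<lambda>S. (1 - c) + l * ?M S)"
      unfolding rad_avg_cmult[symmetric] by (simp add: algebra_simps)
    also have "\<dots> = exp c * ((1 - c) + l * rad_avg I ?M)"
      unfolding rad_avg_add rad_avg_cmult rad_avg_const[OF I] ..
    finally show ?thesis by (simp add: algebra_simps)
  qed
  ultimately have "l * rad_avg I ?M \<le> c" by simp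
  also have "c = l * (r * sqrt (2 * H))"
  proof -
    have lr: "l * r = sqrt (2 * H)" using r by (simp add: l_def)
    have sq: "sqrt (2 * H) * sqrt (2 * H) = 2 * H"
      using H by simp
    have "c = H + (l * r) * (l * r) / 2" by (simp add: c_def power2_eq_square mult_ac)
    also have "\<dots> = sqrt (2 * H) * sqrt (2 * H)" unfolding lr sq by simp
    also have "\<dots> = (l * r) * sqrt (2 * H)" by (simp only: lr)
    finally show ?thesis by (simp only: mult.assoc)
  qed
  finally have "rad_avg I ?M \<le> r * sqrt (2 * H)" using l by (simp only: mult_le_cancel_left_pos)
  then show ?thesis by (simp only: H_def of_nat_mult of_nat_numeral)
qed

lemma maximal_separated_subset:
  assumes "finite T" and "T \<noteq> {}" and sym: "\<And>s t. \<rho> s t = \<rho> t s" and "\<And>t. \<rho> t t \<le> (u::real)"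
  obtains N where "N \<subseteq> T" "N \<noteq> {}" "\<And>s t. s \<in> N \<Longrightarrow> t \<in> N \<Longrightarrow> s \<noteq> t \<Longrightarrow> u < \<rho> s t"
    "\<And>t. t \<in> T \<Longrightarrow> \<exists>s\<in>N. \<rho> t s \<le> u"
proof -
  define sep where "sep N \<longleftrightarrow> N \<subseteq> T \<and> (\<forall>s\<in>N. \<forall>t\<in>N. s \<noteq> t \<longrightarrow> u < \<rho> s t)" for N
  have fin: "finite (Collect sep)"
    by (rule finite_subset[of _ "Pow T"]) (use assms(1) in \<open>auto simp: sep_def\<close>)
  have ne: "Collect sep \<noteq> {}" by (auto simp: sep_def)
  obtain N where N: "sep N" and max: "\<forall>N'\<in>Collect sep. N \<subseteq> N' \<longrightarrow> N = N'"
    using finite_has_maximal[OF fin ne] by blast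
  have cover: "\<exists>s\<in>N. \<rho> t s \<le> u" if t: "t \<in> T" for t
  proof (rule ccontr)
    assume "\<not> ?thesis"
    then have far: "\<And>s. s \<in> N \<Longrightarrow> u < \<rho> t s" by (auto simp: not_le)
    moreover have "u < \<rho> s t" if "s \<in> N" for s using far[OF that] by (simp only: sym[of s t])
    ultimately have "sep (insert t N)" using N t by (auto simp: sep_def)
    then have "t \<in> N" using max by blast
    then show False using far[of t] assms(4)[of t] by simp
  qed
  then have "N \<noteq> {}" using assms(2) by auto
  with N cover show ?thesis by (intro that[of N]) (auto simp: sep_def)
qed

text \<open>Dudley's chaining argument for a process \<open>\<phi>\<close> that is Lipschitz with respect to \<open>b\<close>. Each
  maximal separated subset \<open>N j\<close> at scale \<open>r / 2 ^ j\<close> is a net at this scale, so that passing from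
  \<open>N j\<close> to \<open>N (j + 1)\<close> costs the maximum of \<open>card (N (j + 1))\<close> variables of norm at most
  \<open>c * r / 2 ^ j\<close>. With \<open>sqrt (1 + j) \<le> 1 + j / 2\<close> the costs sum to a series whose value is 4;
  what is left after \<open>k\<close> steps vanishes as \<open>k\<close> grows by the Cauchy-Schwarz inequality.
  The two families \<open>b\<close> and \<open>\<phi>\<close> are kept apart so that the same packing numbers serve for a
  class and for the class of its squares.\<close>
lemma chaining_bound:
  fixes b \<phi> :: "'t \<Rightarrow> 'i \<Rightarrow> real"
  assumes I: "finite I" and T: "finite T" "T \<noteq> {}" and r: "0 < r" and c: "0 < c" and H: "0 \<le> H"
    and lip: "\<And>s t. s \<in> T \<Longrightarrow> t \<in> T \<Longrightarrow>
        (\<Sum>i\<in>I. (\<phi> s i - \<phi> t i)\<^sup>2) \<le> c\<^sup>2 * (\<Sum>i\<in>I. (b s i - b t i)\<^sup>2)"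
    and radius: "\<And>t. t \<in> T \<Longrightarrow> (\<Sum>i\<in>I. (\<phi> t i)\<^sup>2) \<le> (c * r)\<^sup>2"
    and packing: "\<And>N j. N \<subseteq> T \<Longrightarrow> N \<noteq> {} \<Longrightarrow> 1 \<le> j \<Longrightarrow>
        (\<And>s t. s \<in> N \<Longrightarrow> t \<in> N \<Longrightarrow> s \<noteq> t \<Longrightarrow> (r / 2 ^ j)\<^sup>2 < (\<Sum>i\<in>I. (b s i - b t i)\<^sup>2)) \<Longrightarrow>
        ln (2 * card N) \<le> H * (1 + real j)"
  shows "rad_avg I (\<lambda>S. Max ((\<lambda>t. \<bar>\<Sum>i\<in>I. rsign S i * \<phi> t i\<bar>) ` T)) \<le> 4 * sqrt (2 * H) * (c * r)"
proof -
  let ?\<rho> = "\<lambda>s t. \<Sum>i\<in>I. (b s i - b t i)\<^sup>2"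
  let ?X = "\<lambda>S t. \<bar>\<Sum>i\<in>I. rsign S i * \<phi> t i\<bar>"
  define net where "net j N \<longleftrightarrow> N \<subseteq> T \<and> N \<noteq> {} \<and> (\<forall>s\<in>N. \<forall>t\<in>N. s \<noteq> t \<longrightarrow> (r / 2 ^ j)\<^sup>2 < ?\<rho> s t)
      \<and> (\<forall>t\<in>T. \<exists>s\<in>N. ?\<rho> t s \<le> (r / 2 ^ j)\<^sup>2)" for j :: nat and N
  have ex_net: "\<exists>N. net j N" for j
  proof -
    obtain N where "N \<subseteq> T" "N \<noteq> {}" "\<And>s t. s \<in> N \<Longrightarrow> t \<in> N \<Longrightarrow> s \<noteq> t \<Longrightarrow> (r / 2 ^ j)\<^sup>2 < ?\<rho> s t"
      "\<And>t. t \<in> T \<Longrightarrow> \<exists>s\<in>N. ?\<rho> t s \<le> (r / 2 ^ j)\<^sup>2"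
      by (rule maximal_separated_subset[OF T, of ?\<rho> "(r / 2 ^ j)\<^sup>2"])
         (simp_all add: power2_commute)
    then show ?thesis unfolding net_def by (intro exI[of _ N] conjI ballI impI)
  qed
  define N where "N j = (SOME N. net j N)" for j
  have netN: "net j (N j)" for j unfolding N_def by (rule someI_ex[OF ex_net])
  have N: "\<And>j. N j \<subseteq> T" "\<And>j. N j \<noteq> {}"
    and N_sep: "\<And>j s t. s \<in> N j \<Longrightarrow> t \<in> N j \<Longrightarrow> s \<noteq> t \<Longrightarrow> (r / 2 ^ j)\<^sup>2 < ?\<rho> s t"
    and N_cover: "\<And>j t. t \<in> T \<Longrightarrow> \<exists>s\<in>N j. ?\<rho> t s \<le> (r / 2 ^ j)\<^sup>2"
    using netN unfolding net_def by meson+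
  have finN: "finite (N j)" for j by (rule finite_subset[OF N(1) T(1)])
  define \<pi> where "\<pi> j t = (SOME s. s \<in> N j \<and> ?\<rho> t s \<le> (r / 2 ^ j)\<^sup>2)" for j t
  have "\<pi> j t \<in> N j \<and> ?\<rho> t (\<pi> j t) \<le> (r / 2 ^ j)\<^sup>2" if "t \<in> T" for j t
    unfolding \<pi>_def using N_cover[OF that, of j] by (rule someI_ex[OF iffD1[OF Bex_def]])
  then have \<pi>: "\<And>j t. t \<in> T \<Longrightarrow> \<pi> j t \<in> N j"
    "\<And>j t. t \<in> T \<Longrightarrow> ?\<rho> t (\<pi> j t) \<le> (r / 2 ^ j)\<^sup>2" by blast+
  have link: "(\<Sum>i\<in>I. (\<phi> t i - \<phi> (\<pi> j t) i)\<^sup>2) \<le> (c * (r / 2 ^ j))\<^sup>2" if "t \<in> T" for t j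
  proof -
    have "\<pi> j t \<in> T" using \<pi>(1)[OF that] N(1) by blast
    then have "(\<Sum>i\<in>I. (\<phi> t i - \<phi> (\<pi> j t) i)\<^sup>2) \<le> c\<^sup>2 * ?\<rho> t (\<pi> j t)" using lip that by blast
    also have "\<dots> \<le> c\<^sup>2 * (r / 2 ^ j)\<^sup>2" using \<pi>(2)[OF that] by (intro mult_left_mono) auto
    finally show ?thesis by (simp only: power_mult_distrib)
  qed
  have split: "?X S t \<le> ?X S (\<pi> j t) + \<bar>\<Sum>i\<in>I. rsign S i * (\<phi> t i - \<phi> (\<pi> j t) i)\<bar>" for S t j
  proof -
    have "(\<Sum>i\<in>I. rsign S i * \<phi> t i)
        = (\<Sum>i\<in>I. rsign S i * \<phi> (\<pi> j t) i) + (\<Sum>i\<in>I. rsign S i * (\<phi> t i - \<phi> (\<pi> j t) i))"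
      by (simp add: algebra_simps sum.distrib sum_subtractf)
    then show ?thesis by linarith
  qed
  have cover_le: "?X S (\<pi> j t) \<le> Max (?X S ` N j)" if "t \<in> T" for S t j
    using \<pi>(1)[OF that] finN by (intro Max_image_ge)
  define A where "A j = rad_avg I (\<lambda>S. Max (?X S ` N j))" for j
  have sqrt_le: "sqrt (2 * ln (2 * card (N j))) \<le> sqrt (2 * H) * (1 + real j / 2)" if j: "1 \<le> j" for j
  proof -
    have "1 + real j \<le> (1 + real j / 2)\<^sup>2" by (simp add: power2_eq_square algebra_simps)
    then have "H * (1 + real j) \<le> H * (1 + real j / 2)\<^sup>2" using H by (rule mult_left_mono)
    moreover have "ln (2 * card (N j)) \<le> H * (1 + real j)"
      using packing[OF N(1,2) j] N_sep by blast
    ultimately have "sqrt (2 * ln (2 * card (N j))) \<le> sqrt (2 * H * (1 + real j / 2)\<^sup>2)"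
      by (intro real_sqrt_le_mono) simp
    also have "\<dots> = sqrt (2 * H) * (1 + real j / 2)"
      by (simp add: real_sqrt_mult)
    finally show ?thesis .
  qed
  have step: "A (Suc j) \<le> A j + c * (r / 2 ^ j) * (sqrt (2 * H) * (1 + real (Suc j) / 2))" for j
  proof -
    let ?D = "\<lambda>S t. \<bar>\<Sum>i\<in>I. rsign S i * (\<phi> t i - \<phi> (\<pi> j t) i)\<bar>"
    have "A (Suc j) \<le> rad_avg I (\<lambda>S. Max (?X S ` N j) + Max (?D S ` N (Suc j)))"
      unfolding A_def
    proof (intro rad_avg_mono Max_image_le finN N)
      fix S t assume t: "t \<in> N (Suc j)"
      then have "t \<in> T" using N by blast
      have "?D S t \<le> Max (?D S ` N (Suc j))" using t finN by (intro Max_image_ge)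
      then show "?X S t \<le> Max (?X S ` N j) + Max (?D S ` N (Suc j))"
        using split[of S t j] cover_le[OF \<open>t \<in> T\<close>, of S j] by linarith
    qed
    also have "\<dots> = A j + rad_avg I (\<lambda>S. Max (?D S ` N (Suc j)))"
      by (simp add: rad_avg_add A_def)
    also have "rad_avg I (\<lambda>S. Max (?D S ` N (Suc j)))
        \<le> c * (r / 2 ^ j) * sqrt (2 * ln (2 * card (N (Suc j))))"
      using c r link N(1) by (intro rad_avg_Max_le I finN N) auto
    also have "\<dots> \<le> c * (r / 2 ^ j) * (sqrt (2 * H) * (1 + real (Suc j) / 2))"
      using c r by (intro mult_left_mono sqrt_le) auto
    finally show ?thesis by simp
  qed
  \<comment> \<open>The subtracted term is the tail, from \<open>j = k + 2\<close> on, of the series with terms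
    \<open>(1 + j / 2) / 2 ^ (j - 1)\<close>; with it the induction closes exactly.\<close>
  have A_le: "A (Suc k) \<le> (4 - (real k + 5) / 2 ^ Suc k) * (sqrt (2 * H) * (c * r))" for k
  proof (induction k)
    case 0
    have "A 1 \<le> c * r * sqrt (2 * ln (2 * card (N 1)))"
      unfolding A_def using c r radius N(1) by (intro rad_avg_Max_le I finN N) auto
    also have "\<dots> \<le> c * r * (sqrt (2 * H) * (1 + real 1 / 2))"
      using c r by (intro mult_left_mono sqrt_le) auto
    finally show ?case by (simp add: algebra_simps)
  next
    case (Suc k)
    have "A (Suc (Suc k)) \<le> A (Suc k) + c * (r / 2 ^ Suc k) * (sqrt (2 * H) * (1 + real (Suc (Suc k)) / 2))"
      by (rule step)
    also have "\<dots> \<le> (4 - (real k + 5) / 2 ^ Suc k) * (sqrt (2 * H) * (c * r))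
        + c * (r / 2 ^ Suc k) * (sqrt (2 * H) * (1 + real (Suc (Suc k)) / 2))"
      using Suc by simp
    also have "\<dots> = (4 - (real (Suc k) + 5) / 2 ^ Suc (Suc k)) * (sqrt (2 * H) * (c * r))"
      by (simp add: field_simps)
    finally show ?case .
  qed
  let ?L = "rad_avg I (\<lambda>S. Max (?X S ` T))"
  have bound: "?L \<le> 4 * sqrt (2 * H) * (c * r) + sqrt (card I) * (c * r) * (1 / 2) ^ Suc k" for k
  proof -
    have "?L \<le> rad_avg I (\<lambda>S. Max (?X S ` N (Suc k)) + sqrt (card I) * (c * r) * (1 / 2) ^ Suc k)"
    proof (intro rad_avg_mono Max_image_le T)
      fix S t assume t: "t \<in> T"
      let ?d = "\<lambda>i. \<phi> t i - \<phi> (\<pi> (Suc k) t) i"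
      have "\<bar>\<Sum>i\<in>I. rsign S i * ?d i\<bar> \<le> L2_set (rsign S) I * L2_set ?d I"
        using L2_set_mult_ineq[of "rsign S" ?d I] sum_abs[of "\<lambda>i. rsign S i * ?d i" I]
        by (simp add: abs_mult)
      also have "\<dots> \<le> sqrt (card I) * (c * (r / 2 ^ Suc k))"
      proof (intro mult_mono)
        have "(rsign S i)\<^sup>2 = 1" for i by (simp add: rsign_def)
        then show "L2_set (rsign S) I \<le> sqrt (card I)" by (simp add: L2_set_def)
        show "L2_set ?d I \<le> c * (r / 2 ^ Suc k)"
          unfolding L2_set_def
          by (rule real_le_lsqrt[OF _ link[OF t]]) (use c r in simp)
      qed auto
      also have "\<dots> = sqrt (card I) * (c * r) * (1 / 2) ^ Suc k" by (simp add: power_one_over)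
      finally show "?X S t \<le> Max (?X S ` N (Suc k)) + sqrt (card I) * (c * r) * (1 / 2) ^ Suc k"
        using split[of S t "Suc k"] cover_le[OF t, of S "Suc k"] by linarith
    qed
    also have "\<dots> = A (Suc k) + sqrt (card I) * (c * r) * (1 / 2) ^ Suc k"
      by (simp add: rad_avg_add rad_avg_const[OF I] A_def)
    also have "A (Suc k) \<le> 4 * (sqrt (2 * H) * (c * r))"
      by (rule order_trans[OF A_le]) (use c r H in \<open>intro mult_right_mono; simp\<close>)
    finally show ?thesis by simp
  qed
  have "(\<lambda>k. 4 * sqrt (2 * H) * (c * r) + sqrt (card I) * (c * r) * (1 / 2) ^ Suc k)
      \<longlonglongrightarrow> 4 * sqrt (2 * H) * (c * r) + sqrt (card I) * (c * r) * 0"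
    by (intro tendsto_intros LIMSEQ_Suc[OF LIMSEQ_power_zero]) simp
  then have "?L \<le> 4 * sqrt (2 * H) * (c * r) + sqrt (card I) * (c * r) * 0"
    using bound by (intro LIMSEQ_le_const) auto
  then show ?thesis by simp
qed

section \<open>Tensorization of entropy\<close>

text \<open>All functions that are integrated below are measurable and bounded on the space, which makes
  integrability a matter of bookkeeping.\<close>
definition ranged :: "'a measure \<Rightarrow> real \<Rightarrow> real \<Rightarrow> ('a \<Rightarrow> real) \<Rightarrow> bool" where
  "ranged M a b f \<longleftrightarrow> f \<in> borel_measurable M \<and> (\<forall>x\<in>space M. a \<le> f x \<and> f x \<le> b)"

lemma rangedI:
  "f \<in> borel_measurable M \<Longrightarrow> (\<And>x. x \<in> space M \<Longrightarrow> a \<le> f x \<and> f x \<le> b) \<Longrightarrow> ranged M a b f"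
  by (simp add: ranged_def)

lemma ranged_absI:
  assumes "f \<in> borel_measurable M" and "\<And>x. x \<in> space M \<Longrightarrow> \<bar>f x\<bar> \<le> K"
  shows "ranged M (- K) K f"
proof (rule rangedI[OF assms(1)])
  fix x assume "x \<in> space M"
  then show "- K \<le> f x \<and> f x \<le> K" using assms(2)[of x] by linarith
qed

lemma ranged_measurable: "ranged M a b f \<Longrightarrow> f \<in> borel_measurable M"
  by (simp add: ranged_def)

lemma ranged_bounds: "ranged M a b f \<Longrightarrow> x \<in> space M \<Longrightarrow> a \<le> f x \<and> f x \<le> b"
  by (simp add: ranged_def)

context prob_space
begin

lemma integrable_ranged:
  assumes "ranged M a b f"
  shows "integrable M f"
proof (rule integrable_const_bound[where B = "\<bar>a\<bar> + \<bar>b\<bar>"])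
  show "AE x in M. norm (f x) \<le> \<bar>a\<bar> + \<bar>b\<bar>"
  proof (rule AE_I2)
    fix x assume "x \<in> space M"
    then show "norm (f x) \<le> \<bar>a\<bar> + \<bar>b\<bar>"
      using ranged_bounds[OF assms, of x] unfolding real_norm_def by linarith
  qed
qed (rule ranged_measurable[OF assms])

lemma expectation_ranged:
  assumes "ranged M a b f"
  shows "a \<le> expectation f \<and> expectation f \<le> b"
proof
  have "expectation (\<lambda>_. a) \<le> expectation f"
    using ranged_bounds[OF assms] by (intro integral_mono integrable_ranged[OF assms]) auto
  then show "a \<le> expectation f" by (simp add: prob_space)
  have "expectation f \<le> expectation (\<lambda>_. b)"
    using ranged_bounds[OF assms] by (intro integral_mono integrable_ranged[OF assms]) auto
  then show "expectation f \<le> b" by (simp add: prob_space)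
qed

end

lemma diff_le_mult_ln: "p - q \<le> p * (ln p - ln q)" if "0 < p" "0 < q" for p q :: real
proof -
  have "ln (q / p) \<le> q / p - 1" using that by (intro ln_le_minus_one) auto
  then have "p * ln (q / p) \<le> p * (q / p - 1)" using that by (intro mult_left_mono) auto
  then show ?thesis using that by (simp add: ln_div algebra_simps)
qed

text \<open>The Bregman divergence of \<open>y * ln y\<close>. Its joint convexity is what makes tensorization work.\<close>
definition ent_div :: "real \<Rightarrow> real \<Rightarrow> real" where
  "ent_div y u = y * (ln y - ln u) - y + u"

lemma ent_div_nonneg: "0 < y \<Longrightarrow> 0 < u \<Longrightarrow> 0 \<le> ent_div y u"
  using diff_le_mult_ln[of y u] by (simp add: ent_div_def)

lemma abs_ln_le: "0 < a \<Longrightarrow> a \<le> y \<Longrightarrow> y \<le> b \<Longrightarrow> \<bar>ln y\<bar> \<le> \<bar>ln a\<bar> + \<bar>ln (b::real)\<bar>"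
  using ln_mono[of a y] ln_mono[of y b] by linarith

lemma ranged_mult_ln:
  assumes "ranged M a b f" "0 < a"
  shows "\<exists>c d. ranged M c d (\<lambda>x. f x * ln (f x))"
proof -
  let ?K = "\<bar>b\<bar> * (\<bar>ln a\<bar> + \<bar>ln b\<bar>)"
  have [measurable]: "f \<in> borel_measurable M" by (rule ranged_measurable[OF assms(1)])
  have "\<bar>f x * ln (f x)\<bar> \<le> ?K" if "x \<in> space M" for x
    unfolding abs_mult using ranged_bounds[OF assms(1) that] assms(2) abs_ln_le[of a "f x" b]
    by (intro mult_mono) auto
  then have "ranged M (- ?K) ?K (\<lambda>x. f x * ln (f x))"
    by (intro ranged_absI) auto
  then show ?thesis by blast
qed

lemma ranged_ent_div:
  assumes "ranged M a b f" "ranged M a b g" "0 < a"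
  shows "\<exists>c d. ranged M c d (\<lambda>x. ent_div (f x) (g x))"
proof -
  let ?K = "\<bar>b\<bar> * (2 * (\<bar>ln a\<bar> + \<bar>ln b\<bar>)) + 2 * \<bar>b\<bar>"
  have [measurable]: "f \<in> borel_measurable M" "g \<in> borel_measurable M"
    using assms ranged_measurable by auto
  have "\<bar>ent_div (f x) (g x)\<bar> \<le> ?K" if x: "x \<in> space M" for x
  proof -
    have "\<bar>f x * (ln (f x) - ln (g x))\<bar> \<le> \<bar>b\<bar> * (2 * (\<bar>ln a\<bar> + \<bar>ln b\<bar>))"
      unfolding abs_mult
      using ranged_bounds[OF assms(1) x] ranged_bounds[OF assms(2) x] assms(3)
        abs_ln_le[of a "f x" b] abs_ln_le[of a "g x" b]
      by (intro mult_mono) auto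
    then show ?thesis
      using ranged_bounds[OF assms(1) x] ranged_bounds[OF assms(2) x] assms(3)
      unfolding ent_div_def by linarith
  qed
  moreover have "(\<lambda>x. ent_div (f x) (g x)) \<in> borel_measurable M"
    unfolding ent_div_def by measurable
  ultimately have "ranged M (- ?K) ?K (\<lambda>x. ent_div (f x) (g x))"
    by (intro ranged_absI)
  then show ?thesis by blast
qed

text \<open>Jensen's inequality for the jointly convex \<open>ent_div\<close>: integrate the supporting
  hyperplane at the pair of means.\<close>
lemma (in prob_space) ent_div_expectation_le:
  assumes f: "ranged M a b f" and g: "ranged M a b g" and a: "0 < a"
  shows "ent_div (expectation f) (expectation g) \<le> expectation (\<lambda>x. ent_div (f x) (g x))"
proof -
  let ?r = "expectation f / expectation g"
  have pos: "0 < expectation f" "0 < expectation g"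
    using expectation_ranged[OF f] expectation_ranged[OF g] a by auto
  have r: "0 < ?r" using pos by simp
  obtain c d where cd: "ranged M c d (\<lambda>x. ent_div (f x) (g x))"
    using ranged_ent_div[OF f g a] by blast
  have "ent_div (expectation f) (expectation g) = expectation f * ln ?r + (1 - ?r) * expectation g"
    using pos by (simp add: ent_div_def ln_div algebra_simps)
  also have "\<dots> = expectation (\<lambda>x. f x * ln ?r + (1 - ?r) * g x)"
    using integrable_ranged[OF f] integrable_ranged[OF g] by simp
  also have "\<dots> \<le> expectation (\<lambda>x. ent_div (f x) (g x))"
  proof (rule integral_mono)
    fix x assume x: "x \<in> space M"
    have fg: "0 < f x" "0 < g x" using ranged_bounds[OF f x] ranged_bounds[OF g x] a by auto
    have "f x - ?r * g x \<le> f x * (ln (f x) - ln (?r * g x))"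
      by (intro diff_le_mult_ln fg mult_pos_pos r)
    also have "ln (?r * g x) = ln ?r + ln (g x)" using fg r by (simp only: ln_mult_pos)
    finally show "f x * ln ?r + (1 - ?r) * g x \<le> ent_div (f x) (g x)"
      unfolding ent_div_def by (simp add: algebra_simps)
  qed (use integrable_ranged[OF f] integrable_ranged[OF g] integrable_ranged[OF cd] in auto)
  finally show ?thesis .
qed

lemma space_PiM_upd:
  "x \<in> space (PiM I (\<lambda>_. P)) \<Longrightarrow> y \<in> space P \<Longrightarrow> x(j := y) \<in> space (PiM (insert j I) (\<lambda>_. P))"
  by (auto simp: space_PiM PiE_def extensional_def)

context
  fixes P :: "'a measure" and I :: "'i set" and j :: 'i
  assumes P: "prob_space P" and I: "finite I" "j \<notin> I"
begin

interpretation P: prob_space P by (rule P)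
interpretation prod: product_sigma_finite "\<lambda>_::'i. P" ..

lemma ranged_section:
  assumes "ranged (PiM (insert j I) (\<lambda>_. P)) a b F" and "x \<in> space (PiM I (\<lambda>_. P))"
  shows "ranged P a b (\<lambda>y. F (x(j := y)))"
proof (rule rangedI)
  show "(\<lambda>y. F (x(j := y))) \<in> borel_measurable P"
    using measurable_compose[OF measurable_component_update[OF assms(2) I(2)] ranged_measurable[OF assms(1)]] .
qed (use ranged_bounds[OF assms(1) space_PiM_upd[OF assms(2)]] in blast)

lemma ranged_integrate_out:
  assumes "ranged (PiM (insert j I) (\<lambda>_. P)) a b F"
  shows "ranged (PiM I (\<lambda>_. P)) a b (\<lambda>x. \<integral>y. F (x(j := y)) \<partial>P)"
proof (rule rangedI)
  have "(\<lambda>z. F ((\<lambda>(x, y). x(j := y)) z)) \<in> borel_measurable (PiM I (\<lambda>_. P) \<Otimes>\<^sub>M P)"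
    using measurable_compose[OF measurable_add_dim[of j I "\<lambda>_. P"] ranged_measurable[OF assms]] .
  then have "(\<lambda>(x, y). F (x(j := y))) \<in> borel_measurable (PiM I (\<lambda>_. P) \<Otimes>\<^sub>M P)"
    by (simp add: case_prod_beta')
  then show "(\<lambda>x. \<integral>y. F (x(j := y)) \<partial>P) \<in> borel_measurable (PiM I (\<lambda>_. P))"
    by (rule P.borel_measurable_lebesgue_integral)
qed (rule P.expectation_ranged[OF ranged_section[OF assms]])

lemma integral_PiM_insert:
  assumes "ranged (PiM (insert j I) (\<lambda>_. P)) a b F"
  shows "(\<integral>x. F x \<partial>PiM (insert j I) (\<lambda>_. P)) = (\<integral>x. (\<integral>y. F (x(j := y)) \<partial>P) \<partial>PiM I (\<lambda>_. P))"
proof -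
  interpret Q: prob_space "PiM (insert j I) (\<lambda>_. P)" by (rule prob_space_PiM) (rule P)
  show ?thesis by (rule prod.product_integral_insert[OF I Q.integrable_ranged[OF assms]])
qed

end

text \<open>By induction over the coordinates. Integrating out coordinate \<open>j\<close> splits the entropy of \<open>Y\<close> into
  the mean of the entropies in \<open>j\<close> and the entropy of the average \<open>av Y\<close>. The first part is at most
  the \<open>j\<close>-th summand, as the mean of \<open>ent_div Y c\<close> over the
  coordinate is least when the constant \<open>c\<close> is the mean of \<open>Y\<close>. The second is
  handled by the induction hypothesis for the averages of the \<open>u i\<close>, whose divergence
  is at most the averaged divergence.\<close>
lemma entropy_tensorization:
  fixes P :: "'a measure" and I :: "'i set" and Y :: "('i \<Rightarrow> 'a) \<Rightarrow> real"
  assumes P: "prob_space P" and I: "finite I" and a: "0 < a"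
    and Y: "ranged (PiM I (\<lambda>_. P)) a b Y"
    and u: "\<And>i. i \<in> I \<Longrightarrow> ranged (PiM I (\<lambda>_. P)) a b (u i)"
    and indep: "\<And>i x y. i \<in> I \<Longrightarrow> u i (x(i := y)) = u i x"
  shows "(\<integral>x. Y x * ln (Y x) \<partial>PiM I (\<lambda>_. P)) - (\<integral>x. Y x \<partial>PiM I (\<lambda>_. P)) * ln (\<integral>x. Y x \<partial>PiM I (\<lambda>_. P))
      \<le> (\<Sum>i\<in>I. \<integral>x. ent_div (Y x) (u i x) \<partial>PiM I (\<lambda>_. P))"
  using I Y u indep
proof (induction I arbitrary: Y u rule: finite_induct)
  case empty
  interpret Q: prob_space "PiM ({}::'i set) (\<lambda>_. P)" by (rule prob_space_PiM) (rule P)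
  have const: "(\<integral>x. h x \<partial>PiM ({}::'i set) (\<lambda>_. P)) = h (\<lambda>_. undefined)"
    for h :: "('i \<Rightarrow> 'a) \<Rightarrow> real"
  proof -
    have "(\<integral>x. h x \<partial>PiM {} (\<lambda>_. P)) = (\<integral>x. h (\<lambda>_. undefined) \<partial>PiM ({}::'i set) (\<lambda>_. P))"
      by (intro Bochner_Integration.integral_cong) (auto simp: space_PiM)
    then show ?thesis by (simp add: Q.prob_space)
  qed
  show ?case by (simp add: const)
next
  case (insert j I)
  let ?Q = "PiM I (\<lambda>_. P)" and ?Q' = "PiM (insert j I) (\<lambda>_. P)"
  interpret P: prob_space P by (rule P)
  interpret Q: prob_space ?Q by (rule prob_space_PiM) (rule P)
  interpret Q': prob_space ?Q' by (rule prob_space_PiM) (rule P)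
  note sec = ranged_section[OF P insert.hyps(1,2)]
  note out = ranged_integrate_out[OF P insert.hyps(1,2)]
  note fub = integral_PiM_insert[OF P insert.hyps(1,2)]
  note Y = insert.prems(1) and u = insert.prems(2) and indep = insert.prems(3)
  define av where "av F x = (\<integral>y. F (x(j := y)) \<partial>P)" for F :: "('i \<Rightarrow> 'a) \<Rightarrow> real" and x
  let ?YL = "\<lambda>x. Y x * ln (Y x)"
  obtain c d where YL: "ranged ?Q' c d ?YL" using ranged_mult_ln[OF Y a] by blast
  have "\<exists>c d. ranged ?Q' c d (\<lambda>x. ent_div (Y x) (u i x))" if "i \<in> insert j I" for i
    by (rule ranged_ent_div[OF Y u[OF that] a])
  then obtain c' d' where B: "\<And>i. i \<in> insert j I \<Longrightarrow> ranged ?Q' (c' i) (d' i) (\<lambda>x. ent_div (Y x) (u i x))"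
    by metis
  have avY: "ranged ?Q a b (av Y)" unfolding av_def by (rule out[OF Y])
  obtain c'' d'' where avYL: "ranged ?Q c'' d'' (\<lambda>x. av Y x * ln (av Y x))"
    using ranged_mult_ln[OF avY a] by blast
  have last: "av ?YL x - av Y x * ln (av Y x) \<le> av (\<lambda>x. ent_div (Y x) (u j x)) x"
    if x: "x \<in> space ?Q" for x
  proof -
    obtain y0 where y0: "y0 \<in> space P" using P.not_empty by blast
    have ux: "u j (x(j := y)) = u j x" for y by (rule indep) simp
    have ujx: "0 < u j x"
      using ranged_bounds[OF u space_PiM_upd[OF x y0]] a ux[of y0] by fastforce
    have avx: "0 < av Y x" using ranged_bounds[OF avY x] a by auto
    have "av (\<lambda>x. ent_div (Y x) (u j x)) x = (\<integral>y. (?YL (x(j := y)) - Y (x(j := y)) * (ln (u j x) + 1)) + u j x \<partial>P)"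
      unfolding av_def ux by (intro Bochner_Integration.integral_cong) (simp_all add: ent_div_def algebra_simps)
    also have "\<dots> = av ?YL x - av Y x * (ln (u j x) + 1) + u j x"
      unfolding av_def
      by (simp add: P.integrable_ranged[OF sec[OF Y x]] P.integrable_ranged[OF sec[OF YL x]] P.prob_space
          del: fun_upd_apply)
    finally show ?thesis
      using ent_div_nonneg[OF avx ujx] by (simp add: ent_div_def algebra_simps)
  qed
  have IH: "(\<integral>x. av Y x * ln (av Y x) \<partial>?Q) - (\<integral>x. av Y x \<partial>?Q) * ln (\<integral>x. av Y x \<partial>?Q)
      \<le> (\<Sum>i\<in>I. \<integral>x. ent_div (av Y x) (av (u i) x) \<partial>?Q)"
  proof (rule insert.IH[OF avY])
    show "ranged ?Q a b (av (u i))" if "i \<in> I" for i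
      unfolding av_def using that by (intro out u) auto
    show "av (u i) (x(i := y)) = av (u i) x" if "i \<in> I" for i x y
    proof -
      have "i \<noteq> j" using that insert.hyps by auto
      then have "(x(i := y))(j := z) = (x(j := z))(i := y)" for z by (rule fun_upd_twist)
      moreover have "u i ((x(j := z))(i := y)) = u i (x(j := z))" for z
        using that by (intro indep) simp
      ultimately show ?thesis unfolding av_def by (simp only:)
    qed
  qed
  have convex: "(\<integral>x. ent_div (av Y x) (av (u i) x) \<partial>?Q) \<le> (\<integral>x. ent_div (Y x) (u i x) \<partial>?Q')"
    if i: "i \<in> I" for i
  proof -
    have ui: "ranged ?Q' a b (u i)" using i u by auto
    have Bi: "ranged ?Q' (c' i) (d' i) (\<lambda>x. ent_div (Y x) (u i x))" using i B by auto
    obtain e f where ef: "ranged ?Q e f (\<lambda>x. ent_div (av Y x) (av (u i) x))"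
      using ranged_ent_div[OF avY _ a, of "av (u i)"] out[OF ui] unfolding av_def by blast
    have "(\<integral>x. ent_div (av Y x) (av (u i) x) \<partial>?Q) \<le> (\<integral>x. av (\<lambda>x. ent_div (Y x) (u i x)) x \<partial>?Q)"
    proof (rule integral_mono)
      show "integrable ?Q (\<lambda>x. ent_div (av Y x) (av (u i) x))" by (rule Q.integrable_ranged[OF ef])
      show "integrable ?Q (av (\<lambda>x. ent_div (Y x) (u i x)))"
        unfolding av_def by (rule Q.integrable_ranged[OF out[OF Bi]])
      fix x assume x: "x \<in> space ?Q"
      show "ent_div (av Y x) (av (u i) x) \<le> av (\<lambda>x. ent_div (Y x) (u i x)) x"
        unfolding av_def by (rule P.ent_div_expectation_le[OF sec[OF Y x] sec[OF ui x] a])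
    qed
    then show ?thesis unfolding av_def fub[OF Bi] .
  qed
  have split: "(\<integral>x. ?YL x \<partial>?Q') - (\<integral>x. av Y x * ln (av Y x) \<partial>?Q)
      \<le> (\<integral>x. ent_div (Y x) (u j x) \<partial>?Q')"
  proof -
    have Bj: "ranged ?Q' (c' j) (d' j) (\<lambda>x. ent_div (Y x) (u j x))" using B by auto
    have iYL: "integrable ?Q (av ?YL)" unfolding av_def by (rule Q.integrable_ranged[OF out[OF YL]])
    have "(\<integral>x. ?YL x \<partial>?Q') - (\<integral>x. av Y x * ln (av Y x) \<partial>?Q)
        = (\<integral>x. av ?YL x - av Y x * ln (av Y x) \<partial>?Q)"
    proof -
      have "(\<integral>x. ?YL x \<partial>?Q') = (\<integral>x. av ?YL x \<partial>?Q)" unfolding av_def by (rule fub[OF YL])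
      then show ?thesis
        by (simp add: Bochner_Integration.integral_diff[OF iYL Q.integrable_ranged[OF avYL]])
    qed
    also have "\<dots> \<le> (\<integral>x. av (\<lambda>x. ent_div (Y x) (u j x)) x \<partial>?Q)"
    proof (rule integral_mono)
      show "integrable ?Q (\<lambda>x. av ?YL x - av Y x * ln (av Y x))"
        using iYL Q.integrable_ranged[OF avYL] by simp
      show "integrable ?Q (av (\<lambda>x. ent_div (Y x) (u j x)))"
        unfolding av_def by (rule Q.integrable_ranged[OF out[OF Bj]])
    qed (rule last)
    also have "\<dots> = (\<integral>x. ent_div (Y x) (u j x) \<partial>?Q')"
      unfolding av_def by (rule fub[OF Bj, symmetric])
    finally show ?thesis .
  qed
  have EY: "(\<integral>x. Y x \<partial>?Q') = (\<integral>x. av Y x \<partial>?Q)" unfolding av_def by (rule fub[OF Y])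
  have "(\<Sum>i\<in>I. \<integral>x. ent_div (av Y x) (av (u i) x) \<partial>?Q) \<le> (\<Sum>i\<in>I. \<integral>x. ent_div (Y x) (u i x) \<partial>?Q')"
    by (intro sum_mono convex)
  then show ?case using IH split insert.hyps unfolding EY by simp
qed

section \<open>From an entropy inequality to a tail bound\<close>

lemma exp_remainder_le: "\<bar>exp t - 1 - t\<bar> \<le> t\<^sup>2 * exp \<bar>t\<bar>" for t :: real
proof -
  have "1 - t \<le> exp (- t)" using exp_ge_add_one_self[of "- t"] by simp
  then have "(1 - t) * exp t \<le> exp (- t) * exp t" by (intro mult_right_mono) auto
  then have up: "exp t - 1 - t \<le> t * (exp t - 1)" by (simp add: exp_minus algebra_simps)
  have "t * (exp t - 1) \<le> \<bar>t\<bar> * (\<bar>t\<bar> * exp \<bar>t\<bar>)"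
  proof (cases "0 \<le> t")
    case True
    then have "exp t - 1 \<le> t * exp t" using \<open>(1 - t) * exp t \<le> exp (- t) * exp t\<close>
      by (simp add: exp_minus algebra_simps)
    then show ?thesis using True by (auto intro: mult_left_mono)
  next
    case False
    have "1 - exp t \<le> - t * 1" using exp_ge_add_one_self[of t] by linarith
    also have "\<dots> \<le> - t * exp \<bar>t\<bar>" using False by (intro mult_left_mono) auto
    finally have "\<bar>t\<bar> * (1 - exp t) \<le> \<bar>t\<bar> * (\<bar>t\<bar> * exp \<bar>t\<bar>)"
      using False by (intro mult_left_mono) auto
    then show ?thesis using False by (simp add: algebra_simps)
  qed
  moreover have "0 \<le> exp t - 1 - t" using exp_ge_add_one_self[of t] by linarith
  ultimately show ?thesis using up by (simp add: power2_eq_square abs_mult_self_eq flip: mult.assoc)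
qed

lemma ranged_exp_mult:
  assumes "ranged M (- C) C Z"
  shows "ranged M (exp (- (\<bar>l\<bar> * C))) (exp (\<bar>l\<bar> * C)) (\<lambda>x. exp (l * Z x))"
proof (rule rangedI)
  have [measurable]: "Z \<in> borel_measurable M" by (rule ranged_measurable[OF assms])
  show "(\<lambda>x. exp (l * Z x)) \<in> borel_measurable M" by measurable
  fix x assume "x \<in> space M"
  then have "\<bar>Z x\<bar> \<le> C" using ranged_bounds[OF assms] by (simp add: abs_le_iff minus_le_iff)
  then have "\<bar>l * Z x\<bar> \<le> \<bar>l\<bar> * C" by (simp add: abs_mult mult_left_mono)
  then show "exp (- (\<bar>l\<bar> * C)) \<le> exp (l * Z x) \<and> exp (l * Z x) \<le> exp (\<bar>l\<bar> * C)"
    unfolding exp_le_cancel_iff by linarith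
qed

lemma ranged_times:
  assumes f: "ranged M a b f" and g: "ranged M c d g"
  shows "\<exists>K. ranged M (- K) K (\<lambda>x. f x * g x)"
proof -
  have [measurable]: "f \<in> borel_measurable M" "g \<in> borel_measurable M"
    using f g ranged_measurable by auto
  have "ranged M (- ((\<bar>a\<bar> + \<bar>b\<bar>) * (\<bar>c\<bar> + \<bar>d\<bar>))) ((\<bar>a\<bar> + \<bar>b\<bar>) * (\<bar>c\<bar> + \<bar>d\<bar>)) (\<lambda>x. f x * g x)"
  proof (rule ranged_absI)
    fix x assume x: "x \<in> space M"
    have "\<bar>f x\<bar> \<le> \<bar>a\<bar> + \<bar>b\<bar>" "\<bar>g x\<bar> \<le> \<bar>c\<bar> + \<bar>d\<bar>"
      using ranged_bounds[OF f x] ranged_bounds[OF g x] by linarith+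
    then show "\<bar>f x * g x\<bar> \<le> (\<bar>a\<bar> + \<bar>b\<bar>) * (\<bar>c\<bar> + \<bar>d\<bar>)"
      unfolding abs_mult by (intro mult_mono) auto
  qed measurable
  then show ?thesis by blast
qed

context prob_space
begin

text \<open>Differentiation under the integral, by a second-order bound on the remainder that is
  uniform since \<open>Z\<close> is bounded.\<close>
lemma mgf_has_derivative:
  assumes Z: "ranged M (- C) C Z"
  shows "((\<lambda>l. expectation (\<lambda>x. exp (l * Z x))) has_real_derivative expectation (\<lambda>x. Z x * exp (l * Z x))) (at l)"
proof -
  let ?F = "\<lambda>l. expectation (\<lambda>x. exp (l * Z x))" and ?D = "expectation (\<lambda>x. Z x * exp (l * Z x))"
  let ?K = "exp (\<bar>l\<bar> * C) * (C\<^sup>2 * exp C)"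
  note int = integrable_ranged[OF ranged_exp_mult[OF Z]]
  obtain K where "ranged M (- K) K (\<lambda>x. Z x * exp (l * Z x))"
    using ranged_times[OF Z ranged_exp_mult[OF Z]] by blast
  then have intD: "integrable M (\<lambda>x. Z x * exp (l * Z x))" by (rule integrable_ranged)
  have C: "0 \<le> C" using not_empty ranged_bounds[OF Z] by fastforce
  have bound: "norm ((?F (l + h) - ?F l) / h - ?D) \<le> ?K * \<bar>h\<bar>" if h: "h \<noteq> 0" "\<bar>h\<bar> \<le> 1" for h
  proof -
    have "?F (l + h) - ?F l - h * ?D
        = expectation (\<lambda>x. exp ((l + h) * Z x) - exp (l * Z x) - h * (Z x * exp (l * Z x)))"
      using int intD by simp
    also have "\<bar>\<dots>\<bar> \<le> expectation (\<lambda>x. ?K * h\<^sup>2)"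
    proof (rule integral_abs_bound[THEN order_trans], rule integral_mono)
      show "integrable M (\<lambda>x. \<bar>exp ((l + h) * Z x) - exp (l * Z x) - h * (Z x * exp (l * Z x))\<bar>)"
        using int intD by (intro integrable_abs Bochner_Integration.integrable_diff) auto
      fix x assume x: "x \<in> space M"
      have Zx: "\<bar>Z x\<bar> \<le> C" using ranged_bounds[OF Z x] by linarith
      have "\<bar>h * Z x\<bar> \<le> 1 * C" unfolding abs_mult using h(2) Zx by (intro mult_mono) auto
      then have hZ: "\<bar>h * Z x\<bar> \<le> C" by simp
      have "exp ((l + h) * Z x) - exp (l * Z x) - h * (Z x * exp (l * Z x))
          = exp (l * Z x) * (exp (h * Z x) - 1 - h * Z x)"
        by (simp add: exp_add algebra_simps)
      also have "\<bar>\<dots>\<bar> \<le> exp (\<bar>l\<bar> * C) * ((h * Z x)\<^sup>2 * exp \<bar>h * Z x\<bar>)"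
        unfolding abs_mult
        using ranged_bounds[OF ranged_exp_mult[OF Z] x, of l] exp_remainder_le[of "h * Z x"]
        by (intro mult_mono) (auto simp: abs_mult)
      also have "\<dots> \<le> exp (\<bar>l\<bar> * C) * ((h\<^sup>2 * C\<^sup>2) * exp C)"
        using hZ Zx by (intro mult_left_mono mult_mono)
          (auto simp: power_mult_distrib intro!: mult_left_mono abs_le_square_iff[THEN iffD1])
      finally show "\<bar>exp ((l + h) * Z x) - exp (l * Z x) - h * (Z x * exp (l * Z x))\<bar> \<le> ?K * h\<^sup>2"
        by (simp add: mult_ac)
    qed auto
    also have "\<dots> = ?K * h\<^sup>2" by (simp add: prob_space)
    finally have "\<bar>?F (l + h) - ?F l - h * ?D\<bar> / \<bar>h\<bar> \<le> ?K * h\<^sup>2 / \<bar>h\<bar>"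
      by (intro divide_right_mono) auto
    moreover have "?K * h\<^sup>2 / \<bar>h\<bar> = ?K * \<bar>h\<bar>"
      using h(1) by (simp add: power2_eq_square field_simps abs_mult_self_eq)
    moreover have "\<bar>?F (l + h) - ?F l - h * ?D\<bar> / \<bar>h\<bar> = norm ((?F (l + h) - ?F l) / h - ?D)"
      using h(1) by (simp add: field_simps flip: abs_divide)
    ultimately show ?thesis by simp
  qed
  have "((\<lambda>h. (?F (l + h) - ?F l) / h - ?D) \<longlongrightarrow> 0) (at 0)"
  proof (rule Lim_null_comparison)
    show "\<forall>\<^sub>F h in at 0. norm ((?F (l + h) - ?F l) / h - ?D) \<le> ?K * \<bar>h\<bar>"
      unfolding eventually_at by (rule exI[of _ 1]) (use bound in \<open>auto simp: dist_real_def\<close>)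
    show "((\<lambda>h. ?K * \<bar>h\<bar>) \<longlongrightarrow> 0) (at 0)"
      by (rule tendsto_eq_intros refl | simp)+
  qed
  then show ?thesis unfolding DERIV_def by (simp add: LIM_zero_iff)
qed

text \<open>Divided by \<open>l\<^sup>2\<close> times the moment generating function \<open>F l\<close>, the hypothesis says that
  \<open>ln (F l) / l - ln (F l) - l * v / 2\<close> has a nonpositive derivative. Its limit at \<open>0\<close> is the
  mean of \<open>Z\<close>.\<close>
lemma herbst_argument:
  assumes Z: "ranged M (- C) C Z"
    and ent: "\<And>l. 0 < l \<Longrightarrow> l < 1 \<Longrightarrow>
      l * expectation (\<lambda>x. Z x * exp (l * Z x))
        - expectation (\<lambda>x. exp (l * Z x)) * ln (expectation (\<lambda>x. exp (l * Z x)))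
      \<le> l\<^sup>2 * (expectation (\<lambda>x. Z x * exp (l * Z x)) + v / 2 * expectation (\<lambda>x. exp (l * Z x)))"
    and l: "0 < l" "l < 1"
  shows "ln (expectation (\<lambda>x. exp (l * Z x))) \<le> (l * expectation Z + l\<^sup>2 * v / 2) / (1 - l)"
proof -
  define F where "F l = expectation (\<lambda>x. exp (l * Z x))" for l
  define D where "D l = expectation (\<lambda>x. Z x * exp (l * Z x))" for l
  have Fpos: "0 < F s" for s
    using expectation_ranged[OF ranged_exp_mult[OF Z]] exp_gt_zero less_le_trans unfolding F_def by blast
  have dF: "(F has_real_derivative D s) (at s)" for s
    unfolding F_def D_def by (rule mgf_has_derivative[OF Z])
  have dL: "((\<lambda>s. ln (F s)) has_real_derivative D s / F s) (at s)" for s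
    using Fpos dF by (auto intro!: derivative_eq_intros)
  define \<Phi> where "\<Phi> s = ln (F s) / s - ln (F s) - s * v / 2" for s
  have d\<Phi>: "(\<Phi> has_real_derivative (D s / F s * s - ln (F s)) / s\<^sup>2 - D s / F s - v / 2) (at s)"
    if "0 < s" for s
  proof -
    have "((\<lambda>s. ln (F s) / s) has_real_derivative (D s / F s * s - ln (F s) * 1) / (s * s)) (at s)"
      using that by (intro DERIV_divide dL DERIV_ident) auto
    moreover have "((\<lambda>s. s * v / 2) has_real_derivative v / 2) (at s)"
      by (auto intro!: derivative_eq_intros)
    ultimately show ?thesis
      unfolding \<Phi>_def using DERIV_diff[OF DERIV_diff[OF _ dL]] by (simp add: power2_eq_square)
  qed
  have neg: "(D s / F s * s - ln (F s)) / s\<^sup>2 - D s / F s - v / 2 \<le> 0" if "0 < s" "s < 1" for s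
  proof -
    have "s * D s - F s * ln (F s) \<le> s\<^sup>2 * (D s + v / 2 * F s)"
      using ent[OF that] by (simp add: F_def D_def)
    then have "(s * D s - F s * ln (F s)) / (F s * s\<^sup>2) \<le> s\<^sup>2 * (D s + v / 2 * F s) / (F s * s\<^sup>2)"
      using Fpos[of s] that by (intro divide_right_mono) auto
    also have "\<dots> = D s / F s + v / 2" using Fpos[of s] that by (simp add: field_simps)
    also have "(s * D s - F s * ln (F s)) / (F s * s\<^sup>2) = (D s / F s * s - ln (F s)) / s\<^sup>2"
      using Fpos[of s] that by (simp add: field_simps)
    finally show ?thesis by linarith
  qed
  have mono: "\<Phi> l \<le> \<Phi> s" if s: "0 < s" "s \<le> l" for s
  proof (rule DERIV_nonpos_imp_nonincreasing[OF s(2)])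
    fix t assume "s \<le> t" "t \<le> l"
    then have "0 < t" "t < 1" using s l by auto
    then show "\<exists>y. (\<Phi> has_real_derivative y) (at t) \<and> y \<le> 0" using d\<Phi> neg by blast
  qed
  have F0: "F 0 = 1" "D 0 = expectation Z" by (simp_all add: F_def D_def prob_space)
  have "((\<lambda>h. (ln (F (0 + h)) - ln (F 0)) / h) \<longlongrightarrow> D 0 / F 0) (at 0)"
    using dL[of 0] unfolding DERIV_def .
  then have lim1: "((\<lambda>h. ln (F h) / h) \<longlongrightarrow> expectation Z) (at_right 0)"
    using F0 by (auto intro: tendsto_mono[OF at_le])
  have "((\<lambda>s. ln (F s)) \<longlongrightarrow> ln (F 0)) (at 0)"
    using DERIV_isCont[OF dL[of 0]] by (simp add: isCont_def)
  then have lim2: "((\<lambda>s. ln (F s)) \<longlongrightarrow> 0) (at_right 0)"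
    using F0 by (auto intro: tendsto_mono[OF at_le])
  have lim3: "((\<lambda>s. s * v / 2) \<longlongrightarrow> 0 * v / 2) (at_right 0)" by (intro tendsto_intros) auto
  have "(\<Phi> \<longlongrightarrow> expectation Z - 0 - 0 * v / 2) (at_right 0)"
    unfolding \<Phi>_def by (intro tendsto_diff lim1 lim2 lim3)
  moreover have "\<forall>\<^sub>F s in at_right 0. \<Phi> l \<le> \<Phi> s"
    unfolding eventually_at_right[OF l(1)] by (rule exI[of _ l]) (use mono l in auto)
  ultimately have "\<Phi> l \<le> expectation Z - 0 - 0 * v / 2"
    by (intro tendsto_lowerbound) auto
  then have "ln (F l) * (1 - l) \<le> l * expectation Z + l\<^sup>2 * v / 2"
    using l by (simp add: \<Phi>_def field_simps power2_eq_square)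
  then show ?thesis using l by (simp add: F_def field_simps)
qed

text \<open>The Chernoff bound. With \<open>a\<^sup>2 = v / 2 + E0\<close> and \<open>b\<^sup>2 = x\<close>, the parameter \<open>l = b / (a + b)\<close> makes the
  exponent equal to \<open>- x\<close>. The upper bound \<open>E0\<close> replaces the mean because it is positive, which keeps
  \<open>l < 1\<close>.\<close>
lemma tail_from_mgf:
  assumes Z: "ranged M (- C) C Z"
    and mgf: "\<And>l. 0 < l \<Longrightarrow> l < 1 \<Longrightarrow>
      ln (expectation (\<lambda>x. exp (l * Z x))) \<le> (l * expectation Z + l\<^sup>2 * v / 2) / (1 - l)"
    and E0: "expectation Z \<le> E0" "0 < E0" and v: "0 \<le> v" and x: "0 < x"
  shows "prob {\<omega>\<in>space M. E0 + 2 * sqrt ((v / 2 + E0) * x) + x < Z \<omega>} \<le> exp (- x)"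
proof -
  define a where "a = sqrt (v / 2 + E0)"
  define b where "b = sqrt x"
  define l where "l = b / (a + b)"
  define t where "t = E0 + 2 * sqrt ((v / 2 + E0) * x) + x"
  have [measurable]: "Z \<in> borel_measurable M" by (rule ranged_measurable[OF Z])
  have a: "0 < a" "a\<^sup>2 = v / 2 + E0" using E0 v by (auto simp: a_def)
  have b: "0 < b" "b\<^sup>2 = x" using x by (auto simp: b_def)
  have l: "0 < l" "l < 1" "1 - l = a / (a + b)" using a b by (auto simp: l_def field_simps)
  have t: "t = E0 + 2 * a * b + b\<^sup>2" using b by (simp add: t_def real_sqrt_mult a_def b_def)
  have pos: "0 < expectation (\<lambda>x. exp (l * Z x))"
    using expectation_ranged[OF ranged_exp_mult[OF Z]] exp_gt_zero less_le_trans by blast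
  have "prob {\<omega>\<in>space M. t < Z \<omega>} = expectation (indicator {\<omega>\<in>space M. t < Z \<omega>})" by simp
  also have "\<dots> \<le> expectation (\<lambda>\<omega>. exp (- l * t) * exp (l * Z \<omega>))"
  proof (rule integral_mono)
    show "integrable M (\<lambda>\<omega>. exp (- l * t) * exp (l * Z \<omega>))"
      using integrable_ranged[OF ranged_exp_mult[OF Z]] by simp
    fix \<omega> assume "\<omega> \<in> space M"
    have "1 \<le> exp (l * (Z \<omega> - t))" if "t < Z \<omega>" using l that by simp
    moreover have "exp (l * (Z \<omega> - t)) = exp (- l * t) * exp (l * Z \<omega>)"
      by (simp add: exp_add[symmetric] algebra_simps)
    ultimately show "indicator {\<omega>\<in>space M. t < Z \<omega>} \<omega> \<le> exp (- l * t) * exp (l * Z \<omega>)"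
      by (auto simp: indicator_def)
  qed (simp add: integrable_real_indicator emeasure_eq_measure)
  also have "\<dots> = exp (- l * t) * expectation (\<lambda>x. exp (l * Z x))" by simp
  also have "\<dots> = exp (- l * t + ln (expectation (\<lambda>x. exp (l * Z x))))"
    unfolding exp_add using pos by simp
  also have "\<dots> \<le> exp (- x)"
  proof -
    have "ln (expectation (\<lambda>x. exp (l * Z x))) \<le> (l * expectation Z + l\<^sup>2 * v / 2) / (1 - l)"
      using l by (intro mgf)
    also have "\<dots> \<le> (l * E0 + l\<^sup>2 * v / 2) / (1 - l)"
      using l E0 by (intro divide_right_mono add_right_mono mult_left_mono) auto
    also have "\<dots> = l * E0 + l\<^sup>2 * a\<^sup>2 / (1 - l)"
      using l(1,2) unfolding a(2) by (simp add: field_simps power2_eq_square)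
    also have "l\<^sup>2 * a\<^sup>2 / (1 - l) = l * (a * b)"
      unfolding l(3) using a(1) b(1) by (simp add: l_def power2_eq_square)
    finally have "- l * t + ln (expectation (\<lambda>x. exp (l * Z x))) \<le> - (l * (a * b + b\<^sup>2))"
      unfolding t by (simp add: algebra_simps)
    also have "l * (a * b + b\<^sup>2) = b\<^sup>2"
      using a(1) b(1) by (simp add: l_def power2_eq_square field_simps)
    finally show ?thesis using b by simp
  qed
  finally show ?thesis by (simp add: t_def)
qed

end

section \<open>Concentration of the supremum\<close>

text \<open>Both sides agree at \<open>x = 0\<close>. The derivative of their difference has the sign of \<open>x\<close> because
  \<open>(1 - l) * exp (l * x) \<le> 1\<close> for \<open>x \<le> 1\<close>. In the application \<open>x\<close> is the increment
  \<open>Z - Z\<^sub>i\<close>; the first term of the bound, times \<open>exp (l * Z\<^sub>i)\<close>, sums over \<open>i\<close> to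
  at most \<open>Z * exp (l * Z)\<close>, while \<open>x\<^sup>2 / 2 - x\<close> decreases in \<open>x \<le> 1\<close>, so there a lower bound of the increment
  suffices.\<close>
lemma one_sided_exp_inequality:
  fixes l x :: real
  assumes l: "0 \<le> l" "l \<le> 1" and x: "x \<le> 1"
  shows "1 + (l * x - 1) * exp (l * x) \<le> l\<^sup>2 * (x * exp (l * x) + x\<^sup>2 / 2 - x)"
proof -
  define D where "D x = l\<^sup>2 * (x * exp (l * x) + x\<^sup>2 / 2 - x) - (1 + (l * x - 1) * exp (l * x))" for x
  define D' where "D' x = l\<^sup>2 * ((exp (l * x) - 1) + x * (1 - (1 - l) * exp (l * x)))" for x
  have der: "(D has_real_derivative D' y) (at y)" for y
    unfolding D_def D'_def
    by (auto intro!: derivative_eq_intros) (simp add: algebra_simps power2_eq_square)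
  have key: "(1 - l) * exp (l * y) \<le> 1" if "y \<le> 1" for y
  proof -
    have "(1 - l) * exp (l * y) \<le> exp (- l) * exp (l * y)"
      using exp_ge_add_one_self[of "- l"] by (intro mult_right_mono) auto
    also have "\<dots> = exp (l * (y - 1))" by (simp add: exp_add[symmetric] algebra_simps)
    also have "\<dots> \<le> 1" using l that by (simp add: mult_nonneg_nonpos)
    finally show ?thesis .
  qed
  have "D 0 \<le> D x"
  proof (cases "0 \<le> x")
    case True
    show ?thesis
    proof (rule DERIV_nonneg_imp_nondecreasing[OF True])
      fix y assume "0 \<le> y" "y \<le> x"
      then have "0 \<le> D' y" using key[of y] x l unfolding D'_def
        by (intro mult_nonneg_nonneg add_nonneg_nonneg) auto
      then show "\<exists>d. (D has_real_derivative d) (at y) \<and> 0 \<le> d" using der by blast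
    qed
  next
    case False
    then have "x \<le> 0" by simp
    then show ?thesis
    proof (rule DERIV_nonpos_imp_nonincreasing)
      fix y assume "x \<le> y" "y \<le> 0"
      then have "exp (l * y) - 1 \<le> 0" "y * (1 - (1 - l) * exp (l * y)) \<le> 0"
        using key[of y] l by (auto simp: mult_nonneg_nonpos mult_nonpos_nonneg)
      then have "(exp (l * y) - 1) + y * (1 - (1 - l) * exp (l * y)) \<le> 0" by linarith
      then have "D' y \<le> 0" unfolding D'_def by (rule mult_nonneg_nonpos[OF zero_le_power2])
      then show "\<exists>d. (D has_real_derivative d) (at y) \<and> d \<le> 0" using der by blast
    qed
  qed
  then show ?thesis by (simp add: D_def)
qed

definition max_sum :: "('a \<Rightarrow> real) set \<Rightarrow> 'i set \<Rightarrow> ('i \<Rightarrow> 'a) \<Rightarrow> real" where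
  "max_sum G J x = Max ((\<lambda>g. \<Sum>j\<in>J. g (x j)) ` G)"

lemma max_sum_ge: "finite G \<Longrightarrow> g \<in> G \<Longrightarrow> (\<Sum>j\<in>J. g (x j)) \<le> max_sum G J x"
  by (simp add: max_sum_def)

lemma max_sum_attained:
  assumes "finite G" "G \<noteq> {}"
  obtains g where "g \<in> G" "max_sum G J x = (\<Sum>j\<in>J. g (x j))"
proof -
  have "max_sum G J x \<in> (\<lambda>g. \<Sum>j\<in>J. g (x j)) ` G"
    unfolding max_sum_def using assms by (intro Max_in) auto
  then show ?thesis using that by auto
qed

lemma max_sum_upd: "i \<notin> J \<Longrightarrow> max_sum G J (x(i := y)) = max_sum G J x"
  unfolding max_sum_def by (intro arg_cong[where f = Max] image_cong sum.cong) auto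

lemma ranged_sum_PiM:
  assumes g: "ranged P a b g" and J: "finite J" "J \<subseteq> K"
  shows "ranged (PiM K (\<lambda>_. P)) (real (card J) * a) (real (card J) * b) (\<lambda>x. \<Sum>j\<in>J. g (x j))"
proof (rule rangedI)
  show "(\<lambda>x. \<Sum>j\<in>J. g (x j)) \<in> borel_measurable (PiM K (\<lambda>_. P))"
  proof (rule borel_measurable_sum)
    fix j assume "j \<in> J"
    then have "(\<lambda>x. x j) \<in> measurable (PiM K (\<lambda>_. P)) P"
      using J by (intro measurable_component_singleton) auto
    then show "(\<lambda>x. g (x j)) \<in> borel_measurable (PiM K (\<lambda>_. P))"
      using measurable_compose ranged_measurable[OF g] by blast
  qed
  fix x assume x: "x \<in> space (PiM K (\<lambda>_. P))"
  have "a \<le> g (x j) \<and> g (x j) \<le> b" if "j \<in> J" for j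
    using x that J by (intro ranged_bounds[OF g]) (auto simp: space_PiM)
  then show "real (card J) * a \<le> (\<Sum>j\<in>J. g (x j)) \<and> (\<Sum>j\<in>J. g (x j)) \<le> real (card J) * b"
    using sum_bounded_below[of J a "\<lambda>j. g (x j)"] sum_bounded_above[of J "\<lambda>j. g (x j)" b] by auto
qed

lemma ranged_Max:
  assumes "finite G" "G \<noteq> {}" and "\<And>g. g \<in> G \<Longrightarrow> ranged M a b (h g)"
  shows "ranged M a b (\<lambda>x. Max ((\<lambda>g. h g x) ` G))"
proof (rule rangedI)
  show "(\<lambda>x. Max ((\<lambda>g. h g x) ` G)) \<in> borel_measurable M"
    using assms by (intro borel_measurable_Max ranged_measurable) auto
  fix x assume x: "x \<in> space M"
  have "Max ((\<lambda>g. h g x) ` G) \<in> (\<lambda>g. h g x) ` G" using assms by (intro Max_in) auto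
  then show "a \<le> Max ((\<lambda>g. h g x) ` G) \<and> Max ((\<lambda>g. h g x) ` G) \<le> b"
    using ranged_bounds[OF assms(3) x] by auto
qed

lemma ranged_max_sum:
  assumes "finite G" "G \<noteq> {}" and "\<And>g. g \<in> G \<Longrightarrow> ranged P (- 1) 1 g" and "finite J" "J \<subseteq> K"
  shows "ranged (PiM K (\<lambda>_. P)) (- real (card J)) (card J) (max_sum G J)"
  unfolding max_sum_def
proof (rule ranged_Max[OF assms(1,2)])
  fix g assume "g \<in> G"
  show "ranged (PiM K (\<lambda>_. P)) (- real (card J)) (card J) (\<lambda>x. \<Sum>j\<in>J. g (x j))"
    using ranged_sum_PiM[OF assms(3)[OF \<open>g \<in> G\<close>] assms(4,5)] by simp
qed

text \<open>Bousquet's differential inequality. For a fixed choice of the other coordinates, let \<open>h\<close> attain the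
  maximum \<open>Zi i\<close> without coordinate \<open>i\<close>. Then \<open>h \<le> U i \<le> 1\<close>, so \<open>(U i)\<^sup>2 / 2 - U i\<close> is at most
  \<open>h\<^sup>2 / 2 - h\<close>, whose mean is at most \<open>s / 2\<close> as \<open>h\<close> is centered. For the same reason
  integrating over coordinate \<open>i\<close> does not decrease \<open>exp (l * Z)\<close> below \<open>exp (l * Zi i)\<close>.\<close>
lemma max_sum_entropy:
  fixes P :: "'a measure" and I :: "'i set" and s :: real
  assumes P: "prob_space P" and I: "finite I" and G: "finite G" "G \<noteq> {}"
    and g: "\<And>g. g \<in> G \<Longrightarrow> ranged P (- 1) 1 g"
    and mean: "\<And>g. g \<in> G \<Longrightarrow> (\<integral>y. g y \<partial>P) = 0"
    and var: "\<And>g. g \<in> G \<Longrightarrow> (\<integral>y. (g y)\<^sup>2 \<partial>P) \<le> s"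
    and l: "0 < l" "l < 1"
  defines "Q \<equiv> PiM I (\<lambda>_. P)" and "Z \<equiv> max_sum G I"
  shows "l * (\<integral>x. Z x * exp (l * Z x) \<partial>Q) - (\<integral>x. exp (l * Z x) \<partial>Q) * ln (\<integral>x. exp (l * Z x) \<partial>Q)
      \<le> l\<^sup>2 * ((\<integral>x. Z x * exp (l * Z x) \<partial>Q) + card I * s / 2 * (\<integral>x. exp (l * Z x) \<partial>Q))"
proof -
  interpret P: prob_space P by (rule P)
  interpret Q: prob_space Q unfolding Q_def by (rule prob_space_PiM) (rule P)
  define n where "n = real (card I)"
  define Zi where "Zi i = max_sum G (I - {i})" for i :: 'i
  define Y where "Y x = exp (l * Z x)" for x
  define u where "u i x = exp (l * Zi i x)" for i x
  define U where "U i x = Z x - Zi i x" for i x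
  have Z: "ranged Q (- n) n Z"
    unfolding Q_def Z_def n_def by (rule ranged_max_sum[OF G g I]) auto
  have Zi: "ranged Q (- n) n (Zi i)" if "i \<in> I" for i
  proof -
    have "ranged Q (- real (card (I - {i}))) (card (I - {i})) (Zi i)"
      unfolding Q_def Zi_def using I by (intro ranged_max_sum[OF G g]) auto
    moreover have "card (I - {i}) \<le> card I" using I by (intro card_mono) auto
    ultimately show ?thesis unfolding ranged_def n_def by fastforce
  qed
  have Y: "ranged Q (exp (- (\<bar>l\<bar> * n))) (exp (\<bar>l\<bar> * n)) Y"
    unfolding Y_def by (rule ranged_exp_mult[OF Z])
  have u: "ranged Q (exp (- (\<bar>l\<bar> * n))) (exp (\<bar>l\<bar> * n)) (u i)" if "i \<in> I" for i
    unfolding u_def by (rule ranged_exp_mult[OF Zi[OF that]])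
  have U_le: "U i x \<le> 1" if i: "i \<in> I" and x: "x \<in> space Q" for i x
  proof -
    obtain h where h: "h \<in> G" "Z x = (\<Sum>j\<in>I. h (x j))"
      using max_sum_attained[OF G] unfolding Z_def by blast
    have "Z x = h (x i) + (\<Sum>j\<in>I - {i}. h (x j))" using h I i by (simp add: sum.remove)
    also have "(\<Sum>j\<in>I - {i}. h (x j)) \<le> Zi i x" unfolding Zi_def by (rule max_sum_ge[OF G(1) h(1)])
    also have "h (x i) \<le> 1"
      using ranged_bounds[OF g[OF h(1)], of "x i"] x i by (auto simp: Q_def space_PiM)
    finally show ?thesis by (simp add: U_def)
  qed
  have sumU: "(\<Sum>i\<in>I. U i x) \<le> Z x" for x
  proof -
    obtain h where h: "h \<in> G" "Z x = (\<Sum>j\<in>I. h (x j))"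
      using max_sum_attained[OF G] unfolding Z_def by blast
    have "U i x \<le> h (x i)" if i: "i \<in> I" for i
      using h(2) max_sum_ge[OF G(1) h(1), of x "I - {i}"] I i
      by (simp add: U_def Zi_def sum.remove)
    then have "(\<Sum>i\<in>I. U i x) \<le> (\<Sum>i\<in>I. h (x i))" by (intro sum_mono)
    then show ?thesis using h by simp
  qed
  have Ur: "ranged Q (- 2 * n) (2 * n) (U i)" if "i \<in> I" for i
    using Z Zi[OF that] unfolding ranged_def U_def by fastforce
  have ZY: "\<exists>K. ranged Q (- K) K (\<lambda>x. Z x * Y x)" by (rule ranged_times[OF Z Y])
  then have intZY: "integrable Q (\<lambda>x. Z x * Y x)" using Q.integrable_ranged by blast
  have intUY: "integrable Q (\<lambda>x. U i x * Y x)" if "i \<in> I" for i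
    using ranged_times[OF Ur[OF that] Y] Q.integrable_ranged by blast
  have "\<exists>K. ranged Q (- K) K (\<lambda>x. u i x * ((U i x)\<^sup>2 / 2 - U i x))" if i: "i \<in> I" for i
  proof -
    obtain K where "ranged Q (- K) K (\<lambda>x. U i x * U i x)"
      using ranged_times[OF Ur[OF i] Ur[OF i]] by blast
    then have "ranged Q (- K / 2 - 2 * n) (K / 2 + 2 * n) (\<lambda>x. (U i x)\<^sup>2 / 2 - U i x)"
      using Ur[OF i] unfolding ranged_def power2_eq_square by fastforce
    then show ?thesis by (rule ranged_times[OF u[OF i]])
  qed
  then obtain K where K: "\<And>i. i \<in> I \<Longrightarrow> ranged Q (- K i) (K i) (\<lambda>x. u i x * ((U i x)\<^sup>2 / 2 - U i x))"
    by metis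
  note intR = Q.integrable_ranged[OF K]
  have rest: "(\<integral>x. u i x * ((U i x)\<^sup>2 / 2 - U i x) \<partial>Q) \<le> s / 2 * (\<integral>x. Y x \<partial>Q)" if i: "i \<in> I" for i
  proof -
    let ?J = "I - {i}"
    let ?R = "PiM ?J (\<lambda>_. P)"
    have J: "finite ?J" "i \<notin> ?J" "insert i ?J = I" using I i by auto
    interpret R: prob_space ?R by (rule prob_space_PiM) (rule P)
    note fub = integral_PiM_insert[OF P J(1,2), unfolded J(3), folded Q_def]
    note out = ranged_integrate_out[OF P J(1,2), unfolded J(3), folded Q_def]
    note sec = ranged_section[OF P J(1,2), unfolded J(3), folded Q_def]
    have "(\<integral>x. u i x * ((U i x)\<^sup>2 / 2 - U i x) \<partial>Q)
        = (\<integral>x. (\<integral>y. u i (x(i := y)) * ((U i (x(i := y)))\<^sup>2 / 2 - U i (x(i := y))) \<partial>P) \<partial>?R)"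
      by (rule fub[OF K[OF i]])
    also have "\<dots> \<le> (\<integral>x. s / 2 * (\<integral>y. Y (x(i := y)) \<partial>P) \<partial>?R)"
    proof (rule integral_mono)
      show "integrable ?R (\<lambda>x. \<integral>y. u i (x(i := y)) * ((U i (x(i := y)))\<^sup>2 / 2 - U i (x(i := y))) \<partial>P)"
        by (rule R.integrable_ranged[OF out[OF K[OF i]]])
      show "integrable ?R (\<lambda>x. s / 2 * (\<integral>y. Y (x(i := y)) \<partial>P))"
        using R.integrable_ranged[OF out[OF Y]] by simp
      fix x assume x: "x \<in> space ?R"
      have xy: "x(i := y) \<in> space Q" if "y \<in> space P" for y
        using space_PiM_upd[OF x that, of i] unfolding Q_def J(3) .
      obtain h where h: "h \<in> G" "Zi i x = (\<Sum>j\<in>?J. h (x j))"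
        using max_sum_attained[OF G] unfolding Zi_def by blast
      have Zi_upd: "Zi i (x(i := y)) = Zi i x" for y
        unfolding Zi_def by (rule max_sum_upd) simp
      have u_upd: "u i (x(i := y)) = u i x" for y by (simp only: u_def Zi_upd)
      have U_ge: "h y \<le> U i (x(i := y))" for y
      proof -
        have "(\<Sum>j\<in>I. h ((x(i := y)) j)) = h y + (\<Sum>j\<in>?J. h (x j))"
          using I i by (simp add: sum.remove)
        then show ?thesis
          using max_sum_ge[OF G(1) h(1), of "x(i := y)" I] h(2) unfolding U_def Zi_upd Z_def by linarith
      qed
      note gh = g[OF h(1)]
      have inth: "integrable P h" by (rule P.integrable_ranged[OF gh])
      have inth2: "integrable P (\<lambda>y. (h y)\<^sup>2)"
        using ranged_times[OF gh gh] P.integrable_ranged unfolding power2_eq_square by blast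
      have ux: "0 < u i x" by (simp add: u_def)
      have "(\<integral>y. u i (x(i := y)) * ((U i (x(i := y)))\<^sup>2 / 2 - U i (x(i := y))) \<partial>P)
          \<le> (\<integral>y. u i x * ((h y)\<^sup>2 / 2 - h y) \<partial>P)"
      proof (rule integral_mono)
        show "integrable P (\<lambda>y. u i (x(i := y)) * ((U i (x(i := y)))\<^sup>2 / 2 - U i (x(i := y))))"
          by (rule P.integrable_ranged[OF sec[OF K[OF i] x]])
        show "integrable P (\<lambda>y. u i x * ((h y)\<^sup>2 / 2 - h y))" using inth inth2 by simp
        fix y assume y: "y \<in> space P"
        have le: "h y \<le> U i (x(i := y))" "U i (x(i := y)) \<le> 1" using U_ge U_le[OF i xy[OF y]] by auto
        have "0 \<le> (U i (x(i := y)) - h y) * (1 - (U i (x(i := y)) + h y) / 2)"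
          using le by (intro mult_nonneg_nonneg) auto
        then have "(U i (x(i := y)))\<^sup>2 / 2 - U i (x(i := y)) \<le> (h y)\<^sup>2 / 2 - h y"
          by (simp add: power2_eq_square algebra_simps add_divide_distrib diff_divide_distrib)
        then show "u i (x(i := y)) * ((U i (x(i := y)))\<^sup>2 / 2 - U i (x(i := y))) \<le> u i x * ((h y)\<^sup>2 / 2 - h y)"
          unfolding u_upd using ux by (intro mult_left_mono) auto
      qed
      also have "\<dots> = u i x * ((\<integral>y. (h y)\<^sup>2 \<partial>P) / 2)" using inth inth2 mean[OF h(1)] by simp
      also have "\<dots> \<le> u i x * (s / 2)" using ux var[OF h(1)] by (intro mult_left_mono) auto
      also have "\<dots> = s / 2 * (\<integral>y. u i x * (1 + l * h y) \<partial>P)"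
        using inth mean[OF h(1)] by (simp add: P.prob_space)
      also have "\<dots> \<le> s / 2 * (\<integral>y. Y (x(i := y)) \<partial>P)"
      proof (rule mult_left_mono)
        have "0 \<le> (\<integral>y. (h y)\<^sup>2 \<partial>P)" by simp
        then show "0 \<le> s / 2" using var[OF h(1)] by linarith
        show "(\<integral>y. u i x * (1 + l * h y) \<partial>P) \<le> (\<integral>y. Y (x(i := y)) \<partial>P)"
        proof (rule integral_mono)
          show "integrable P (\<lambda>y. u i x * (1 + l * h y))" using inth by simp
          show "integrable P (\<lambda>y. Y (x(i := y)))" by (rule P.integrable_ranged[OF sec[OF Y x]])
          fix y
          have "1 + l * h y \<le> 1 + l * U i (x(i := y))" using l U_ge by simp
          also have "\<dots> \<le> exp (l * U i (x(i := y)))" by (rule exp_ge_add_one_self)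
          finally have "u i x * (1 + l * h y) \<le> u i x * exp (l * U i (x(i := y)))"
            using ux by (intro mult_left_mono) auto
          also have "\<dots> = Y (x(i := y))"
            unfolding u_def Y_def U_def Zi_upd exp_add[symmetric] by (simp add: algebra_simps)
          finally show "u i x * (1 + l * h y) \<le> Y (x(i := y))" .
        qed
      qed
      finally show "(\<integral>y. u i (x(i := y)) * ((U i (x(i := y)))\<^sup>2 / 2 - U i (x(i := y))) \<partial>P)
          \<le> s / 2 * (\<integral>y. Y (x(i := y)) \<partial>P)" .
    qed
    also have "\<dots> = s / 2 * (\<integral>x. Y x \<partial>Q)" unfolding fub[OF Y] by simp
    finally show ?thesis .
  qed
  have div: "ent_div (Y x) (u i x) \<le> l\<^sup>2 * (U i x * Y x + u i x * ((U i x)\<^sup>2 / 2 - U i x))"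
    if i: "i \<in> I" and x: "x \<in> space Q" for i x
  proof -
    have Yu: "Y x = u i x * exp (l * U i x)"
      unfolding u_def Y_def U_def exp_add[symmetric] by (simp add: algebra_simps)
    have "ln (Y x) - ln (u i x) = l * U i x" by (simp add: Y_def u_def U_def algebra_simps)
    then have "ent_div (Y x) (u i x) = u i x * (1 + (l * U i x - 1) * exp (l * U i x))"
      unfolding ent_div_def by (simp add: Yu algebra_simps)
    also have "\<dots> \<le> u i x * (l\<^sup>2 * (U i x * exp (l * U i x) + (U i x)\<^sup>2 / 2 - U i x))"
      using l U_le[OF i x] by (intro mult_left_mono one_sided_exp_inequality) (auto simp: u_def)
    also have "\<dots> = l\<^sup>2 * (U i x * Y x + u i x * ((U i x)\<^sup>2 / 2 - U i x))"
      by (simp add: Yu algebra_simps)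
    finally show ?thesis .
  qed
  have "l * (\<integral>x. Z x * Y x \<partial>Q) - (\<integral>x. Y x \<partial>Q) * ln (\<integral>x. Y x \<partial>Q)
      = (\<integral>x. Y x * ln (Y x) \<partial>Q) - (\<integral>x. Y x \<partial>Q) * ln (\<integral>x. Y x \<partial>Q)"
    by (simp add: Y_def mult_ac)
  also have "\<dots> \<le> (\<Sum>i\<in>I. \<integral>x. ent_div (Y x) (u i x) \<partial>Q)"
    unfolding Q_def
  proof (rule entropy_tensorization[OF P I _ Y[unfolded Q_def]])
    show "ranged (PiM I (\<lambda>_. P)) (exp (- (\<bar>l\<bar> * n))) (exp (\<bar>l\<bar> * n)) (u i)" if "i \<in> I" for i
      using u[OF that] unfolding Q_def .
    show "u i (x(i := y)) = u i x" for i x y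
    proof -
      have "Zi i (x(i := y)) = Zi i x" unfolding Zi_def by (rule max_sum_upd) simp
      then show ?thesis by (simp only: u_def)
    qed
  qed simp
  also have "\<dots> \<le> (\<Sum>i\<in>I. l\<^sup>2 * ((\<integral>x. U i x * Y x \<partial>Q) + s / 2 * (\<integral>x. Y x \<partial>Q)))"
  proof (rule sum_mono)
    fix i assume i: "i \<in> I"
    have "\<exists>c d. ranged Q c d (\<lambda>x. ent_div (Y x) (u i x))" by (rule ranged_ent_div[OF Y u[OF i]]) simp
    then have "integrable Q (\<lambda>x. ent_div (Y x) (u i x))" using Q.integrable_ranged by blast
    then have "(\<integral>x. ent_div (Y x) (u i x) \<partial>Q)
        \<le> (\<integral>x. l\<^sup>2 * (U i x * Y x + u i x * ((U i x)\<^sup>2 / 2 - U i x)) \<partial>Q)"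
      using div[OF i] intUY[OF i] intR[OF i] by (intro integral_mono) auto
    also have "\<dots> = l\<^sup>2 * ((\<integral>x. U i x * Y x \<partial>Q) + (\<integral>x. u i x * ((U i x)\<^sup>2 / 2 - U i x) \<partial>Q))"
      using intUY[OF i] intR[OF i] by simp
    also have "\<dots> \<le> l\<^sup>2 * ((\<integral>x. U i x * Y x \<partial>Q) + s / 2 * (\<integral>x. Y x \<partial>Q))"
      using rest[OF i] by (intro mult_left_mono add_left_mono) auto
    finally show "(\<integral>x. ent_div (Y x) (u i x) \<partial>Q) \<le> \<dots>" .
  qed
  also have "\<dots> = l\<^sup>2 * ((\<integral>x. (\<Sum>i\<in>I. U i x) * Y x \<partial>Q) + card I * s / 2 * (\<integral>x. Y x \<partial>Q))"
    using intUY by (simp add: sum_distrib_right sum_distrib_left[symmetric] sum.distrib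
        Bochner_Integration.integral_sum)
  also have "\<dots> \<le> l\<^sup>2 * ((\<integral>x. Z x * Y x \<partial>Q) + card I * s / 2 * (\<integral>x. Y x \<partial>Q))"
  proof (intro mult_left_mono add_right_mono integral_mono)
    show "integrable Q (\<lambda>x. (\<Sum>i\<in>I. U i x) * Y x)"
      unfolding sum_distrib_right by (intro Bochner_Integration.integrable_sum intUY)
    show "(\<Sum>i\<in>I. U i x) * Y x \<le> Z x * Y x" for x
      using sumU by (intro mult_right_mono) (auto simp: Y_def)
  qed (use intZY in auto)
  finally show ?thesis by (simp add: Y_def)
qed

lemma max_sum_tail:
  fixes P :: "'a measure" and I :: "'i set" and s :: real
  assumes P: "prob_space P" and I: "finite I" and G: "finite G" "G \<noteq> {}"
    and g: "\<And>g. g \<in> G \<Longrightarrow> ranged P (- 1) 1 g"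
    and mean: "\<And>g. g \<in> G \<Longrightarrow> (\<integral>y. g y \<partial>P) = 0"
    and var: "\<And>g. g \<in> G \<Longrightarrow> (\<integral>y. (g y)\<^sup>2 \<partial>P) \<le> s"
    and E0: "(\<integral>x. max_sum G I x \<partial>PiM I (\<lambda>_. P)) \<le> E0" "0 < E0" and s: "0 \<le> s" and t: "0 < t"
  shows "measure (PiM I (\<lambda>_. P)) {x\<in>space (PiM I (\<lambda>_. P)).
      E0 + 2 * sqrt ((card I * s / 2 + E0) * t) + t < max_sum G I x} \<le> exp (- t)"
proof -
  interpret Q: prob_space "PiM I (\<lambda>_. P)" by (rule prob_space_PiM) (rule P)
  have Z: "ranged (PiM I (\<lambda>_. P)) (- real (card I)) (card I) (max_sum G I)"
    by (rule ranged_max_sum[OF G g I]) auto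
  show ?thesis
  proof (rule Q.tail_from_mgf[OF Z _ E0 _ t])
    show "0 \<le> real (card I) * s" using s by simp
    fix l :: real assume l: "0 < l" "l < 1"
    show "ln (\<integral>x. exp (l * max_sum G I x) \<partial>PiM I (\<lambda>_. P))
        \<le> (l * (\<integral>x. max_sum G I x \<partial>PiM I (\<lambda>_. P)) + l\<^sup>2 * (card I * s) / 2) / (1 - l)"
      by (rule Q.herbst_argument[OF Z max_sum_entropy[OF P I G g mean var] l])
  qed
qed

section \<open>Symmetrization\<close>

text \<open>The weights \<open>w\<close> are all 1 in the empirical process and signs in its Rademacher version.
  The functions are indexed by \<open>F\<close> through \<open>h\<close>, so that the process of squares
  is indexed by the class itself.\<close>
definition max_abs_sum :: "'f set \<Rightarrow> ('f \<Rightarrow> 'a \<Rightarrow> real) \<Rightarrow> ('i \<Rightarrow> real) \<Rightarrow> 'i set \<Rightarrow> ('i \<Rightarrow> 'a) \<Rightarrow> real" where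
  "max_abs_sum F h w J x = Max ((\<lambda>f. \<bar>\<Sum>i\<in>J. w i * h f (x i)\<bar>) ` F)"

lemma max_abs_sum_ge:
  "finite F \<Longrightarrow> f \<in> F \<Longrightarrow> \<bar>\<Sum>i\<in>J. w i * h f (x i)\<bar> \<le> max_abs_sum F h w J x"
  by (simp add: max_abs_sum_def)

lemma max_abs_sum_attained:
  assumes "finite F" "F \<noteq> {}"
  obtains f where "f \<in> F" "max_abs_sum F h w J x = \<bar>\<Sum>i\<in>J. w i * h f (x i)\<bar>"
proof -
  have "max_abs_sum F h w J x \<in> (\<lambda>f. \<bar>\<Sum>i\<in>J. w i * h f (x i)\<bar>) ` F"
    unfolding max_abs_sum_def using assms by (intro Max_in) auto
  then show ?thesis using that by auto
qed

lemma ranged_max_abs_sum: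
  assumes F: "finite F" "F \<noteq> {}" and h: "\<And>f. f \<in> F \<Longrightarrow> ranged P (- c) c (h f)"
    and w: "\<And>i. \<bar>w i\<bar> \<le> 1" and J: "finite J" "J \<subseteq> K"
  shows "ranged (PiM K (\<lambda>_. P)) (- (real (card J) * c)) (real (card J) * c) (max_abs_sum F h w J)"
  unfolding max_abs_sum_def
proof (rule ranged_Max[OF F], rule ranged_absI)
  fix f assume f: "f \<in> F"
  show "(\<lambda>x. \<bar>\<Sum>i\<in>J. w i * h f (x i)\<bar>) \<in> borel_measurable (PiM K (\<lambda>_. P))"
  proof (intro borel_measurable_abs borel_measurable_sum borel_measurable_times borel_measurable_const)
    fix j assume "j \<in> J"
    then have "(\<lambda>x. x j) \<in> measurable (PiM K (\<lambda>_. P)) P"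
      using J by (intro measurable_component_singleton) auto
    then show "(\<lambda>x. h f (x j)) \<in> borel_measurable (PiM K (\<lambda>_. P))"
      using measurable_compose ranged_measurable[OF h[OF f]] by blast
  qed
  fix x assume x: "x \<in> space (PiM K (\<lambda>_. P))"
  have "\<bar>w j * h f (x j)\<bar> \<le> 1 * c" if "j \<in> J" for j
  proof -
    have "x j \<in> space P" using x that J by (auto simp: space_PiM)
    then have "\<bar>h f (x j)\<bar> \<le> c" using ranged_bounds[OF h[OF f]] by (simp add: abs_le_iff minus_le_iff)
    then show ?thesis unfolding abs_mult using w[of j] by (intro mult_mono) auto
  qed
  then have "(\<Sum>j\<in>J. \<bar>w j * h f (x j)\<bar>) \<le> real (card J) * c"
    using sum_bounded_above[of J "\<lambda>j. \<bar>w j * h f (x j)\<bar>" c] by simp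
  then show "\<bar>\<bar>\<Sum>i\<in>J. w i * h f (x i)\<bar>\<bar> \<le> real (card J) * c"
    unfolding abs_idempotent by (rule order_trans[OF sum_abs])
qed

context
  fixes P :: "'a measure" and I :: "'i set" and F :: "'f set" and h :: "'f \<Rightarrow> 'a \<Rightarrow> real" and c :: real
  assumes P: "prob_space P" and I: "finite I" and F: "finite F" "F \<noteq> {}"
    and h: "\<And>f. f \<in> F \<Longrightarrow> ranged P (- c) c (h f)"
    and mean: "\<And>f. f \<in> F \<Longrightarrow> (\<integral>y. h f y \<partial>P) = 0"
begin

text \<open>The maximum is convex and the dropped term has mean zero, so this is Jensen's inequality in
  coordinate \<open>j\<close>.\<close>
lemma expectation_drop_term:
  assumes w: "\<And>i. \<bar>w i\<bar> \<le> 1" and J: "J \<subseteq> I" and j: "j \<in> J"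
  shows "(\<integral>x. max_abs_sum F h w (J - {j}) x \<partial>PiM I (\<lambda>_. P)) \<le> (\<integral>x. max_abs_sum F h w J x \<partial>PiM I (\<lambda>_. P))"
proof -
  interpret P: prob_space P by (rule P)
  let ?K = "I - {j}" and ?Q = "PiM I (\<lambda>_. P)"
  let ?R = "PiM ?K (\<lambda>_. P)"
  have K: "finite ?K" "j \<notin> ?K" "insert j ?K = I" using I J j by auto
  have finJ: "finite J" using I J finite_subset by blast
  interpret R: prob_space ?R by (rule prob_space_PiM) (rule P)
  note fub = integral_PiM_insert[OF P K(1,2), unfolded K(3)]
  note out = ranged_integrate_out[OF P K(1,2), unfolded K(3)]
  note sec = ranged_section[OF P K(1,2), unfolded K(3)]
  have r1: "ranged ?Q (- (real (card J) * c)) (real (card J) * c) (max_abs_sum F h w J)"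
    by (rule ranged_max_abs_sum[OF F h w finJ J])
  have r2: "ranged ?Q (- (real (card (J - {j})) * c)) (real (card (J - {j})) * c) (max_abs_sum F h w (J - {j}))"
    using finJ J by (intro ranged_max_abs_sum[OF F h w]) auto
  have "(\<integral>x. (\<integral>y. max_abs_sum F h w (J - {j}) (x(j := y)) \<partial>P) \<partial>?R)
      \<le> (\<integral>x. (\<integral>y. max_abs_sum F h w J (x(j := y)) \<partial>P) \<partial>?R)"
  proof (rule integral_mono[OF R.integrable_ranged[OF out[OF r2]] R.integrable_ranged[OF out[OF r1]]])
    fix x assume x: "x \<in> space ?R"
    obtain f where f: "f \<in> F"
      "max_abs_sum F h w (J - {j}) x = \<bar>\<Sum>i\<in>J - {j}. w i * h f (x i)\<bar>"
      using max_abs_sum_attained[OF F] by blast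
    have int: "integrable P (h f)" by (rule P.integrable_ranged[OF h[OF f(1)]])
    have "(\<integral>y. max_abs_sum F h w (J - {j}) (x(j := y)) \<partial>P) = (\<integral>y. max_abs_sum F h w (J - {j}) x \<partial>P)"
      by (intro Bochner_Integration.integral_cong refl)
         (auto simp: max_abs_sum_def intro!: arg_cong[where f = Max] image_cong arg_cong[where f = abs] sum.cong)
    also have "\<dots> = \<bar>\<integral>y. (\<Sum>i\<in>J - {j}. w i * h f (x i)) + w j * h f y \<partial>P\<bar>"
      using int mean[OF f(1)] by (simp add: f(2) P.prob_space)
    also have "\<dots> \<le> (\<integral>y. \<bar>(\<Sum>i\<in>J - {j}. w i * h f (x i)) + w j * h f y\<bar> \<partial>P)"
      by (rule integral_abs_bound)
    also have "\<dots> \<le> (\<integral>y. max_abs_sum F h w J (x(j := y)) \<partial>P)"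
    proof (rule integral_mono)
      show "integrable P (\<lambda>y. \<bar>(\<Sum>i\<in>J - {j}. w i * h f (x i)) + w j * h f y\<bar>)" using int by simp
      show "integrable P (\<lambda>y. max_abs_sum F h w J (x(j := y)))"
        by (rule P.integrable_ranged[OF sec[OF r1 x]])
      fix y
      have "(\<Sum>i\<in>J. w i * h f ((x(j := y)) i)) = (\<Sum>i\<in>J - {j}. w i * h f (x i)) + w j * h f y"
        using finJ j by (simp add: sum.remove[of J j])
      then show "\<bar>(\<Sum>i\<in>J - {j}. w i * h f (x i)) + w j * h f y\<bar> \<le> max_abs_sum F h w J (x(j := y))"
        using max_abs_sum_ge[OF F(1) f(1), of w h "x(j := y)" J] by simp
    qed
    finally show "(\<integral>y. max_abs_sum F h w (J - {j}) (x(j := y)) \<partial>P) \<le> \<dots>" .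
  qed
  then show ?thesis unfolding fub[OF r1] fub[OF r2] .
qed

lemma expectation_subset_le:
  assumes w: "\<And>i. \<bar>w i\<bar> \<le> 1" and D: "D \<subseteq> I"
  shows "(\<integral>x. max_abs_sum F h w (I - D) x \<partial>PiM I (\<lambda>_. P)) \<le> (\<integral>x. max_abs_sum F h w I x \<partial>PiM I (\<lambda>_. P))"
  using finite_subset[OF D I] D
proof (induction D rule: finite_induct)
  case (insert j D)
  have "I - insert j D = (I - D) - {j}" by auto
  then have "(\<integral>x. max_abs_sum F h w (I - insert j D) x \<partial>PiM I (\<lambda>_. P))
      \<le> (\<integral>x. max_abs_sum F h w (I - D) x \<partial>PiM I (\<lambda>_. P))"
    using insert expectation_drop_term[OF w, of "I - D" j] by auto
  then show ?case using insert by auto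
qed simp

text \<open>Centering makes a ghost sample superfluous and gives the bound for every single sign pattern: the sum
  over \<open>I\<close> splits into those over \<open>S\<close> and \<open>I - S\<close>. On each part the signs are constant and do not affect
  the absolute value, and in mean each part is at most the full signed sum, since the missing terms are
  centered.\<close>
lemma symmetrization:
  assumes S: "S \<subseteq> I"
  shows "(\<integral>x. max_abs_sum F h (\<lambda>_. 1) I x \<partial>PiM I (\<lambda>_. P)) \<le> 2 * (\<integral>x. max_abs_sum F h (rsign S) I x \<partial>PiM I (\<lambda>_. P))"
proof -
  let ?Q = "PiM I (\<lambda>_. P)"
  interpret Q: prob_space ?Q by (rule prob_space_PiM) (rule P)
  have sgn: "\<bar>rsign S i\<bar> \<le> 1" for i by (simp add: rsign_def)
  have int: "integrable ?Q (max_abs_sum F h w J)" if "\<And>i. \<bar>w i\<bar> \<le> 1" "J \<subseteq> I" for w J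
    by (rule Q.integrable_ranged[OF ranged_max_abs_sum[OF F h that(1) finite_subset[OF that(2) I] that(2)]])
  have split: "max_abs_sum F h (\<lambda>_. 1) I x \<le> max_abs_sum F h (rsign S) (I - (I - S)) x + max_abs_sum F h (rsign S) (I - S) x" for x
  proof -
    obtain f where f: "f \<in> F" "max_abs_sum F h (\<lambda>_. 1) I x = \<bar>\<Sum>i\<in>I. 1 * h f (x i)\<bar>"
      using max_abs_sum_attained[OF F] by blast
    have IS: "I - (I - S) = S" using S by auto
    have "(\<Sum>i\<in>I. h f (x i)) = (\<Sum>i\<in>S. h f (x i)) + (\<Sum>i\<in>I - S. h f (x i))"
      using sum.subset_diff[OF S I, of "\<lambda>i. h f (x i)"] by simp
    moreover have "(\<Sum>i\<in>S. rsign S i * h f (x i)) = (\<Sum>i\<in>S. h f (x i))"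
      by (simp add: rsign_def)
    moreover have "(\<Sum>i\<in>I - S. rsign S i * h f (x i)) = - (\<Sum>i\<in>I - S. h f (x i))"
      by (simp add: rsign_def sum_negf)
    ultimately show ?thesis
      using max_abs_sum_ge[OF F(1) f(1), of "rsign S" h x S]
        max_abs_sum_ge[OF F(1) f(1), of "rsign S" h x "I - S"] f(2) IS by simp
  qed
  have "(\<integral>x. max_abs_sum F h (\<lambda>_. 1) I x \<partial>?Q)
      \<le> (\<integral>x. max_abs_sum F h (rsign S) (I - (I - S)) x + max_abs_sum F h (rsign S) (I - S) x \<partial>?Q)"
    by (intro integral_mono split Bochner_Integration.integrable_add int sgn) auto
  also have "\<dots> = (\<integral>x. max_abs_sum F h (rsign S) (I - (I - S)) x \<partial>?Q) + (\<integral>x. max_abs_sum F h (rsign S) (I - S) x \<partial>?Q)"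
    by (intro Bochner_Integration.integral_add int sgn) auto
  also have "\<dots> \<le> (\<integral>x. max_abs_sum F h (rsign S) I x \<partial>?Q) + (\<integral>x. max_abs_sum F h (rsign S) I x \<partial>?Q)"
    using S by (intro add_mono expectation_subset_le sgn) auto
  finally show ?thesis by simp
qed

lemma symmetrization_rad_avg:
  "(\<integral>x. max_abs_sum F h (\<lambda>_. 1) I x \<partial>PiM I (\<lambda>_. P))
    \<le> 2 * (\<integral>x. rad_avg I (\<lambda>S. max_abs_sum F h (rsign S) I x) \<partial>PiM I (\<lambda>_. P))"
proof -
  let ?Q = "PiM I (\<lambda>_. P)"
  interpret Q: prob_space ?Q by (rule prob_space_PiM) (rule P)
  have int: "integrable ?Q (max_abs_sum F h (rsign S) I)" for S
    by (rule Q.integrable_ranged[OF ranged_max_abs_sum[OF F h _ I]]) (auto simp: rsign_def)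
  have "rad_avg I (\<lambda>S. \<integral>x. max_abs_sum F h (\<lambda>_. 1) I x \<partial>?Q)
      \<le> rad_avg I (\<lambda>S. 2 * (\<integral>x. max_abs_sum F h (rsign S) I x \<partial>?Q))"
    by (intro rad_avg_mono symmetrization)
  also have "\<dots> = 2 * (\<integral>x. rad_avg I (\<lambda>S. max_abs_sum F h (rsign S) I x) \<partial>?Q)"
    unfolding rad_avg_cmult using int by (simp add: rad_avg_def)
  finally show ?thesis by (simp add: rad_avg_const[OF I])
qed

end

lemma quadratic_bound:
  fixes q s k :: real
  assumes "q\<^sup>2 \<le> s\<^sup>2 + k * q" "0 \<le> s" "0 \<le> k"
  shows "q \<le> s + k"
proof (rule ccontr)
  assume "\<not> ?thesis"
  then have "s + k < q" by simp
  then have "s * s \<le> (q - k) * s" using assms by (intro mult_right_mono) auto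
  also have "\<dots> < (q - k) * q" using \<open>s + k < q\<close> assms by (intro mult_strict_left_mono) auto
  finally show False using assms(1) by (simp add: power2_eq_square algebra_simps)
qed

text \<open>Jensen's inequality, through the tangent of the square root at the mean.\<close>
lemma (in prob_space) expectation_sqrt_le:
  assumes R: "ranged M a b R" and a: "0 < a"
  shows "expectation (\<lambda>x. sqrt (R x)) \<le> sqrt (expectation R)"
proof -
  let ?c = "sqrt (expectation R)"
  have "0 < expectation R" using expectation_ranged[OF R] a by simp
  then have c: "0 < ?c" "?c * ?c = expectation R" by auto
  have int: "integrable M R" by (rule integrable_ranged[OF R])
  have "ranged M 0 (sqrt b) (\<lambda>x. sqrt (R x))"
  proof (rule rangedI)
    show "(\<lambda>x. sqrt (R x)) \<in> borel_measurable M" using ranged_measurable[OF R] by measurable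
    show "0 \<le> sqrt (R x) \<and> sqrt (R x) \<le> sqrt b" if "x \<in> space M" for x
      using ranged_bounds[OF R that] a by auto
  qed
  then have "integrable M (\<lambda>x. sqrt (R x))" by (rule integrable_ranged)
  then have "expectation (\<lambda>x. sqrt (R x)) \<le> expectation (\<lambda>x. (R x / ?c + ?c) / 2)"
  proof (rule integral_mono)
    show "integrable M (\<lambda>x. (R x / ?c + ?c) / 2)" using int by simp
    fix x assume "x \<in> space M"
    then have "0 \<le> R x" using ranged_bounds[OF R] a by fastforce
    have "0 \<le> (sqrt (R x) - ?c)\<^sup>2 / ?c" using c by simp
    also have "\<dots> = R x / ?c + ?c - 2 * sqrt (R x)"
      using c(1) \<open>0 \<le> R x\<close> by (simp add: power2_eq_square field_simps)
    finally show "sqrt (R x) \<le> (R x / ?c + ?c) / 2" by simp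
  qed
  also have "\<dots> = (expectation R / ?c + ?c) / 2" using int by (simp add: prob_space)
  also have "expectation R / ?c = ?c" using c by (simp add: real_div_sqrt)
  finally show ?thesis by simp
qed

section \<open>The expected supremum over a VC subgraph class\<close>

text \<open>The rough estimate \<open>2 \<le> exp 1 \<le> 3\<close> suffices.\<close>
lemma ln_55_bounds: "3 \<le> ln (55::real)" "ln (55::real) \<le> 6"
proof -
  have "exp (3::real) = exp 1 ^ 3" using exp_of_nat_mult[of 3 "1::real"] by simp
  also have "\<dots> \<le> 3 ^ 3" using exp_le by (intro power_mono) auto
  finally have "exp (3::real) \<le> 55" by simp
  then show "3 \<le> ln (55::real)" by (subst ln_ge_iff) auto
  have "(55::real) \<le> 2 ^ 6" by simp
  also have "\<dots> \<le> exp 1 ^ 6" using exp_ge_add_one_self[of "1::real"] by (intro power_mono) auto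
  also have "exp 1 ^ 6 = exp (6::real)" using exp_of_nat_mult[of 6 "1::real"] by simp
  finally show "ln (55::real) \<le> 6" using ln_mono[of 55 "exp (6::real)"] by simp
qed

text \<open>\<open>R\<close> is the squared empirical radius, kept above \<open>n * \<tau>\<^sup>2\<close>: this way the chain starts at a
  scale of at least \<open>\<tau>\<close> relative to the sample size, and the logarithm of the packing numbers is
  controlled by the deterministic \<open>L\<close>. Chaining and symmetrization give
  \<open>2 * K * sqrt D\<close> as a bound of the mean, where \<open>D\<close> is the mean of \<open>R\<close>. Applied to the centered squares, with
  Lipschitz constant 2, they give \<open>D \<le> 3 * n * \<tau>\<^sup>2 + 4 * K * sqrt D\<close>. It remains to solve for
  \<open>sqrt D\<close>.\<close>
lemma expected_sup_VC_bound:
  fixes P :: "'a measure" and I :: "'i set" and F :: "('a \<Rightarrow> real) set" and \<tau> :: real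
  assumes P: "prob_space P" and I: "finite I" "I \<noteq> {}" and F: "finite F" "F \<noteq> {}"
    and f: "\<And>f. f \<in> F \<Longrightarrow> ranged P (- 1) 1 f"
    and mean: "\<And>f. f \<in> F \<Longrightarrow> (\<integral>y. f y \<partial>P) = 0"
    and var: "\<And>f. f \<in> F \<Longrightarrow> (\<integral>y. (f y)\<^sup>2 \<partial>P) \<le> \<tau>\<^sup>2"
    and \<tau>: "0 < \<tau>" "\<tau> \<le> 1"
    and vc: "\<And>A. A \<subseteq> space P \<times> UNIV \<Longrightarrow> shatters (subgraph (space P) ` F) A \<Longrightarrow> card A \<le> d"
    and d: "1 \<le> d"
  shows "(\<integral>x. max_abs_sum F (\<lambda>f. f) (\<lambda>_. 1) I x \<partial>PiM I (\<lambda>_. P))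
      \<le> 40 * sqrt (real d * (real (card I) * \<tau>\<^sup>2 * ln (55 / \<tau>))) + 1024 * real d * ln (55 / \<tau>)"
proof -
  let ?Q = "PiM I (\<lambda>_. P)"
  interpret P: prob_space P by (rule P)
  interpret Q: prob_space ?Q by (rule prob_space_PiM) (rule P)
  define n where "n = real (card I)"
  have n: "1 \<le> n" using I by (simp add: n_def Suc_leI card_gt_0_iff)
  define L where "L = ln (55 / \<tau>)"
  have L: "L = ln 55 + ln (1 / \<tau>)" "0 \<le> ln (1 / \<tau>)" using \<tau> by (auto simp: L_def ln_div)
  have L3: "3 \<le> L" using L ln_55_bounds by simp
  define H where "H = 4 * real d * L"
  have H: "0 \<le> H" using L3 by (simp add: H_def)
  define K where "K = 4 * sqrt (2 * H)"
  have K: "0 \<le> K" "K\<^sup>2 = 128 * real d * L" using H by (auto simp: K_def H_def power_mult_distrib)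
  define R where "R x = max (n * \<tau>\<^sup>2) (Max ((\<lambda>f. \<Sum>i\<in>I. (f (x i))\<^sup>2) ` F))" for x
  have sq: "ranged P 0 1 (\<lambda>y. (f y)\<^sup>2)" if "f \<in> F" for f
  proof (rule rangedI)
    show "(\<lambda>y. (f y)\<^sup>2) \<in> borel_measurable P" using ranged_measurable[OF f[OF that]] by measurable
    fix y assume "y \<in> space P"
    then have "\<bar>f y\<bar> \<le> 1" using ranged_bounds[OF f[OF that]] by (simp add: abs_le_iff minus_le_iff)
    then show "0 \<le> (f y)\<^sup>2 \<and> (f y)\<^sup>2 \<le> 1" by (simp add: abs_square_le_1)
  qed
  have nt: "0 < n * \<tau>\<^sup>2" "n * \<tau>\<^sup>2 \<le> n" using n \<tau> by (auto simp: power_le_one mult_left_le)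
  have R: "ranged ?Q (n * \<tau>\<^sup>2) n R"
  proof -
    have "ranged ?Q (n * 0) (n * 1) (\<lambda>x. Max ((\<lambda>f. \<Sum>i\<in>I. (f (x i))\<^sup>2) ` F))"
      unfolding n_def using I by (intro ranged_Max[OF F] ranged_sum_PiM[OF sq]) auto
    then show ?thesis using nt unfolding ranged_def R_def by auto
  qed
  have R_ge: "(\<Sum>i\<in>I. (f (x i))\<^sup>2) \<le> R x" if "f \<in> F" for f x
    unfolding R_def using F that by (intro max.coboundedI2 Max_ge) auto
  have packing: "ln (2 * card N) \<le> H * (1 + real j)"
    if x: "x \<in> space ?Q" and N: "N \<subseteq> F" "N \<noteq> {}"
      and sep: "\<And>f g. f \<in> N \<Longrightarrow> g \<in> N \<Longrightarrow> f \<noteq> g \<Longrightarrow>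
        (sqrt (R x) / 2 ^ j)\<^sup>2 < (\<Sum>i\<in>I. (f (x i) - g (x i))\<^sup>2)"
    for x N and j :: nat
  proof -
    define e where "e = \<tau> / 2 ^ j"
    have "\<tau> \<le> 1 * 2 ^ j" using \<tau> one_le_power[of "2::real" j] by linarith
    then have e: "0 < e" "e \<le> 1" using \<tau> by (auto simp: e_def field_simps)
    have Rx: "n * \<tau>\<^sup>2 \<le> R x" by (simp add: R_def)
    have finN: "finite N" using N F finite_subset by blast
    have cN: "1 \<le> real (card N)" using finN N by (simp add: Suc_leI card_gt_0_iff)
    have "ln (card N) \<le> d * (1 + 4 * ln 2 + 2 * ln (4 / e\<^sup>2))"
    proof (rule VC_packing_bound[OF I(1) _ finN N(2) _ _ d e])
      show "x i \<in> space P" if "i \<in> I" for i using x that by (auto simp: space_PiM)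
      show "\<bar>f y\<bar> \<le> 1" if "f \<in> N" "y \<in> space P" for f y
        using ranged_bounds[OF f that(2)] that N by (auto simp: abs_le_iff minus_le_iff)
      show "card A \<le> d" if A: "A \<subseteq> space P \<times> UNIV" "shatters (subgraph (space P) ` N) A" for A
      proof (rule vc[OF A(1)])
        show "shatters (subgraph (space P) ` F) A"
          using A(2) N(1) unfolding shatters_def by (meson image_mono subsetD)
      qed
      fix f g assume fg: "f \<in> N" "g \<in> N" "f \<noteq> g"
      have "card I * e\<^sup>2 = n * \<tau>\<^sup>2 / (2 ^ j)\<^sup>2" by (simp add: n_def e_def power_divide)
      also have "\<dots> \<le> R x / (2 ^ j)\<^sup>2" using Rx by (intro divide_right_mono) auto
      also have "\<dots> = (sqrt (R x) / 2 ^ j)\<^sup>2" using Rx nt by (simp add: power_divide)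
      finally show "card I * e\<^sup>2 < (\<Sum>i\<in>I. (f (x i) - g (x i))\<^sup>2)" using sep[OF fg] by simp
    qed
    also have "ln (4 / e\<^sup>2) = 2 * ln 2 + 2 * (real j * ln 2) + 2 * ln (1 / \<tau>)"
    proof -
      have "4 / e\<^sup>2 = (2 * 2 ^ j * (1 / \<tau>)) ^ 2" using \<tau> by (simp add: e_def field_simps power_mult_distrib)
      then have "ln (4 / e\<^sup>2) = 2 * ln (2 * 2 ^ j * (1 / \<tau>))" using \<tau> by (simp add: ln_realpow)
      also have "ln (2 * 2 ^ j * (1 / \<tau>)) = ln (2 * 2 ^ j) + ln (1 / \<tau>)"
        using \<tau> by (intro ln_mult_pos) auto
      also have "ln (2 * 2 ^ j :: real) = ln 2 + real j * ln 2"
        by (simp add: ln_mult_pos ln_realpow)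
      finally show ?thesis by simp
    qed
    finally have "ln (card N) \<le> d * (1 + 8 * ln 2 + 4 * (real j * ln 2) + 4 * ln (1 / \<tau>))"
      by (simp add: algebra_simps)
    moreover have "ln (real (2 * card N)) = ln 2 + ln (card N)" using cN by (simp add: ln_mult_pos)
    moreover have "ln (2::real) \<le> d * ln 2" using d by simp
    moreover have "d * (1 + 9 * ln 2 + 4 * (real j * ln 2) + 4 * ln (1 / \<tau>))
        = d * (1 + 8 * ln 2 + 4 * (real j * ln 2) + 4 * ln (1 / \<tau>)) + d * ln 2"
      by (simp add: algebra_simps)
    ultimately have "ln (real (2 * card N)) \<le> d * (1 + 9 * ln 2 + 4 * (real j * ln 2) + 4 * ln (1 / \<tau>))"
      by linarith
    also have "\<dots> \<le> d * (4 * L * (1 + real j))"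
    proof (rule mult_left_mono)
      have ln2: "ln (2::real) \<le> 1" using ln_le_minus_one[of "2::real"] by simp
      then have "real j * ln 2 \<le> real j * L" using L3 by (intro mult_left_mono) auto
      then show "1 + 9 * ln 2 + 4 * (real j * ln 2) + 4 * ln (1 / \<tau>) \<le> 4 * L * (1 + real j)"
        using ln2 L ln_55_bounds(1) by (simp add: algebra_simps)
    qed simp
    finally show ?thesis by (simp add: H_def algebra_simps)
  qed
  have chain: "rad_avg I (\<lambda>S. max_abs_sum F \<phi> (rsign S) I x) \<le> K * (c * sqrt (R x))"
    if x: "x \<in> space ?Q" and c: "0 < c"
      and lip: "\<And>f g y. f \<in> F \<Longrightarrow> g \<in> F \<Longrightarrow> y \<in> space P \<Longrightarrow> \<bar>\<phi> f y - \<phi> g y\<bar> \<le> c * \<bar>f y - g y\<bar>"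
      and zero: "\<And>f y. f \<in> F \<Longrightarrow> y \<in> space P \<Longrightarrow> \<bar>\<phi> f y\<bar> \<le> c * \<bar>f y\<bar>"
    for x \<phi> c
  proof -
    have Rx: "0 < R x" using nt by (simp add: R_def less_max_iff_disj)
    have xi: "x i \<in> space P" if "i \<in> I" for i using x that by (auto simp: space_PiM)
    have sqle: "u\<^sup>2 \<le> c\<^sup>2 * v\<^sup>2" if "\<bar>u\<bar> \<le> c * \<bar>v\<bar>" for u v :: real
      using power_mono[OF that, of 2] by (simp add: power_mult_distrib)
    show ?thesis
      unfolding K_def max_abs_sum_def
    proof (rule chaining_bound[where b = "\<lambda>f i. f (x i)", OF I(1) F _ c H])
      show "0 < sqrt (R x)" using Rx by simp
      fix f g assume fg: "f \<in> F" "g \<in> F"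
      show "(\<Sum>i\<in>I. (\<phi> f (x i) - \<phi> g (x i))\<^sup>2) \<le> c\<^sup>2 * (\<Sum>i\<in>I. (f (x i) - g (x i))\<^sup>2)"
        unfolding sum_distrib_left by (intro sum_mono sqle lip fg xi)
    next
      fix f assume f: "f \<in> F"
      have "(\<Sum>i\<in>I. (\<phi> f (x i))\<^sup>2) \<le> c\<^sup>2 * (\<Sum>i\<in>I. (f (x i))\<^sup>2)"
        unfolding sum_distrib_left by (intro sum_mono sqle zero f xi)
      also have "\<dots> \<le> c\<^sup>2 * R x" using R_ge[OF f] by (intro mult_left_mono) auto
      finally show "(\<Sum>i\<in>I. (\<phi> f (x i))\<^sup>2) \<le> (c * sqrt (R x))\<^sup>2"
        using Rx by (simp add: power_mult_distrib)
    qed (rule packing[OF x])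
  qed
  have rsign: "\<bar>rsign S i\<bar> \<le> 1" for S :: "'i set" and i by (simp add: rsign_def)
  have int_rad: "integrable ?Q (\<lambda>x. rad_avg I (\<lambda>S. max_abs_sum F \<phi> (rsign S) I x))"
    if "\<And>f. f \<in> F \<Longrightarrow> ranged P (- c) c (\<phi> f)" for \<phi> c
    unfolding rad_avg_def
    using Q.integrable_ranged[OF ranged_max_abs_sum[OF F that rsign I(1)]] by simp
  have r_sqrt: "ranged ?Q 0 (sqrt n) (\<lambda>x. sqrt (R x))"
  proof (rule rangedI)
    show "(\<lambda>x. sqrt (R x)) \<in> borel_measurable ?Q" using ranged_measurable[OF R] by measurable
    show "0 \<le> sqrt (R x) \<and> sqrt (R x) \<le> sqrt n" if "x \<in> space ?Q" for x
      using ranged_bounds[OF R that] nt by auto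
  qed
  note int_sqrt = Q.integrable_ranged[OF r_sqrt]
  define D where "D = (\<integral>x. R x \<partial>?Q)"
  have D: "0 < D" using Q.expectation_ranged[OF R] nt unfolding D_def by linarith
  have Esqrt: "(\<integral>x. sqrt (R x) \<partial>?Q) \<le> sqrt D"
    unfolding D_def by (rule Q.expectation_sqrt_le[OF R nt(1)])
  have rad_le: "(\<integral>x. rad_avg I (\<lambda>S. max_abs_sum F \<phi> (rsign S) I x) \<partial>?Q) \<le> K * (c * sqrt D)"
    if c: "0 < c" and \<phi>: "\<And>f. f \<in> F \<Longrightarrow> ranged P (- 1) 1 (\<phi> f)"
      and lip: "\<And>f g y. f \<in> F \<Longrightarrow> g \<in> F \<Longrightarrow> y \<in> space P \<Longrightarrow> \<bar>\<phi> f y - \<phi> g y\<bar> \<le> c * \<bar>f y - g y\<bar>"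
      and zero: "\<And>f y. f \<in> F \<Longrightarrow> y \<in> space P \<Longrightarrow> \<bar>\<phi> f y\<bar> \<le> c * \<bar>f y\<bar>" for \<phi> c
  proof -
    have "(\<integral>x. rad_avg I (\<lambda>S. max_abs_sum F \<phi> (rsign S) I x) \<partial>?Q) \<le> (\<integral>x. K * (c * sqrt (R x)) \<partial>?Q)"
      using int_sqrt by (intro integral_mono int_rad[OF \<phi>] chain c lip zero) auto
    also have "\<dots> = K * (c * (\<integral>x. sqrt (R x) \<partial>?Q))" by simp
    also have "\<dots> \<le> K * (c * sqrt D)" using K(1) c Esqrt by (intro mult_left_mono) auto
    finally show ?thesis .
  qed
  have abs1: "\<bar>f y\<bar> \<le> 1" if "f \<in> F" "y \<in> space P" for f y
    using ranged_bounds[OF f[OF that(1)] that(2)] by (simp add: abs_le_iff minus_le_iff)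
  have EZ: "(\<integral>x. max_abs_sum F (\<lambda>f. f) (\<lambda>_. 1) I x \<partial>?Q) \<le> 2 * (K * (1 * sqrt D))"
  proof -
    have "(\<integral>x. rad_avg I (\<lambda>S. max_abs_sum F (\<lambda>f. f) (rsign S) I x) \<partial>?Q) \<le> K * (1 * sqrt D)"
      by (rule rad_le[OF _ f]) auto
    moreover have "(\<integral>x. max_abs_sum F (\<lambda>f. f) (\<lambda>_. 1) I x \<partial>?Q)
        \<le> 2 * (\<integral>x. rad_avg I (\<lambda>S. max_abs_sum F (\<lambda>f. f) (rsign S) I x) \<partial>?Q)"
      by (rule symmetrization_rad_avg[OF P I(1) F f mean])
    ultimately show ?thesis by linarith
  qed
  define m where "m f = (\<integral>y. (f y)\<^sup>2 \<partial>P)" for f :: "'a \<Rightarrow> real"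
  have m: "0 \<le> m f" "m f \<le> \<tau>\<^sup>2" if "f \<in> F" for f using var[OF that] by (auto simp: m_def)
  have \<tau>2: "\<tau>\<^sup>2 \<le> 1" using \<tau> by (simp add: power_le_one)
  let ?h = "\<lambda>f y. (f y)\<^sup>2 - m f" and ?q = "\<lambda>f y. (f y)\<^sup>2"
  have h: "ranged P (- 1) 1 (?h f)" if "f \<in> F" for f
  proof (rule rangedI)
    show "?h f \<in> borel_measurable P" using ranged_measurable[OF f[OF that]] by measurable
    show "- 1 \<le> ?h f y \<and> ?h f y \<le> 1" if "y \<in> space P" for y
      using ranged_bounds[OF sq[OF \<open>f \<in> F\<close>] that] m[OF \<open>f \<in> F\<close>] \<tau>2 by linarith
  qed
  have q: "ranged P (- 1) 1 (?q f)" if "f \<in> F" for f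
  proof (rule rangedI)
    show "?q f \<in> borel_measurable P" by (rule ranged_measurable[OF sq[OF that]])
    show "- 1 \<le> ?q f y \<and> ?q f y \<le> 1" if "y \<in> space P" for y
      using ranged_bounds[OF sq[OF \<open>f \<in> F\<close>] that] by linarith
  qed
  have h_mean: "(\<integral>y. ?h f y \<partial>P) = 0" if "f \<in> F" for f
    using P.integrable_ranged[OF sq[OF that]] by (simp add: P.prob_space m_def)
  have R_le: "R x \<le> n * \<tau>\<^sup>2 + max_abs_sum F ?h (\<lambda>_. 1) I x" for x
  proof -
    have nonneg: "0 \<le> max_abs_sum F ?h (\<lambda>_. 1) I x"
    proof -
      obtain f where "max_abs_sum F ?h (\<lambda>_. 1) I x = \<bar>\<Sum>i\<in>I. 1 * ?h f (x i)\<bar>"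
        by (rule max_abs_sum_attained[OF F])
      then show ?thesis by (simp only: abs_ge_zero)
    qed
    have "(\<Sum>i\<in>I. (f (x i))\<^sup>2) \<le> n * \<tau>\<^sup>2 + max_abs_sum F ?h (\<lambda>_. 1) I x" if "f \<in> F" for f
    proof -
      have "(\<Sum>i\<in>I. (f (x i))\<^sup>2) = n * m f + (\<Sum>i\<in>I. 1 * ?h f (x i))"
        by (simp add: sum_subtractf n_def)
      also have "(\<Sum>i\<in>I. 1 * ?h f (x i)) \<le> max_abs_sum F ?h (\<lambda>_. 1) I x"
        using max_abs_sum_ge[OF F(1) that, of "\<lambda>_. 1" ?h x I] by linarith
      also have "n * m f \<le> n * \<tau>\<^sup>2" using m[OF that] n by (intro mult_left_mono) auto
      finally show ?thesis by simp
    qed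
    then show ?thesis unfolding R_def using F nonneg by simp
  qed
  have h_le_q: "max_abs_sum F ?h (rsign S) I x \<le> max_abs_sum F ?q (rsign S) I x + n * \<tau>\<^sup>2" for S x
  proof -
    obtain f where f: "f \<in> F" "max_abs_sum F ?h (rsign S) I x = \<bar>\<Sum>i\<in>I. rsign S i * ?h f (x i)\<bar>"
      by (rule max_abs_sum_attained[OF F])
    have "(\<Sum>i\<in>I. rsign S i * ?h f (x i)) = (\<Sum>i\<in>I. rsign S i * ?q f (x i)) - (\<Sum>i\<in>I. rsign S i) * m f"
      by (simp add: algebra_simps sum_subtractf sum_distrib_left)
    moreover have "\<bar>(\<Sum>i\<in>I. rsign S i) * m f\<bar> \<le> n * \<tau>\<^sup>2"
    proof -
      have "\<bar>\<Sum>i\<in>I. rsign S i\<bar> \<le> (\<Sum>i\<in>I. \<bar>rsign S i\<bar>)" by (rule sum_abs)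
      also have "\<dots> \<le> n" using sum_bounded_above[of I "\<lambda>i. \<bar>rsign S i\<bar>" 1] rsign by (simp add: n_def)
      finally show ?thesis unfolding abs_mult using m[OF f(1)] n by (intro mult_mono) auto
    qed
    ultimately show ?thesis
      using max_abs_sum_ge[OF F(1) f(1), of "rsign S" ?q x I] f(2) by linarith
  qed
  have "D \<le> (\<integral>x. n * \<tau>\<^sup>2 + max_abs_sum F ?h (\<lambda>_. 1) I x \<partial>?Q)"
    unfolding D_def using Q.integrable_ranged[OF R] Q.integrable_ranged[OF ranged_max_abs_sum[OF F h _ I(1)]]
    by (intro integral_mono R_le Bochner_Integration.integrable_add) auto
  also have "\<dots> = n * \<tau>\<^sup>2 + (\<integral>x. max_abs_sum F ?h (\<lambda>_. 1) I x \<partial>?Q)"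
    using Q.integrable_ranged[OF ranged_max_abs_sum[OF F h _ I(1)]] by (simp add: Q.prob_space)
  also have "(\<integral>x. max_abs_sum F ?h (\<lambda>_. 1) I x \<partial>?Q)
      \<le> 2 * (\<integral>x. rad_avg I (\<lambda>S. max_abs_sum F ?h (rsign S) I x) \<partial>?Q)"
    by (rule symmetrization_rad_avg[OF P I(1) F h h_mean])
  also have "(\<integral>x. rad_avg I (\<lambda>S. max_abs_sum F ?h (rsign S) I x) \<partial>?Q)
      \<le> (\<integral>x. rad_avg I (\<lambda>S. max_abs_sum F ?q (rsign S) I x + n * \<tau>\<^sup>2) \<partial>?Q)"
    using int_rad[OF h] int_rad[OF q]
    by (intro integral_mono rad_avg_mono h_le_q) (simp_all add: rad_avg_add rad_avg_const[OF I(1)])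
  also have "\<dots> = (\<integral>x. rad_avg I (\<lambda>S. max_abs_sum F ?q (rsign S) I x) \<partial>?Q) + n * \<tau>\<^sup>2"
    using int_rad[OF q] by (simp add: rad_avg_add rad_avg_const[OF I(1)] Q.prob_space)
  also have "(\<integral>x. rad_avg I (\<lambda>S. max_abs_sum F ?q (rsign S) I x) \<partial>?Q) \<le> K * (2 * sqrt D)"
  proof (rule rad_le[OF _ q])
    fix f g y assume fg: "f \<in> F" "g \<in> F" "y \<in> space P"
    have "\<bar>f y + g y\<bar> \<le> 2" using abs1[OF fg(1,3)] abs1[OF fg(2,3)] by linarith
    then have "\<bar>f y + g y\<bar> * \<bar>f y - g y\<bar> \<le> 2 * \<bar>f y - g y\<bar>" by (rule mult_right_mono) simp
    moreover have "(f y)\<^sup>2 - (g y)\<^sup>2 = (f y + g y) * (f y - g y)" by (simp add: power2_eq_square algebra_simps)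
    ultimately show "\<bar>(f y)\<^sup>2 - (g y)\<^sup>2\<bar> \<le> 2 * \<bar>f y - g y\<bar>" by (simp add: abs_mult)
  next
    fix f y assume fy: "f \<in> F" "y \<in> space P"
    have "\<bar>f y\<bar> * \<bar>f y\<bar> \<le> 2 * \<bar>f y\<bar>" using abs1[OF fy] by (intro mult_right_mono) auto
    then show "\<bar>(f y)\<^sup>2\<bar> \<le> 2 * \<bar>f y\<bar>" by (simp add: power2_eq_square abs_mult)
  qed simp
  finally have "D \<le> 3 * (n * \<tau>\<^sup>2) + 4 * K * sqrt D" by simp
  moreover have "(sqrt D)\<^sup>2 = D" using D by simp
  moreover have "(sqrt (3 * (n * \<tau>\<^sup>2)))\<^sup>2 = 3 * (n * \<tau>\<^sup>2)" using nt(1) by simp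
  ultimately have "(sqrt D)\<^sup>2 \<le> (sqrt (3 * (n * \<tau>\<^sup>2)))\<^sup>2 + 4 * K * sqrt D" by linarith
  then have "sqrt D \<le> sqrt (3 * (n * \<tau>\<^sup>2)) + 4 * K"
    by (rule quadratic_bound) (use K(1) nt(1) in auto)
  then have "2 * (K * sqrt D) \<le> 2 * (K * (sqrt (3 * (n * \<tau>\<^sup>2)) + 4 * K))"
    using K by (intro mult_left_mono) auto
  also have "\<dots> = sqrt (4 * K\<^sup>2 * (3 * (n * \<tau>\<^sup>2))) + 8 * K\<^sup>2"
  proof -
    have "4 * K\<^sup>2 * (3 * (n * \<tau>\<^sup>2)) = (2 * K)\<^sup>2 * (3 * (n * \<tau>\<^sup>2))" by (simp add: power_mult_distrib)
    then have "sqrt (4 * K\<^sup>2 * (3 * (n * \<tau>\<^sup>2))) = 2 * K * sqrt (3 * (n * \<tau>\<^sup>2))"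
      using K(1) by (simp only: real_sqrt_mult[of "(2 * K)\<^sup>2"] real_sqrt_abs)
    then show ?thesis by (simp add: power2_eq_square algebra_simps)
  qed
  also have "\<dots> \<le> 40 * sqrt (d * (n * \<tau>\<^sup>2 * L)) + 1024 * real d * L"
  proof -
    have "0 \<le> L * (n * (d * \<tau>\<^sup>2))" using n L3 by (intro mult_nonneg_nonneg) auto
    then have "4 * K\<^sup>2 * (3 * (n * \<tau>\<^sup>2)) \<le> 40\<^sup>2 * (d * (n * \<tau>\<^sup>2 * L))"
      unfolding K(2) by (simp add: mult_ac)
    then have "sqrt (4 * K\<^sup>2 * (3 * (n * \<tau>\<^sup>2))) \<le> sqrt (40\<^sup>2 * (d * (n * \<tau>\<^sup>2 * L)))" by simp
    also have "\<dots> = 40 * sqrt (d * (n * \<tau>\<^sup>2 * L))" by (subst real_sqrt_mult) simp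
    finally show ?thesis unfolding K(2) by simp
  qed
  finally show ?thesis using EZ by (simp add: n_def L_def)
qed

section \<open>The tail bound\<close>

text \<open>Absolute values are absorbed by closing the class under negation.\<close>
lemma max_sum_symmetric_closure:
  assumes F: "finite F" "F \<noteq> {}"
  shows "max_sum (F \<union> (\<lambda>f y. - f y) ` F) I x = max_abs_sum F (\<lambda>f. f) (\<lambda>_. 1) I x"
proof -
  let ?G = "F \<union> (\<lambda>f y. - f y) ` F"
  have G: "finite ?G" "?G \<noteq> {}" using F by auto
  show ?thesis
  proof (rule antisym)
    obtain g where g: "g \<in> ?G" "max_sum ?G I x = (\<Sum>j\<in>I. g (x j))" by (rule max_sum_attained[OF G])
    then obtain f where f: "f \<in> F" "g = f \<or> g = (\<lambda>y. - f y)" by auto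
    then have "(\<Sum>j\<in>I. g (x j)) \<le> \<bar>\<Sum>j\<in>I. 1 * f (x j)\<bar>" by (auto simp: sum_negf)
    then show "max_sum ?G I x \<le> max_abs_sum F (\<lambda>f. f) (\<lambda>_. 1) I x"
      using max_abs_sum_ge[OF F(1) f(1), of "\<lambda>_. 1" "\<lambda>f. f" x I] g(2) by linarith
  next
    obtain f where f: "f \<in> F" "max_abs_sum F (\<lambda>f. f) (\<lambda>_. 1) I x = \<bar>\<Sum>j\<in>I. 1 * f (x j)\<bar>"
      by (rule max_abs_sum_attained[OF F])
    have "(\<Sum>j\<in>I. f (x j)) \<le> max_sum ?G I x" using f by (intro max_sum_ge G) auto
    moreover have "(\<Sum>j\<in>I. - f (x j)) \<le> max_sum ?G I x"
      using f max_sum_ge[OF G(1), of "\<lambda>y. - f y" x I] by auto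
    ultimately show "max_abs_sum F (\<lambda>f. f) (\<lambda>_. 1) I x \<le> max_sum ?G I x"
      unfolding f(2) by (simp add: sum_negf abs_le_iff)
  qed
qed

definition VC_mean_bound :: "nat \<Rightarrow> nat \<Rightarrow> real \<Rightarrow> real" where
  "VC_mean_bound d n \<tau> = 40 * sqrt (real d * (real n * \<tau>\<^sup>2 * ln (55 / \<tau>))) + 1024 * real d * ln (55 / \<tau>)"

lemma ln_55_div_ge: "3 \<le> ln (55 / \<tau>)" if "0 < \<tau>" "\<tau> \<le> 1" for \<tau> :: real
proof -
  have "ln 55 \<le> ln (55 / \<tau>)" using that by (intro ln_mono) (auto simp: field_simps)
  then show ?thesis using ln_55_bounds by linarith
qed

lemma VC_mean_bound_pos:
  assumes "0 < \<tau>" "\<tau> \<le> 1" "1 \<le> d"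
  shows "0 < VC_mean_bound d n \<tau>"
proof -
  have "0 < ln (55 / \<tau>)" using ln_55_div_ge[OF assms(1,2)] by linarith
  then show ?thesis unfolding VC_mean_bound_def using assms by (intro add_nonneg_pos mult_pos_pos) auto
qed

text \<open>Concentration for the class closed under negation, combined with the bound of the mean. The
  VC condition enters only through the mean, so it is asked of \<open>F\<close> and not of the closed class.\<close>
lemma VC_tail_finite:
  fixes P :: "'a measure" and I :: "'i set" and F :: "('a \<Rightarrow> real) set" and \<tau> :: real
  assumes P: "prob_space P" and I: "finite I" "I \<noteq> {}" and F: "finite F" "F \<noteq> {}"
    and f: "\<And>f. f \<in> F \<Longrightarrow> ranged P (- 1) 1 f"
    and mean: "\<And>f. f \<in> F \<Longrightarrow> (\<integral>y. f y \<partial>P) = 0"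
    and var: "\<And>f. f \<in> F \<Longrightarrow> (\<integral>y. (f y)\<^sup>2 \<partial>P) \<le> \<tau>\<^sup>2"
    and \<tau>: "0 < \<tau>" "\<tau> \<le> 1"
    and vc: "\<And>A. A \<subseteq> space P \<times> UNIV \<Longrightarrow> shatters (subgraph (space P) ` F) A \<Longrightarrow> card A \<le> d"
    and d: "1 \<le> d" and t: "0 < t"
    and u: "VC_mean_bound d (card I) \<tau>
      + 2 * sqrt ((real (card I) * \<tau>\<^sup>2 / 2 + VC_mean_bound d (card I) \<tau>) * t) + t \<le> u"
  shows "measure (PiM I (\<lambda>_. P)) {x\<in>space (PiM I (\<lambda>_. P)).
      u < max_abs_sum F (\<lambda>f. f) (\<lambda>_. 1) I x} \<le> exp (- t)"
proof -
  let ?Q = "PiM I (\<lambda>_. P)" and ?Z = "max_abs_sum F (\<lambda>f. f) (\<lambda>_. 1) I"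
  let ?E = "VC_mean_bound d (card I) \<tau>" and ?G = "F \<union> (\<lambda>f y. - f y) ` F"
  interpret Q: prob_space ?Q by (rule prob_space_PiM) (rule P)
  have Z: "max_sum ?G I = ?Z" by (rule ext) (rule max_sum_symmetric_closure[OF F])
  have [measurable]: "?Z \<in> borel_measurable ?Q"
    by (rule ranged_measurable[OF ranged_max_abs_sum[OF F f _ I(1)]]) auto
  have EZ: "(\<integral>x. max_sum ?G I x \<partial>?Q) \<le> ?E"
    unfolding Z VC_mean_bound_def by (rule expected_sup_VC_bound[OF P I F f mean var \<tau> vc d])
  have neg: "ranged P (- 1) 1 (\<lambda>y. - f y)" if "f \<in> F" for f
    using f[OF that] unfolding ranged_def by fastforce
  have "measure ?Q {x\<in>space ?Q. u < ?Z x}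
      \<le> measure ?Q {x\<in>space ?Q. ?E + 2 * sqrt ((real (card I) * \<tau>\<^sup>2 / 2 + ?E) * t) + t < ?Z x}"
    using u by (intro Q.finite_measure_mono) auto
  also have "\<dots> \<le> exp (- t)"
    unfolding Z[symmetric]
  proof (rule max_sum_tail[OF P I(1) _ _ _ _ _ EZ VC_mean_bound_pos[OF \<tau> d] _ t])
    show "finite ?G" "?G \<noteq> {}" using F by auto
    show "ranged P (- 1) 1 g" if "g \<in> ?G" for g using that f neg by auto
    show "(\<integral>y. g y \<partial>P) = 0" if "g \<in> ?G" for g using that mean by auto
    show "(\<integral>y. (g y)\<^sup>2 \<partial>P) \<le> \<tau>\<^sup>2" if "g \<in> ?G" for g using that var by auto
  qed simp
  finally show ?thesis .
qed

text \<open>The sample is a random element of the product space with distribution the product measure.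
  The event is the increasing union of the events for the finite families of the first
  \<open>k + 1\<close> functions of an enumeration, so that its probability is the limit of theirs.\<close>
lemma VC_tail_countable:
  fixes M :: "'w measure" and P :: "'a measure" and \<xi> :: "nat \<Rightarrow> 'w \<Rightarrow> 'a"
    and F :: "('a \<Rightarrow> real) set" and \<tau> :: real
  assumes M: "prob_space M" and n: "1 \<le> n"
    and indep: "prob_space.indep_vars M (\<lambda>_. P) \<xi> {1..n}"
    and distr: "\<And>i. i \<in> {1..n} \<Longrightarrow> distr M P (\<xi> i) = P"
    and F: "countable F" "F \<noteq> {}"
    and f: "\<And>f. f \<in> F \<Longrightarrow> ranged P (- 1) 1 f"
    and mean: "\<And>f. f \<in> F \<Longrightarrow> (\<integral>y. f y \<partial>P) = 0"
    and var: "\<And>f. f \<in> F \<Longrightarrow> (\<integral>y. (f y)\<^sup>2 \<partial>P) \<le> \<tau>\<^sup>2"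
    and \<tau>: "0 < \<tau>" "\<tau> \<le> 1"
    and vc: "\<And>A. A \<subseteq> space P \<times> UNIV \<Longrightarrow> shatters (subgraph (space P) ` F) A \<Longrightarrow> card A \<le> d"
    and d: "1 \<le> d" and t: "0 < t"
    and u: "VC_mean_bound d n \<tau> + 2 * sqrt ((real n * \<tau>\<^sup>2 / 2 + VC_mean_bound d n \<tau>) * t) + t \<le> u"
  shows "measure M {\<omega>\<in>space M. u < emp_sup n F \<xi> \<omega>} \<le> exp (- t)"
proof -
  interpret M: prob_space M by (rule M)
  let ?I = "{1..n}"
  let ?Q = "PiM ?I (\<lambda>_. P)"
  have \<xi>[measurable]: "\<xi> i \<in> measurable M P" if "i \<in> ?I" for i
    using indep that unfolding M.indep_vars_def by blast
  have P: "prob_space P" using M.prob_space_distr[OF \<xi>[of 1]] distr[of 1] n by simp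
  define X where "X \<omega> = (\<lambda>i\<in>?I. \<xi> i \<omega>)" for \<omega>
  have X: "X \<in> measurable M ?Q" unfolding X_def by (rule measurable_restrict) (rule \<xi>)
  have "distr M ?Q X = PiM ?I (\<lambda>i. distr M P (\<xi> i))"
    unfolding X_def using M.indep_vars_iff_distr_eq_PiM'[of ?I \<xi> "\<lambda>_. P"] indep n \<xi> by auto
  also have "\<dots> = ?Q" by (rule PiM_cong[OF refl]) (rule distr)
  finally have distrX: "distr M ?Q X = ?Q" .
  have bdd: "\<bar>\<Sum>i=1..n. f (\<xi> i \<omega>)\<bar> \<le> n" if "f \<in> F" "\<omega> \<in> space M" for f \<omega>
  proof -
    have "\<bar>f (\<xi> i \<omega>)\<bar> \<le> 1" if i: "i \<in> ?I" for i
      using ranged_bounds[OF f[OF \<open>f \<in> F\<close>] measurable_space[OF \<xi>[OF i] \<open>\<omega> \<in> space M\<close>]]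
      by (simp add: abs_le_iff minus_le_iff)
    then have "(\<Sum>i=1..n. \<bar>f (\<xi> i \<omega>)\<bar>) \<le> real n"
      using sum_bounded_above[of ?I "\<lambda>i. \<bar>f (\<xi> i \<omega>)\<bar>" 1] by simp
    then show ?thesis using sum_abs[of "\<lambda>i. f (\<xi> i \<omega>)" ?I] by linarith
  qed
  define F\<^sub>k where "F\<^sub>k k = from_nat_into F ` {..k}" for k :: nat
  have Fk: "finite (F\<^sub>k k)" "F\<^sub>k k \<noteq> {}" "F\<^sub>k k \<subseteq> F" for k
    using from_nat_into[OF F(2)] by (auto simp: F\<^sub>k_def)
  define A where "A k = {\<omega>\<in>space M. u < max_abs_sum (F\<^sub>k k) (\<lambda>f. f) (\<lambda>_. 1) ?I (X \<omega>)}" for k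
  have A_iff: "\<omega> \<in> A k \<longleftrightarrow> \<omega> \<in> space M \<and> (\<exists>f\<in>F\<^sub>k k. u < \<bar>\<Sum>i=1..n. f (\<xi> i \<omega>)\<bar>)" for \<omega> k
    using Fk[of k] by (auto simp: A_def max_abs_sum_def X_def Max_gr_iff)
  have Z: "max_abs_sum (F\<^sub>k k) (\<lambda>f. f) (\<lambda>_. 1) ?I \<in> borel_measurable ?Q" for k
    by (rule ranged_measurable[OF ranged_max_abs_sum[OF Fk(1,2)]]) (use f Fk(3) in auto)
  have A_vimage: "A k = X -` {x\<in>space ?Q. u < max_abs_sum (F\<^sub>k k) (\<lambda>f. f) (\<lambda>_. 1) ?I x} \<inter> space M" for k
    using measurable_space[OF X] by (auto simp: A_def)
  have sets_Q: "{x\<in>space ?Q. u < max_abs_sum (F\<^sub>k k) (\<lambda>f. f) (\<lambda>_. 1) ?I x} \<in> sets ?Q" for k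
    using Z[of k] by measurable
  have A_sets: "A k \<in> sets M" for k
    unfolding A_vimage by (rule measurable_sets[OF X sets_Q])
  have A_le: "measure M (A k) \<le> exp (- t)" for k
  proof -
    have "measure M (A k) = measure (distr M ?Q X) {x\<in>space ?Q. u < max_abs_sum (F\<^sub>k k) (\<lambda>f. f) (\<lambda>_. 1) ?I x}"
      unfolding A_vimage by (rule measure_distr[OF X sets_Q, symmetric])
    also have "\<dots> \<le> exp (- t)"
      unfolding distrX
    proof (rule VC_tail_finite[OF P _ _ Fk(1,2) _ _ _ \<tau> _ d t])
      show "card A \<le> d" if A: "A \<subseteq> space P \<times> UNIV" "shatters (subgraph (space P) ` F\<^sub>k k) A" for A
      proof (rule vc[OF A(1)])
        show "shatters (subgraph (space P) ` F) A"
          using A(2) Fk(3)[of k] unfolding shatters_def by (meson image_mono subsetD)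
      qed
    qed (use f mean var n u subsetD[OF Fk(3)[of k]] in auto)
    finally show ?thesis .
  qed
  have eq: "{\<omega>\<in>space M. u < emp_sup n F \<xi> \<omega>} = (\<Union>k. A k)"
  proof (intro set_eqI)
    fix \<omega>
    have "\<omega> \<in> (\<Union>k. A k) \<longleftrightarrow> \<omega> \<in> space M \<and> (\<exists>f\<in>(\<Union>k. F\<^sub>k k). u < \<bar>\<Sum>i=1..n. f (\<xi> i \<omega>)\<bar>)"
      by (auto simp: A_iff)
    also have "(\<Union>k. F\<^sub>k k) = range (from_nat_into F)" by (auto simp: F\<^sub>k_def)
    also have "\<dots> = F" by (rule range_from_nat_into[OF F(2,1)])
    also have "\<omega> \<in> space M \<and> (\<exists>f\<in>F. u < \<bar>\<Sum>i=1..n. f (\<xi> i \<omega>)\<bar>) \<longleftrightarrow> \<omega> \<in> space M \<and> u < emp_sup n F \<xi> \<omega>"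
    proof (intro conj_cong refl)
      assume "\<omega> \<in> space M"
      then have "bdd_above ((\<lambda>f. \<bar>\<Sum>i=1..n. f (\<xi> i \<omega>)\<bar>) ` F)" using bdd by (intro bdd_aboveI2)
      then show "(\<exists>f\<in>F. u < \<bar>\<Sum>i=1..n. f (\<xi> i \<omega>)\<bar>) \<longleftrightarrow> u < emp_sup n F \<xi> \<omega>"
        unfolding emp_sup_def by (rule less_cSUP_iff[OF F(2), symmetric])
    qed
    finally show "\<omega> \<in> {\<omega>\<in>space M. u < emp_sup n F \<xi> \<omega>} \<longleftrightarrow> \<omega> \<in> (\<Union>k. A k)" by simp
  qed
  have lim: "(\<lambda>k. measure M (A k)) \<longlonglongrightarrow> measure M (\<Union>k. A k)"
  proof (rule M.finite_Lim_measure_incseq)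
    show "range A \<subseteq> sets M" using A_sets by auto
    show "incseq A"
    proof (rule incseq_SucI)
      fix k
      have "F\<^sub>k k \<subseteq> F\<^sub>k (Suc k)" by (auto simp: F\<^sub>k_def)
      then show "A k \<subseteq> A (Suc k)" unfolding subset_iff A_iff by blast
    qed
  qed
  have "measure M (\<Union>k. A k) \<le> exp (- t)"
    by (rule LIMSEQ_le_const2[OF lim]) (use A_le in blast)
  with eq show ?thesis by (simp only:)
qed

text \<open>The square root is subadditive. Its variance part is half of
  \<open>\<tau> * sqrt (8 * n * x)\<close>, and its mean part is split by the arithmetic-geometric mean inequality for
  \<open>\<eta> * E\<close> and \<open>x / \<eta>\<close>.\<close>
lemma threshold_le:
  fixes E :: real
  assumes E: "0 < E" "E \<le> E'" and \<tau>: "0 < \<tau>" and \<eta>: "0 < \<eta>" and x: "0 < x"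
  shows "E + 2 * sqrt ((real n * \<tau>\<^sup>2 / 2 + E) * x) + x
      \<le> (1 + \<eta>) * E' + \<tau> * sqrt (8 * real n * x) + kappa \<eta> * x"
proof -
  have "sqrt ((real n * \<tau>\<^sup>2 / 2 + E) * x) \<le> sqrt (real n * \<tau>\<^sup>2 / 2 * x) + sqrt (E * x)"
    unfolding distrib_right using E x by (intro sqrt_add_le_add_sqrt) auto
  moreover have "2 * sqrt (real n * \<tau>\<^sup>2 / 2 * x) \<le> \<tau> * sqrt (8 * real n * x)"
  proof -
    have "2 * sqrt (real n * \<tau>\<^sup>2 / 2 * x) = sqrt (2\<^sup>2 * (real n * \<tau>\<^sup>2 / 2 * x))"
      by (subst real_sqrt_mult) simp
    also have "\<dots> \<le> sqrt (\<tau>\<^sup>2 * (8 * real n * x))" using x by (intro real_sqrt_le_mono) (simp add: field_simps)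
    also have "\<dots> = \<tau> * sqrt (8 * real n * x)" using \<tau> by (subst real_sqrt_mult) simp
    finally show ?thesis .
  qed
  moreover have "2 * sqrt (E * x) \<le> \<eta> * E + x / \<eta>"
    using arith_geo_mean_sqrt[of "\<eta> * E" "x / \<eta>"] E \<eta> x by simp
  moreover have "x / \<eta> + x \<le> kappa \<eta> * x"
  proof -
    have "0 \<le> x / \<eta>" using \<eta> x by simp
    moreover have "kappa \<eta> * x = 2.5 * x + 32 * (x / \<eta>)" by (simp add: kappa_def field_simps)
    ultimately show ?thesis using x by linarith
  qed
  moreover have "(1 + \<eta>) * E \<le> (1 + \<eta>) * E'" using E \<eta> by (intro mult_left_mono) auto
  ultimately show ?thesis by (simp add: algebra_simps)
qed

theorem theorem2:
  fixes M :: "'w measure" and P :: "'a measure"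
    and \<xi> :: "nat \<Rightarrow> 'w \<Rightarrow> 'a" and \<F> :: "('a \<Rightarrow> real) set"
    and n d :: nat and \<sigma> :: real
  assumes "prob_space M"
    and "n \<ge> 1"
    and "prob_space.indep_vars M (\<lambda>_. P) \<xi> {1..n}"
    and "\<And>i. i \<in> {1..n} \<Longrightarrow> distr M P (\<xi> i) = P"
    and "countable \<F>"
    and "\<F> \<subseteq> borel_measurable P"
    and "\<And>f. f \<in> \<F> \<Longrightarrow> centered P f"
    and "\<And>f. f \<in> \<F> \<Longrightarrow> sup_norm (space P) f \<le> 1"
    and "VC_subgraph_class_of_index (space P) \<F> d"
    and "d \<ge> 1"
    and "\<sigma> \<ge> 0"
    and "\<sigma>\<^sup>2 = (SUP f\<in>\<F>. prob_space.expectation M (\<lambda>\<omega>. (f (\<xi> 1 \<omega>))\<^sup>2))"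
  shows "\<forall>\<eta>>0. \<forall>x>0.
    (\<sigma> > 0 \<longrightarrow>
      measure M {\<omega> \<in> space M. emp_sup n \<F> \<xi> \<omega> >
          (1 + \<eta>) * (60 * sqrt (real d) * sqrt (real n * \<sigma>\<^sup>2 * ln (55 / \<sigma>))
                     + 14400 * real d * ln (55 / \<sigma>))
          + \<sigma> * sqrt (8 * real n * x) + kappa \<eta> * x} \<le> exp (- x)) \<and>
    measure M {\<omega> \<in> space M. emp_sup n \<F> \<xi> \<omega> >
          (1 + \<eta>) * (121 * sqrt (real d) * sqrt (real n) + 58000 * real d)
          + sqrt (8 * real n * x) + kappa \<eta> * x} \<le> exp (- x)"
proof -
  interpret M: prob_space M by (rule assms(1))
  have vc: "card A \<le> d" if "A \<subseteq> space P \<times> UNIV" "shatters (subgraph (space P) ` \<F>) A" for A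
    using assms(9) that unfolding VC_subgraph_class_of_index_def VC_class_of_index_def by blast
  have ne: "\<F> \<noteq> {}"
    using assms(9) unfolding VC_subgraph_class_of_index_def VC_class_of_index_def shatters_def by auto
  have \<xi>1: "\<xi> 1 \<in> measurable M P"
    using assms(2,3) unfolding M.indep_vars_def by auto
  have P: "prob_space P" using M.prob_space_distr[OF \<xi>1] assms(2,4) by simp
  interpret P: prob_space P by (rule P)
  have f: "ranged P (- 1) 1 f" if "f \<in> \<F>" for f
  proof (rule ranged_absI)
    show "f \<in> borel_measurable P" using assms(6) that by blast
    fix y assume "y \<in> space P"
    then have "ereal \<bar>f y\<bar> \<le> 1"
      using assms(8)[OF that] unfolding sup_norm_def by (simp add: SUP_le_iff)
    then show "\<bar>f y\<bar> \<le> 1" by (simp add: one_ereal_def)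
  qed
  have mean: "(\<integral>y. f y \<partial>P) = 0" if "f \<in> \<F>" for f
    using assms(7)[OF that] by (simp add: centered_def)
  have second: "M.expectation (\<lambda>\<omega>. (f (\<xi> 1 \<omega>))\<^sup>2) = (\<integral>y. (f y)\<^sup>2 \<partial>P)" if "f \<in> \<F>" for f
  proof -
    have "(\<lambda>y. (f y)\<^sup>2) \<in> borel_measurable P" using ranged_measurable[OF f[OF that]] by measurable
    then have "(\<integral>y. (f y)\<^sup>2 \<partial>distr M P (\<xi> 1)) = M.expectation (\<lambda>\<omega>. (f (\<xi> 1 \<omega>))\<^sup>2)"
      by (rule integral_distr[OF \<xi>1])
    then show ?thesis using assms(2,4) by simp
  qed
  have le1: "(\<integral>y. (f y)\<^sup>2 \<partial>P) \<le> 1" if "f \<in> \<F>" for f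
  proof -
    have "ranged P 0 1 (\<lambda>y. (f y)\<^sup>2)"
    proof (rule rangedI)
      show "(\<lambda>y. (f y)\<^sup>2) \<in> borel_measurable P" using ranged_measurable[OF f[OF that]] by measurable
      fix y assume "y \<in> space P"
      then have "\<bar>f y\<bar> \<le> 1" using ranged_bounds[OF f[OF that]] by (simp add: abs_le_iff minus_le_iff)
      then show "0 \<le> (f y)\<^sup>2 \<and> (f y)\<^sup>2 \<le> 1" by (simp add: abs_square_le_1)
    qed
    then show ?thesis using P.expectation_ranged by blast
  qed
  have \<sigma>2: "\<sigma>\<^sup>2 = (SUP f\<in>\<F>. \<integral>y. (f y)\<^sup>2 \<partial>P)"
    unfolding assms(12) using second by (rule SUP_cong[OF refl])
  have var: "(\<integral>y. (f y)\<^sup>2 \<partial>P) \<le> \<sigma>\<^sup>2" if "f \<in> \<F>" for f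
    unfolding \<sigma>2 using le1 by (intro cSUP_upper[OF that] bdd_aboveI2)
  have "\<sigma>\<^sup>2 \<le> 1" unfolding \<sigma>2 by (rule cSUP_least[OF ne le1])
  then have \<sigma>1: "\<sigma> \<le> 1" using assms(11) by (simp add: power_le_one_iff)
  have tail: "measure M {\<omega> \<in> space M. u < emp_sup n \<F> \<xi> \<omega>} \<le> exp (- t)"
    if "\<And>f. f \<in> \<F> \<Longrightarrow> (\<integral>y. (f y)\<^sup>2 \<partial>P) \<le> \<tau>\<^sup>2" "0 < \<tau>" "\<tau> \<le> 1" "0 < t"
      "VC_mean_bound d n \<tau> + 2 * sqrt ((real n * \<tau>\<^sup>2 / 2 + VC_mean_bound d n \<tau>) * t) + t \<le> u" for \<tau> t u :: real
    by (rule VC_tail_countable[OF assms(1-3) _ assms(5) ne _ _ _ that(2,3) _ assms(10) that(4,5)])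
       (fact assms(4) f mean that(1) vc)+
  show ?thesis
  proof (intro allI impI conjI)
    fix \<eta> x :: real
    assume \<eta>: "0 < \<eta>" and x: "0 < x" and \<sigma>: "0 < \<sigma>"
    have L: "3 \<le> ln (55 / \<sigma>)" by (rule ln_55_div_ge[OF \<sigma> \<sigma>1])
    have "VC_mean_bound d n \<sigma> \<le> 60 * sqrt (real d) * sqrt (real n * \<sigma>\<^sup>2 * ln (55 / \<sigma>))
        + 14400 * real d * ln (55 / \<sigma>)"
      unfolding VC_mean_bound_def real_sqrt_mult[of "real d"] mult.assoc
      using L by (intro add_mono mult_right_mono mult_nonneg_nonneg) auto
    note threshold = threshold_le[OF VC_mean_bound_pos[OF \<sigma> \<sigma>1 assms(10)] this \<sigma> \<eta> x, of n]
    show "measure M {\<omega> \<in> space M. emp_sup n \<F> \<xi> \<omega> >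
          (1 + \<eta>) * (60 * sqrt (real d) * sqrt (real n * \<sigma>\<^sup>2 * ln (55 / \<sigma>))
                     + 14400 * real d * ln (55 / \<sigma>))
          + \<sigma> * sqrt (8 * real n * x) + kappa \<eta> * x} \<le> exp (- x)"
      by (rule tail[OF var \<sigma> \<sigma>1 x threshold])
  next
    fix \<eta> x :: real
    assume \<eta>: "0 < \<eta>" and x: "0 < x"
    have "sqrt (ln 55) \<le> sqrt ((121 / 40)\<^sup>2)"
      using ln_55_bounds by (intro real_sqrt_le_mono) (simp add: power2_eq_square)
    then have s: "40 * sqrt (ln 55) \<le> 121" by simp
    have "40 * sqrt (real d * (real n * 1\<^sup>2 * ln (55 / 1))) = (40 * sqrt (ln 55)) * (sqrt d * sqrt n)"
      by (simp add: real_sqrt_mult)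
    also have "\<dots> \<le> 121 * (sqrt d * sqrt n)" by (rule mult_right_mono[OF s]) simp
    finally have "40 * sqrt (real d * (real n * 1\<^sup>2 * ln (55 / 1))) \<le> 121 * sqrt (real d) * sqrt (real n)"
      by (simp only: mult.assoc)
    moreover have "1024 * real d * ln (55 / 1) \<le> 1024 * real d * 6"
      using ln_55_bounds by (intro mult_left_mono) auto
    ultimately have "VC_mean_bound d n 1 \<le> 121 * sqrt (real d) * sqrt (real n) + 58000 * real d"
      unfolding VC_mean_bound_def by simp
    from threshold_le[where n = n and \<tau> = 1, OF VC_mean_bound_pos[OF _ _ assms(10)] this _ \<eta> x]
    have threshold: "VC_mean_bound d n 1 + 2 * sqrt ((real n * 1\<^sup>2 / 2 + VC_mean_bound d n 1) * x) + x
        \<le> (1 + \<eta>) * (121 * sqrt (real d) * sqrt (real n) + 58000 * real d)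
          + sqrt (8 * real n * x) + kappa \<eta> * x" by simp
    show "measure M {\<omega> \<in> space M. emp_sup n \<F> \<xi> \<omega> >
          (1 + \<eta>) * (121 * sqrt (real d) * sqrt (real n) + 58000 * real d)
          + sqrt (8 * real n * x) + kappa \<eta> * x} \<le> exp (- x)"
      by (rule tail[OF _ _ _ x threshold]) (use le1 in auto)
  qed
qed

end
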